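(* Consider Wyner's symmetric network under Model 1 with both Tx- and Rx-cooperation and a total of $D$ cooperation rounds, as defined in the context, and let $\rho_f\in[0,1]$. For $\rho\in(0,1)$, every achievable MG pair $(S^{(U)},S^{(e)})$ satisfies $$S^{(U)}\le\frac{\rho\rho_f}{2},\qquad S^{(e)}+S^{(U)}\le \rho-\frac{(1-\rho)\rho^{D+2}}{1-\rho^{D+2}}.$$ For $\rho=1$, every achievable MG pair satisfies $$S^{(U)}\le\frac{\rho\rho_f}{2},\qquad S^{(e)}+S^{(U)}\le\rho\,\frac{D+1}{D+2}.$$
   Context: Throughout, $D$ is a positive even integer. Wyner's symmetric network: for each $K$ there are $K$ transmitters (Txs) and $K$ receivers (Rxs), indexed by $\mathcal K=\{1,\dots,K\}$. Activity. Each Tx $k$ is active ($A_k=1$) with probability $\rho$, independently over $k$, and $A_k=0$ otherwise. Given that Tx $k$ is active, $B_k=1$ with probability $\rho_f$, independently of everything else, and $B_k=0$ otherwise. Let $\mathcal K_{active}=\{k:A_k=1\}$, $\mathcal K_{URLLC}=\{k:A_k=1,B_k=1\}$. Model 1: every active Tx has an eMBB message, i.e. $\mathcal K_{eMBB}=\mathcal K_{active}$, and each Tx in $\mathcal K_{URLLC}$ additionally has a URLLC message. Write $\mathbf A,\mathbf B$ for the activity tuples; all terminals know $(\mathbf A,\mathbf B)$. Messages. For blocklength $n$, the eMBB message $M_k^{(e)}$ ($k\in\mathcal K_{eMBB}$) is uniform on $\{1,\dots,\lfloor 2^{nR_k^{(e)}}\rfloor\}$, where $R_k^{(e)}$ may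 depend on $k$ and on $(\mathbf A,\mathbf B)$. The URLLC message $M_k^{(U)}$ ($k\in\mathcal K_{URLLC}$) is uniform on $\{1,\dots,\lfloor 2^{nR^{(U)}}\rfloor\}$, with the same rate $R^{(U)}$ for all $k$, not depending on $(\mathbf A,\mathbf B)$. Messages are independent. Channel. For $t=1,\dots,n$, $Y_{k,t}=h_{k,k}X_{k,t}+\sum_{\tilde k\in\{k-1,k+1\}}h_{\tilde k,k}X_{\tilde k,t}+Z_{k,t}$, where indices outside $\mathcal K$ are ignored, inactive Txs send zero, the $h_{\tilde k,k}\ge 0$ are fixed real numbers, and the $Z_{k,t}$ are i.i.d. standard Gaussian, independent of all messages. The neighbours of $k$ are $\mathcal N_k=\{k-1,k+1\}\cap\mathcal K$. Communication. (i) $D_{Tx}$ Tx-cooperation rounds: in each round every active Tx $k$ sends to each active neighbour $\ell\in\mathcal N_k$ over a noise-free link of unlimited capacity an arbitrary function of its eMBB message (if it has one), the cooperation messages it received in previous rounds, and $(\mathbf A,\mathbf B)$ (not of URLLC messages). (ii) Each active Tx $k$ computes $X_k^n$ as a function of its own URLLC and eMBB messages (those that exist), all cooperation messages it received, and $(\mathbf A,\mathbf B)$, subject to $\frac1n\sum_{t=1}^n X_{k,t}^2\le P$ almost surely. (iii) Each Rx $k\in\mathcal K_{URLLC}$ decodes $M_k^{(U)}$ from $Y_k^n$ and $(\mathbf A,\mathbf B)$ only. (iv) $D_{Rx}$ Rx-cooperation rounds: in each round every active Rx $k$ sends to each active neighbour over a noise-free link of unlimited capacity an arbitrary function of $Y_k^n$,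 the cooperation messages it received in previous rounds, and $(\mathbf A,\mathbf B)$. (v) Each Rx $k\in\mathcal K_{eMBB}$ decodes $M_k^{(e)}$ from $Y_k^n$, all cooperation messages it received, and $(\mathbf A,\mathbf B)$. Setup with both Tx- and Rx-cooperation: $D_{Tx},D_{Rx}\ge 0$ are integers that can be chosen freely subject to $D_{Tx}+D_{Rx}=D$. Achievability. For given $P,K$, a pair $(R^{(U)}(P),\bar R_K^{(e)}(P))$ is $D$-achievable if there exist rates $R_k^{(e)}$ with $\bar R_K^{(e)}\le \mathbb E_{\mathbf A,\mathbf B}\big[\frac1K\sum_{k\in\mathcal K_{eMBB}}R_k^{(e)}\big]$, a choice of integers $D_{Tx},D_{Rx}\ge 0$ with $D_{Tx}+D_{Rx}=D$, and Tx-cooperation functions (of the own eMBB message, the previously received Tx-cooperation messages and $(\mathbf A,\mathbf B)$), encoding functions (of the own messages, the received Tx-cooperation messages and $(\mathbf A,\mathbf B)$, obeying the power constraint $\frac1n\sum_{t=1}^n X_{k,t}^2\le P$ almost surely), URLLC decoding functions (of $Y_k^n$ and $(\mathbf A,\mathbf B)$), Rx-cooperation functions (of $Y_k^n$, the previously received Rx-cooperation messages and $(\mathbf A,\mathbf B)$) and eMBB decoding functions (of $Y_k^n$, all received Rx-cooperation messages and $(\mathbf A,\mathbf B)$) such that the probability that some URLLC message ($k\in\mathcal K_{URLLC}$) or some eMBB message ($k\in\mathcal K_{eMBB}$) is decoded incorrectly tends to $0$ as $n\to\infty$. A multiplexing gain (MG) pair $(S^{(U)},S^{(e)})$ is ($D$-)achievable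 if for all $P>0$ (and all $K$) there exist $D$-achievable rates with $S^{(U)}=\rho\rho_f\,\varlimsup_{K\to\infty}\varlimsup_{P\to\infty}\frac{R^{(U)}(P)}{\frac12\log P}$ and $S^{(e)}=\varlimsup_{K\to\infty}\varlimsup_{P\to\infty}\frac{\bar R_K^{(e)}(P)}{\frac12\log P}$.
   Formalization: Cross gains between neighbours are assumed strictly positive (with zero gains S^U = ρρ_f is achievable), and the two upper limits defining S^U and S^e must be attained along common sequences of K and P (otherwise alternating schemes over P violate the sum bound). *)

theory Defs
  imports "HOL-Probability.Probability"
begin

section \<open>Users and random activity\<close>

text \<open>
  An activity pattern assigns to every user \<open>k\<close> the pair \<open>(A\<^sub>k, B\<^sub>k)\<close>. Users are the elements of
  \<open>{1..K}\<close>; outside this set a random activity pattern is constantly \<open>(False, False)\<close>.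
\<close>

type_synonym activity = "nat \<Rightarrow> bool \<times> bool"

definition user_pmf :: "real \<Rightarrow> real \<Rightarrow> (bool \<times> bool) pmf" where
  "user_pmf \<rho> \<rho>\<^sub>f = bind_pmf (bernoulli_pmf \<rho>) (\<lambda>a.
     if a then map_pmf (\<lambda>b. (True, b)) (bernoulli_pmf \<rho>\<^sub>f) else return_pmf (False, False))"

definition activity_pmf :: "real \<Rightarrow> real \<Rightarrow> nat \<Rightarrow> activity pmf" where
  "activity_pmf \<rho> \<rho>\<^sub>f K = Pi_pmf {1..K} (False, False) (\<lambda>_. user_pmf \<rho> \<rho>\<^sub>f)"

definition active_users :: "nat \<Rightarrow> activity \<Rightarrow> nat set" where
  "active_users K s = {k \<in> {1..K}. fst (s k)}"

definition urllc_users :: "nat \<Rightarrow> activity \<Rightarrow> nat set" where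
  "urllc_users K s = {k \<in> {1..K}. fst (s k) \<and> snd (s k)}"

text \<open>Model 1: every active user has an eMBB message.\<close>

definition embb_users :: "nat \<Rightarrow> activity \<Rightarrow> nat set" where
  "embb_users K s = active_users K s"

definition neighbours :: "nat \<Rightarrow> nat \<Rightarrow> nat set" where
  "neighbours K k = {l \<in> {1..K}. l = k + 1 \<or> k = l + 1}"


section \<open>Messages and noise\<close>

definition message_set :: "nat \<Rightarrow> real \<Rightarrow> nat set" where
  "message_set n R = {1..nat \<lfloor>2 powr (real n * R)\<rfloor>}"

text \<open>
  The joint law of the eMBB messages and the URLLC messages for a given activity pattern; \<open>R k\<close> is
  the eMBB rate of user \<open>k\<close>. Messages that do not exist are represented by the constant \<open>0\<close>.
\<close>

definition message_pmf ::
    "nat \<Rightarrow> nat \<Rightarrow> activity \<Rightarrow> (nat \<Rightarrow> real) \<Rightarrow> real \<Rightarrow> ((nat \<Rightarrow> nat) \<times> (nat \<Rightarrow> nat)) pmf" where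
  "message_pmf K n s R RU = pair_pmf
     (Pi_pmf (embb_users K s) 0 (\<lambda>k. pmf_of_set (message_set n (R k))))
     (Pi_pmf (urllc_users K s) 0 (\<lambda>k. pmf_of_set (message_set n RU)))"

definition noise_measure :: "nat \<Rightarrow> nat \<Rightarrow> (nat \<times> nat \<Rightarrow> real) measure" where
  "noise_measure K n = PiM ({1..K} \<times> {..<n}) (\<lambda>_. std_normal_distribution)"


section \<open>Cooperation rounds\<close>

text \<open>
  \<open>coop_history K s c obs r k i l\<close> is what terminal \<open>k\<close> received from terminal \<open>l\<close> in round \<open>i\<close>,
  after the rounds \<open>0, ..., r - 1\<close> have taken place. The function \<open>c i l k\<close> used by \<open>l\<close> in round \<open>i\<close>
  for the link to \<open>k\<close> has as arguments the local observation of \<open>l\<close> and everything \<open>l\<close> received in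
  earlier rounds. The constant \<open>undefined\<close> stands for the absence of a message.
\<close>

primrec coop_history ::
    "nat \<Rightarrow> activity \<Rightarrow> (nat \<Rightarrow> nat \<Rightarrow> nat \<Rightarrow> 'o \<Rightarrow> (nat \<Rightarrow> nat \<Rightarrow> 'm) \<Rightarrow> 'm) \<Rightarrow> (nat \<Rightarrow> 'o)
       \<Rightarrow> nat \<Rightarrow> nat \<Rightarrow> nat \<Rightarrow> nat \<Rightarrow> 'm" where
  "coop_history K s c obs 0 = (\<lambda>k i l. undefined)"
| "coop_history K s c obs (Suc r) = (\<lambda>k i l.
     if i = r then
       (if k \<in> active_users K s \<and> l \<in> active_users K s \<and> l \<in> neighbours K k
        then c r l k (obs l) (coop_history K s c obs r l) else undefined)
     else coop_history K s c obs r k i l)"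


section \<open>Codes\<close>

text \<open>
  A code for one blocklength. Since all terminals know the activity pattern, every component takes
  it as its first argument. Transmitter cooperation only carries functions of finitely many
  messages, so natural numbers suffice for links of unlimited capacity; receivers exchange real
  sequences, each of which can hold any finite collection of real vectors.
\<close>

record code =
  tx_coop :: "activity \<Rightarrow> nat \<Rightarrow> nat \<Rightarrow> nat \<Rightarrow> nat \<Rightarrow> (nat \<Rightarrow> nat \<Rightarrow> nat) \<Rightarrow> nat"
    \<comment> \<open>round, sender, addressee, own eMBB message, received messages\<close>
  encode :: "activity \<Rightarrow> nat \<Rightarrow> nat \<Rightarrow> nat \<Rightarrow> (nat \<Rightarrow> nat \<Rightarrow> nat) \<Rightarrow> nat \<Rightarrow> real"
    \<comment> \<open>user, own eMBB message, own URLLC message, received messages, time\<close>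
  decode_urllc :: "activity \<Rightarrow> nat \<Rightarrow> (nat \<Rightarrow> real) \<Rightarrow> nat"
    \<comment> \<open>user, own channel outputs\<close>
  rx_coop :: "activity \<Rightarrow> nat \<Rightarrow> nat \<Rightarrow> nat \<Rightarrow> (nat \<Rightarrow> real) \<Rightarrow> (nat \<Rightarrow> nat \<Rightarrow> nat \<Rightarrow> real) \<Rightarrow> nat \<Rightarrow> real"
    \<comment> \<open>round, sender, addressee, own channel outputs, received messages\<close>
  decode_embb :: "activity \<Rightarrow> nat \<Rightarrow> (nat \<Rightarrow> real) \<Rightarrow> (nat \<Rightarrow> nat \<Rightarrow> nat \<Rightarrow> real) \<Rightarrow> nat"
    \<comment> \<open>user, own channel outputs, received messages\<close>

text \<open>
  Receiver-side functions are Borel measurable, so that error probabilities make sense.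
  Transmitter-side functions have discrete arguments.
\<close>

definition measurable_code :: "code \<Rightarrow> bool" where
  "measurable_code C \<longleftrightarrow>
     (\<forall>s k. decode_urllc C s k \<in> measurable borel (count_space UNIV)) \<and>
     (\<forall>s i k l. (\<lambda>(y, H). rx_coop C s i k l y H) \<in> borel_measurable borel) \<and>
     (\<forall>s k. (\<lambda>(y, H). decode_embb C s k y H) \<in> measurable borel (count_space UNIV))"

definition channel_input ::
    "nat \<Rightarrow> nat \<Rightarrow> code \<Rightarrow> activity \<Rightarrow> (nat \<Rightarrow> nat) \<Rightarrow> (nat \<Rightarrow> nat) \<Rightarrow> nat \<Rightarrow> nat \<Rightarrow> real" where
  "channel_input K DTx C s me mu k t =
     (if k \<in> active_users K s
      then encode C s k (me k) (mu k) (coop_history K s (tx_coop C s) me DTx k) t else 0)"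

text \<open>
  \<open>h l k\<close> is the gain from transmitter \<open>l\<close> to receiver \<open>k\<close>. Times are \<open>0, ..., n - 1\<close>; the output
  sequence is padded by zeros.
\<close>

definition channel_output ::
    "(nat \<Rightarrow> nat \<Rightarrow> real) \<Rightarrow> nat \<Rightarrow> nat \<Rightarrow> (nat \<Rightarrow> nat \<Rightarrow> real) \<Rightarrow> (nat \<times> nat \<Rightarrow> real)
       \<Rightarrow> nat \<Rightarrow> nat \<Rightarrow> real" where
  "channel_output h K n x z k t =
     (if t < n then h k k * x k t + (\<Sum>l\<in>neighbours K k. h l k * x l t) + z (k, t) else 0)"

definition decoding_error ::
    "(nat \<Rightarrow> nat \<Rightarrow> real) \<Rightarrow> nat \<Rightarrow> nat \<Rightarrow> nat \<Rightarrow> nat \<Rightarrow> code \<Rightarrow> activity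
       \<Rightarrow> (nat \<Rightarrow> nat) \<Rightarrow> (nat \<Rightarrow> nat) \<Rightarrow> (nat \<times> nat \<Rightarrow> real) \<Rightarrow> bool" where
  "decoding_error h K n DTx DRx C s me mu z \<longleftrightarrow>
     (let Y = channel_output h K n (channel_input K DTx C s me mu) z in
       (\<exists>k\<in>urllc_users K s. decode_urllc C s k (Y k) \<noteq> mu k) \<or>
       (\<exists>k\<in>embb_users K s. decode_embb C s k (Y k) (coop_history K s (rx_coop C s) Y DRx k) \<noteq> me k))"

definition error_prob ::
    "(nat \<Rightarrow> nat \<Rightarrow> real) \<Rightarrow> real \<Rightarrow> real \<Rightarrow> nat \<Rightarrow> nat \<Rightarrow> nat \<Rightarrow> nat
       \<Rightarrow> (activity \<Rightarrow> nat \<Rightarrow> real) \<Rightarrow> real \<Rightarrow> code \<Rightarrow> real" where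
  "error_prob h \<rho> \<rho>\<^sub>f K n DTx DRx R RU C =
     measure_pmf.expectation (activity_pmf \<rho> \<rho>\<^sub>f K) (\<lambda>s.
       measure_pmf.expectation (message_pmf K n s (R s) RU) (\<lambda>(me, mu).
         measure (noise_measure K n)
           {z \<in> space (noise_measure K n). decoding_error h K n DTx DRx C s me mu z}))"

definition power_constraint ::
    "real \<Rightarrow> real \<Rightarrow> nat \<Rightarrow> nat \<Rightarrow> nat \<Rightarrow> (activity \<Rightarrow> nat \<Rightarrow> real) \<Rightarrow> real \<Rightarrow> real \<Rightarrow> code \<Rightarrow> bool" where
  "power_constraint \<rho> \<rho>\<^sub>f K n DTx R RU P C \<longleftrightarrow>
     (AE s in measure_pmf (activity_pmf \<rho> \<rho>\<^sub>f K).
      AE (me, mu) in measure_pmf (message_pmf K n s (R s) RU).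
        \<forall>k\<in>active_users K s. (1 / real n) * (\<Sum>t<n. (channel_input K DTx C s me mu k t)\<^sup>2) \<le> P)"


section \<open>Achievable rates and multiplexing gains\<close>

definition achievable_rates ::
    "(nat \<Rightarrow> nat \<Rightarrow> real) \<Rightarrow> real \<Rightarrow> real \<Rightarrow> nat \<Rightarrow> nat \<Rightarrow> real \<Rightarrow> real \<Rightarrow> real \<Rightarrow> bool" where
  "achievable_rates h \<rho> \<rho>\<^sub>f D K P RU Rbar \<longleftrightarrow>
     (\<exists>R DTx DRx C.
        0 \<le> RU \<and> (\<forall>s k. 0 \<le> R s k) \<and>
        Rbar \<le> measure_pmf.expectation (activity_pmf \<rho> \<rho>\<^sub>f K)
                  (\<lambda>s. (1 / real K) * (\<Sum>k\<in>embb_users K s. R s k)) \<and>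
        DTx + DRx = D \<and>
        (\<forall>n. measurable_code (C n) \<and> power_constraint \<rho> \<rho>\<^sub>f K n DTx R RU P (C n)) \<and>
        (\<lambda>n. error_prob h \<rho> \<rho>\<^sub>f K n DTx DRx R RU (C n)) \<longlonglongrightarrow> 0)"

definition pre_log :: "(nat \<Rightarrow> real \<Rightarrow> real) \<Rightarrow> nat \<Rightarrow> real \<Rightarrow> ereal" where
  "pre_log R K P = ereal (R K P / (1 / 2 * log 2 P))"

definition upper_pre_log :: "(nat \<Rightarrow> real \<Rightarrow> real) \<Rightarrow> ereal" where
  "upper_pre_log R = limsup (\<lambda>K. Limsup at_top (pre_log R K))"

text \<open>
  The two upper limits of a multiplexing gain pair must be attained simultaneously, that is, along
  common sequences of network sizes and powers. Without this requirement one could serve only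
  URLLC messages for some powers and only eMBB messages for the others, and the two upper limits
  would not describe any joint operation of the network; the sum of the gains would then not obey
  the trade-off. The requirement holds in particular whenever the limits exist.
\<close>

definition jointly_attained :: "(nat \<Rightarrow> real \<Rightarrow> real) \<Rightarrow> (nat \<Rightarrow> real \<Rightarrow> real) \<Rightarrow> bool" where
  "jointly_attained R R' \<longleftrightarrow>
     (\<exists>\<kappa> p u u'.
        filterlim \<kappa> at_top sequentially \<and>
        (\<forall>j. filterlim (p j) at_top sequentially \<and>
             (\<lambda>i. pre_log R (\<kappa> j) (p j i)) \<longlonglongrightarrow> u j \<and>
             (\<lambda>i. pre_log R' (\<kappa> j) (p j i)) \<longlonglongrightarrow> u' j) \<and>
        u \<longlonglongrightarrow> upper_pre_log R \<and> u' \<longlonglongrightarrow> upper_pre_log R')"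

definition achievable_mg_pair ::
    "(nat \<Rightarrow> nat \<Rightarrow> real) \<Rightarrow> real \<Rightarrow> real \<Rightarrow> nat \<Rightarrow> ereal \<Rightarrow> ereal \<Rightarrow> bool" where
  "achievable_mg_pair h \<rho> \<rho>\<^sub>f D SU Se \<longleftrightarrow>
     (\<exists>RU Rbar.
        (\<forall>K\<ge>1. \<forall>P>0. achievable_rates h \<rho> \<rho>\<^sub>f D K P (RU K P) (Rbar K P)) \<and>
        SU = ereal (\<rho> * \<rho>\<^sub>f) * upper_pre_log RU \<and>
        Se = upper_pre_log Rbar \<and>
        jointly_attained RU Rbar)"

end

theory Submission
  imports Defs
begin

text \<open>
  The converse is a volume argument for a fixed activity pattern. In every run of \<open>L\<close> consecutive
  active users one can discard the outputs of \<open>L div (D + 2)\<close> receivers in such a way that the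
  remaining outputs still determine everything up to bounded noise: around suitable users (seeds)
  all receivers within distance \<open>D\<close> are kept, so that after \<open>D\<close> rounds of cooperation all messages
  on which the input of a seed depends are decoded; starting from the seeds, the kept outputs give
  noisy versions of all inputs along the run, and hence of the discarded outputs. The differences
  between the discarded outputs and these reconstructions depend on the noise only. The map from
  the noise to the kept outputs and these differences preserves volume, and its images of the sets
  of successfully decoded noises are disjoint for different messages. As the kept outputs have power
  \<open>O(P)\<close> and the differences have bounded power, the number of messages is at most
  \<open>(c P) ^ (n g / 2)\<close>, where \<open>g\<close> is the number of kept outputs. Taking expectations over the activity
  turns the number of discarded receivers into the number of users whose position in their run is a
  multiple of \<open>D + 2\<close>.

  For the URLLC rate, the same argument is applied to two neighbouring URLLC users: given all other
  messages, the output of the first receiver determines both URLLC messages up to bounded noise,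
  since URLLC messages are not shared between transmitters.
\<close>

section \<open>Volume bound for decodable messages\<close>

text \<open>Counting disjoint sets of noise takes the place of Fano's inequality, and it only uses
  that the error probability of each pattern is eventually at most \<open>1 / 4\<close>. Factors
  exponential in \<open>n\<close> but free of \<open>P\<close> are harmless, since constants vanish
  against \<open>log 2 P\<close>. Hence each rate bound fixes its constant before the power and the
  rates, one constant for each of the finitely many patterns.

  An output involves three consecutive inputs, so two adjacent inputs must be known to start the
  reconstruction: seeds come in pairs. A sweep from the seeds on the left ends with the input of the
  first of two adjacent cut users, a sweep from the right with that of the second: cuts come in
  pairs too. The two cooperation phases together carry information over distance
  \<open>DTx + DRx = D\<close>, so seeds and cuts must be more than \<open>D\<close> apart. Pairs at
  \<open>j * E, j * E + 1\<close> and at \<open>(j + 1) * E, (j + 1) * E + 1\<close> have gap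
  \<open>E - 1\<close>, and \<open>E = D + 2\<close> is the least value that works. Two cuts in
  every \<open>2 * E\<close> users make one in \<open>D + 2\<close>.\<close>

abbreviation lborel_on :: "'i set \<Rightarrow> ('i \<Rightarrow> real) measure" where
  "lborel_on I \<equiv> PiM I (\<lambda>_. lborel)"

section \<open>Translations and shears preserve Lebesgue measure\<close>

lemma product_sigma_finite_lborel: "product_sigma_finite (\<lambda>_. lborel :: real measure)"
  by standard

lemma distr_lborel_on_translate:
  fixes c :: "'i \<Rightarrow> real"
  assumes "finite I"
  shows "distr (lborel_on I) (lborel_on I) (\<lambda>x. \<lambda>i\<in>I. x i + c i) = lborel_on I"
proof -
  interpret product_sigma_finite "\<lambda>_::'i. lborel :: real measure"
    by (rule product_sigma_finite_lborel)
  have meas: "(\<lambda>x. \<lambda>i\<in>I. x i + c i) \<in> measurable (lborel_on I) (lborel_on I)"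
    by (intro measurable_restrict) measurable
  show ?thesis
  proof (rule PiM_eqI[OF assms])
    fix A :: "'i \<Rightarrow> real set" assume A: "\<And>i. i \<in> I \<Longrightarrow> A i \<in> sets lborel"
    have A': "(\<lambda>x. x + c i) -` A i \<in> sets borel" if "i \<in> I" for i
      using A[OF that] measurable_sets[of "\<lambda>x::real. x + c i" borel borel "A i"] by simp
    have pre: "(\<lambda>x. \<lambda>i\<in>I. x i + c i) -` PiE I A \<inter> space (lborel_on I)
        = PiE I (\<lambda>i. (\<lambda>x. x + c i) -` A i)"
      by (auto simp: space_PiM PiE_iff)
    have "emeasure (distr (lborel_on I) (lborel_on I) (\<lambda>x. \<lambda>i\<in>I. x i + c i)) (PiE I A)
        = emeasure (lborel_on I) (PiE I (\<lambda>i. (\<lambda>x. x + c i) -` A i))"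
      using A by (subst emeasure_distr[OF meas]) (auto simp: pre intro!: sets_PiM_I_finite assms)
    also have "\<dots> = (\<Prod>i\<in>I. emeasure lborel ((\<lambda>x. x + c i) -` A i))"
      using A' by (subst emeasure_PiM) (auto simp: assms)
    also have "\<dots> = (\<Prod>i\<in>I. emeasure lborel (A i))"
    proof (rule prod.cong[OF refl])
      fix i assume i: "i \<in> I"
      have "emeasure lborel (A i) = emeasure (distr lborel borel ((+) (c i))) (A i)"
        by (simp add: lborel_distr_plus)
      also have "\<dots> = emeasure lborel ((\<lambda>x. x + c i) -` A i)"
        using A[OF i] by (subst emeasure_distr) (auto simp: add.commute[of _ "c i"])
      finally show "emeasure lborel ((\<lambda>x. x + c i) -` A i) = emeasure lborel (A i)" by simp
    qed
    finally show "emeasure (distr (lborel_on I) (lborel_on I) (\<lambda>x. \<lambda>i\<in>I. x i + c i)) (PiE I A)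
        = (\<Prod>i\<in>I. emeasure lborel (A i))" .
  qed simp
qed

lemma nn_integral_lborel_on_translate:
  assumes "finite I" and "f \<in> borel_measurable (lborel_on I)"
  shows "(\<integral>\<^sup>+x. f (\<lambda>i\<in>I. x i + c i) \<partial>lborel_on I) = (\<integral>\<^sup>+x. f x \<partial>lborel_on I)"
proof -
  have meas: "(\<lambda>x. \<lambda>i\<in>I. x i + c i) \<in> measurable (lborel_on I) (lborel_on I)"
    by (intro measurable_restrict) measurable
  have "(\<integral>\<^sup>+x. f x \<partial>lborel_on I)
      = (\<integral>\<^sup>+x. f x \<partial>distr (lborel_on I) (lborel_on I) (\<lambda>x. \<lambda>i\<in>I. x i + c i))"
    by (simp only: distr_lborel_on_translate[OF assms(1)])
  also have "\<dots> = (\<integral>\<^sup>+x. f (\<lambda>i\<in>I. x i + c i) \<partial>lborel_on I)"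
    by (rule nn_integral_distr[OF meas]) (use assms in simp)
  finally show ?thesis by simp
qed

text \<open>Inverse of the map that adds \<open>c\<close> to \<open>z\<close> on \<open>I\<close>
  and subtracts \<open>L\<close> of the \<open>I\<close>-part from \<open>z\<close> on
  \<open>J\<close>. \<open>L\<close> sees only the \<open>I\<close>-coordinates, which is what
  preserves the volume.\<close>

definition unshear ::
    "'i set \<Rightarrow> 'i set \<Rightarrow> ('i \<Rightarrow> real) \<Rightarrow> (('i \<Rightarrow> real) \<Rightarrow> 'i \<Rightarrow> real)
      \<Rightarrow> ('i \<Rightarrow> real) \<times> ('i \<Rightarrow> real) \<Rightarrow> 'i \<Rightarrow> real" where
  "unshear I J c L p = merge I J (\<lambda>i\<in>I. fst p i - c i,
                                 \<lambda>j\<in>J. snd p j + L (\<lambda>i\<in>I. fst p i - c i) j)"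

lemma measurable_unshear:
  assumes "\<And>j. j \<in> J \<Longrightarrow> (\<lambda>x. L x j) \<in> borel_measurable (lborel_on I)"
  shows "unshear I J c L \<in> measurable (lborel_on I \<Otimes>\<^sub>M lborel_on J) (lborel_on (I \<union> J))"
proof -
  have 1: "(\<lambda>p. \<lambda>i\<in>I. fst p i - c i)
      \<in> measurable (lborel_on I \<Otimes>\<^sub>M lborel_on J) (lborel_on I)"
    by (intro measurable_restrict) measurable
  have 2: "(\<lambda>p. L (\<lambda>i\<in>I. fst p i - c i) j)
      \<in> borel_measurable (lborel_on I \<Otimes>\<^sub>M lborel_on J)" if "j \<in> J" for j
    by (rule measurable_compose[OF 1 assms[OF that]])
  have 3: "(\<lambda>p. \<lambda>j\<in>J. snd p j + L (\<lambda>i\<in>I. fst p i - c i) j)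
      \<in> measurable (lborel_on I \<Otimes>\<^sub>M lborel_on J) (lborel_on J)"
  proof (intro measurable_restrict)
    fix j assume j: "j \<in> J"
    have "(\<lambda>p. snd p j) \<in> measurable (lborel_on I \<Otimes>\<^sub>M lborel_on J) lborel"
      using j by measurable
    then show "(\<lambda>p. snd p j + L (\<lambda>i\<in>I. fst p i - c i) j)
        \<in> measurable (lborel_on I \<Otimes>\<^sub>M lborel_on J) lborel"
      using 2[OF j] by simp
  qed
  show ?thesis
    unfolding unshear_def
    by (rule measurable_compose[OF measurable_Pair[OF 1 3] measurable_merge])
qed

text \<open>By Fubini only translations occur: for a fixed \<open>I\<close>-part the
  \<open>J\<close>-part is shifted by a constant vector, and then the \<open>I\<close>-part is
  shifted by \<open>c\<close>. So measurability of \<open>L\<close> suffices.\<close>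

lemma nn_integral_unshear:
  fixes I J :: "'i set" and f :: "('i \<Rightarrow> real) \<Rightarrow> ennreal"
  assumes fin: "finite I" "finite J" and disj: "I \<inter> J = {}"
    and f: "f \<in> borel_measurable (lborel_on (I \<union> J))"
    and L: "\<And>j. j \<in> J \<Longrightarrow> (\<lambda>x. L x j) \<in> borel_measurable (lborel_on I)"
  shows "(\<integral>\<^sup>+p. f (unshear I J c L p) \<partial>(lborel_on I \<Otimes>\<^sub>M lborel_on J))
    = (\<integral>\<^sup>+z. f z \<partial>lborel_on (I \<union> J))"
proof -
  interpret product_sigma_finite "\<lambda>_::'i. lborel :: real measure"
    by (rule product_sigma_finite_lborel)
  interpret J: sigma_finite_measure "lborel_on J" by (rule sigma_finite[OF fin(2)])
  note f_unshear = measurable_compose[OF measurable_unshear f, OF L]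
  have fm: "(\<lambda>p. f (merge I J p)) \<in> borel_measurable (lborel_on I \<Otimes>\<^sub>M lborel_on J)"
    by (rule measurable_compose[OF measurable_merge f])
  define g where "g x = (\<integral>\<^sup>+y. f (merge I J (x, y)) \<partial>lborel_on J)" for x
  have g: "g \<in> borel_measurable (lborel_on I)"
    unfolding g_def by (rule J.borel_measurable_nn_integral_fst[OF fm])
  have "(\<integral>\<^sup>+p. f (unshear I J c L p) \<partial>(lborel_on I \<Otimes>\<^sub>M lborel_on J))
      = (\<integral>\<^sup>+x. (\<integral>\<^sup>+y. f (unshear I J c L (x, y)) \<partial>lborel_on J) \<partial>lborel_on I)"
    by (rule J.nn_integral_fst[symmetric, OF f_unshear])
  also have "\<dots> = (\<integral>\<^sup>+x. g (\<lambda>i\<in>I. x i + - c i) \<partial>lborel_on I)"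
  proof (rule nn_integral_cong)
    fix x assume "x \<in> space (lborel_on I)"
    let ?x = "\<lambda>i\<in>I. x i + - c i"
    have "?x \<in> space (lborel_on I)" by (auto simp: space_PiM)
    then have m: "(\<lambda>y. f (merge I J (?x, y))) \<in> borel_measurable (lborel_on J)"
      by (rule measurable_compose[OF measurable_Pair1' fm])
    show "(\<integral>\<^sup>+y. f (unshear I J c L (x, y)) \<partial>lborel_on J) = g ?x"
      unfolding g_def unshear_def fst_conv snd_conv
      using nn_integral_lborel_on_translate[OF fin(2) m, of "L ?x"] by simp
  qed
  also have "\<dots> = (\<integral>\<^sup>+x. g x \<partial>lborel_on I)"
    by (rule nn_integral_lborel_on_translate[OF fin(1) g])
  also have "\<dots> = (\<integral>\<^sup>+z. f z \<partial>lborel_on (I \<union> J))"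
    unfolding g_def by (rule product_nn_integral_fold[OF disj fin f, symmetric])
  finally show ?thesis .
qed

text \<open>A centred Gaussian density of variance \<open>a\<close>, scaled to be at least
  \<open>1\<close> on the ball of squared radius \<open>A\<close>. Its integral bounds the volume of
  the ball without the Gamma function; for \<open>A = n * a\<close> the exponential factor is
  \<open>exp (n / 2)\<close>.\<close>

definition gauss_weight :: "'i set \<Rightarrow> real \<Rightarrow> real \<Rightarrow> ('i \<Rightarrow> real) \<Rightarrow> ennreal" where
  "gauss_weight I a A x =
     ennreal (exp (A / (2 * a)) * sqrt (2 * pi * a) ^ card I)
       * (\<Prod>i\<in>I. ennreal (normal_density 0 (sqrt a) (x i)))"

lemma gauss_weight_measurable [measurable]:
  "gauss_weight I a A \<in> borel_measurable (lborel_on I)"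
  unfolding gauss_weight_def[abs_def] by measurable

lemma gauss_weight_ge_1:
  assumes "finite I" "0 < a" and "(\<Sum>i\<in>I. (x i)\<^sup>2) \<le> A"
  shows "1 \<le> gauss_weight I a A x"
proof -
  have "(\<Prod>i\<in>I. normal_density 0 (sqrt a) (x i))
      = (\<Prod>i\<in>I. 1 / sqrt (2 * pi * a)) * (\<Prod>i\<in>I. exp (- (x i)\<^sup>2 / (2 * a)))"
    using assms by (simp add: normal_density_def prod.distrib[symmetric] del: prod_constant)
  also have "(\<Prod>i\<in>I. exp (- (x i)\<^sup>2 / (2 * a))) = exp (\<Sum>i\<in>I. - (x i)\<^sup>2 / (2 * a))"
    using assms by (simp add: exp_sum)
  also have "(\<Sum>i\<in>I. - (x i)\<^sup>2 / (2 * a)) = - (\<Sum>i\<in>I. (x i)\<^sup>2) / (2 * a)"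
    by (simp add: sum_divide_distrib[symmetric] sum_negf)
  finally have eq: "(\<Prod>i\<in>I. normal_density 0 (sqrt a) (x i))
      = (1 / sqrt (2 * pi * a)) ^ card I * exp (- (\<Sum>i\<in>I. (x i)\<^sup>2) / (2 * a))"
    by simp
  have "1 \<le> exp ((A - (\<Sum>i\<in>I. (x i)\<^sup>2)) / (2 * a))"
    using assms by simp
  also have "\<dots> = exp (A / (2 * a)) * sqrt (2 * pi * a) ^ card I
      * (\<Prod>i\<in>I. normal_density 0 (sqrt a) (x i))"
  proof -
    have "sqrt (2 * pi * a) ^ card I * (1 / sqrt (2 * pi * a)) ^ card I = 1"
      using assms by (simp flip: power_mult_distrib)
    then have "exp (A / (2 * a)) * (sqrt (2 * pi * a) ^ card I * (1 / sqrt (2 * pi * a)) ^ card I)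
          * exp (- (\<Sum>i\<in>I. (x i)\<^sup>2) / (2 * a))
        = exp (A / (2 * a) + - (\<Sum>i\<in>I. (x i)\<^sup>2) / (2 * a))"
      by (simp only: exp_add mult_1_right)
    then show ?thesis
      unfolding eq by (simp only: add_divide_distrib mult.assoc
          diff_conv_add_uminus)
  qed
  finally have "ennreal 1 \<le> ennreal (exp (A / (2 * a)) * sqrt (2 * pi * a) ^ card I
      * (\<Prod>i\<in>I. normal_density 0 (sqrt a) (x i)))"
    by (rule ennreal_leI)
  also have "\<dots> = gauss_weight I a A x"
    unfolding gauss_weight_def using assms
    by (subst ennreal_mult) (auto simp: prod_ennreal intro!: prod_nonneg)
  finally show ?thesis by simp
qed

lemma nn_integral_gauss_weight:
  fixes I :: "'i set"
  assumes "finite I" "0 < a"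
  shows "(\<integral>\<^sup>+x. gauss_weight I a A x \<partial>lborel_on I)
    = ennreal (exp (A / (2 * a)) * sqrt (2 * pi * a) ^ card I)"
proof -
  interpret product_sigma_finite "\<lambda>_::'i. lborel :: real measure"
    by (rule product_sigma_finite_lborel)
  have 1: "(\<integral>\<^sup>+x. ennreal (normal_density 0 (sqrt a) x) \<partial>lborel) = 1"
    using assms by (subst nn_integral_eq_integral) (auto simp: integral_normal_density)
  have "(\<integral>\<^sup>+x. (\<Prod>i\<in>I. ennreal (normal_density 0 (sqrt a) (x i))) \<partial>lborel_on I) = 1"
    using assms by (subst product_nn_integral_prod) (auto simp: 1)
  then show ?thesis
    unfolding gauss_weight_def by (subst nn_integral_cmult) auto
qed

text \<open>
  For every message \<open>m\<close> the map sending \<open>z\<close> to the pair of \<open>z + S m\<close> on \<open>I\<close> and \<open>z - L z\<close> on \<open>J\<close>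
  preserves volume, and the images of the sets \<open>E m\<close> are disjoint and lie in a product of two balls.
\<close>

lemma decodable_volume_bound:
  fixes I J :: "'i set" and E :: "'m \<Rightarrow> ('i \<Rightarrow> real) set"
  assumes fin: "finite I" "finite J" "finite Ms" and disj: "I \<inter> J = {}"
    and L: "\<And>j. j \<in> J \<Longrightarrow> (\<lambda>x. L x j) \<in> borel_measurable (lborel_on I)"
    and E: "\<And>m. m \<in> Ms \<Longrightarrow> E m \<in> sets (lborel_on (I \<union> J))"
    and A: "\<And>m z. m \<in> Ms \<Longrightarrow> z \<in> E m \<Longrightarrow> (\<Sum>i\<in>I. (z i + S m i)\<^sup>2) \<le> A"
    and B: "\<And>m z. m \<in> Ms \<Longrightarrow> z \<in> E m \<Longrightarrow> (\<Sum>j\<in>J. (z j - L (restrict z I) j)\<^sup>2) \<le> B"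
    and inj: "\<And>m m' z z'. m \<in> Ms \<Longrightarrow> m' \<in> Ms \<Longrightarrow> z \<in> E m \<Longrightarrow> z' \<in> E m' \<Longrightarrow>
        (\<forall>i\<in>I. z i + S m i = z' i + S m' i) \<Longrightarrow>
        (\<forall>j\<in>J. z j - L (restrict z I) j = z' j - L (restrict z' I) j) \<Longrightarrow> m = m'"
    and ab: "0 < a" "0 < b"
  shows "(\<Sum>m\<in>Ms. emeasure (lborel_on (I \<union> J)) (E m))
    \<le> ennreal (exp (A / (2 * a)) * sqrt (2 * pi * a) ^ card I)
      * ennreal (exp (B / (2 * b)) * sqrt (2 * pi * b) ^ card J)"
proof -
  interpret product_sigma_finite "\<lambda>_::'i. lborel :: real measure"
    by (rule product_sigma_finite_lborel)
  interpret J: sigma_finite_measure "lborel_on J" by (rule sigma_finite[OF fin(2)])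
  let ?M = "lborel_on I \<Otimes>\<^sub>M lborel_on J"
  define U where "U m = unshear I J (S m) L" for m
  have U: "U m \<in> measurable ?M (lborel_on (I \<union> J))" for m
    unfolding U_def by (rule measurable_unshear[OF L])
  have U1: "U m p i + S m i = fst p i" if "i \<in> I" for m p i
    using that by (simp add: U_def unshear_def merge_def)
  have rU: "restrict (U m p) I = (\<lambda>i\<in>I. fst p i - S m i)" for m p
    by (auto simp: U_def unshear_def merge_def)
  have U2: "U m p j - L (restrict (U m p) I) j = snd p j" if "j \<in> J" for m p j
    using that disj by (auto simp: rU) (auto simp: U_def unshear_def merge_def)
  have "(\<Sum>m\<in>Ms. emeasure (lborel_on (I \<union> J)) (E m))
      = (\<Sum>m\<in>Ms. \<integral>\<^sup>+p. indicator (E m) (U m p) \<partial>?M)"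
  proof (rule sum.cong[OF refl])
    fix m assume m: "m \<in> Ms"
    then have "(\<integral>\<^sup>+p. indicator (E m) (U m p) \<partial>?M)
        = (\<integral>\<^sup>+z. indicator (E m) z \<partial>lborel_on (I \<union> J))"
      unfolding U_def using E by (intro nn_integral_unshear fin disj L) auto
    then show "emeasure (lborel_on (I \<union> J)) (E m) = (\<integral>\<^sup>+p. indicator (E m) (U m p) \<partial>?M)"
      using E[OF m] by simp
  qed
  also have "\<dots> = (\<integral>\<^sup>+p. (\<Sum>m\<in>Ms. indicator (E m) (U m p)) \<partial>?M)"
  proof (rule nn_integral_sum[symmetric])
    fix m assume "m \<in> Ms"
    then show "(\<lambda>p. indicator (E m) (U m p) :: ennreal) \<in> borel_measurable ?M"
      by (intro measurable_compose[OF U] borel_measurable_indicator E)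
  qed
  \<comment> \<open>Disjointness enters here: for each point \<open>p\<close> at most one message
    has the preimage \<open>U m p\<close> in \<open>E m\<close>, so the sum is \<open>0\<close> or
    \<open>1\<close>. If it is \<open>1\<close>, then \<open>p\<close> lies in both balls and both
    weights are at least \<open>1\<close>.\<close>
  also have "\<dots> \<le> (\<integral>\<^sup>+p. gauss_weight I a A (fst p) * gauss_weight J b B (snd p) \<partial>?M)"
  proof (rule nn_integral_mono)
    fix p
    show "(\<Sum>m\<in>Ms. indicator (E m) (U m p))
        \<le> gauss_weight I a A (fst p) * gauss_weight J b B (snd p)"
    proof (cases "\<exists>m\<in>Ms. U m p \<in> E m")
      case False
      then have "(\<Sum>m\<in>Ms. indicator (E m) (U m p) :: ennreal) = 0"
        by (intro sum.neutral) auto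
      then show ?thesis by simp
    next
      case True
      then obtain m where m: "m \<in> Ms" "U m p \<in> E m" by auto
      have uniq: "m' = m" if "m' \<in> Ms" "U m' p \<in> E m'" for m'
        using that m by (intro inj[of m' m "U m' p" "U m p"]) (auto simp: U1 U2)
      have "(\<Sum>m'\<in>Ms. indicator (E m') (U m' p) :: ennreal)
          = (\<Sum>m'\<in>Ms. if m' = m then 1 else 0)"
      proof (rule sum.cong[OF refl])
        fix m' assume m': "m' \<in> Ms"
        have "U m' p \<in> E m' \<longleftrightarrow> m' = m"
          using uniq[OF m'] m by blast
        then show "(indicator (E m') (U m' p) :: ennreal) = (if m' = m then 1 else 0)"
          by (simp add: indicator_def)
      qed
      also have "\<dots> = 1 * 1" using m fin by simp
      also have "\<dots> \<le> gauss_weight I a A (fst p) * gauss_weight J b B (snd p)"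
      proof (rule mult_mono)
        show "1 \<le> gauss_weight I a A (fst p)"
          using A[OF m] by (intro gauss_weight_ge_1 fin ab) (simp add: U1)
        show "1 \<le> gauss_weight J b B (snd p)"
          using B[OF m] by (intro gauss_weight_ge_1 fin ab) (simp add: U2)
      qed auto
      finally show ?thesis .
    qed
  qed
  also have "\<dots> = (\<integral>\<^sup>+x. (\<integral>\<^sup>+y. gauss_weight I a A x * gauss_weight J b B y
      \<partial>lborel_on J) \<partial>lborel_on I)"
    by (subst J.nn_integral_fst[symmetric]) auto
  also have "\<dots> = (\<integral>\<^sup>+x. gauss_weight I a A x \<partial>lborel_on I) * (\<integral>\<^sup>+y. gauss_weight J b B y \<partial>lborel_on J)"
    by (simp add: nn_integral_cmult nn_integral_multc)
  finally show ?thesis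
    by (simp add: nn_integral_gauss_weight fin ab)
qed

section \<open>Gaussian noise compared with Lebesgue measure\<close>

lemma PiM_density_lborel:
  fixes I :: "'i set"
  assumes "finite I" and f: "f \<in> borel_measurable borel"
    and "prob_space (density lborel f)"
  shows "PiM I (\<lambda>_. density lborel f) = density (lborel_on I) (\<lambda>z. \<Prod>i\<in>I. f (z i))"
proof -
  interpret product_sigma_finite "\<lambda>_::'i. lborel :: real measure"
    by (rule product_sigma_finite_lborel)
  interpret P: product_prob_space "\<lambda>_::'i. density lborel f"
    by (intro product_prob_spaceI assms(3))
  have sets_eq: "sets (PiM I (\<lambda>_. density lborel f)) = sets (lborel_on I)"
    by (rule sets_PiM_cong) auto
  show ?thesis
  proof (rule P.PiM_eqI[OF assms(1), symmetric])
    show "sets (density (lborel_on I) (\<lambda>z. \<Prod>i\<in>I. f (z i))) = sets (PiM I (\<lambda>_. density lborel f))"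
      using sets_eq by simp
  next
    fix A :: "'i \<Rightarrow> real set" assume A: "\<And>i. i \<in> I \<Longrightarrow> A i \<in> sets (density lborel f)"
    have m: "(\<lambda>z. \<Prod>i\<in>I. f (z i)) \<in> borel_measurable (lborel_on I)"
      using f by measurable
    have PiE: "PiE I A \<in> sets (lborel_on I)"
      using A by (intro sets_PiM_I_finite assms) auto
    have "emeasure (density (lborel_on I) (\<lambda>z. \<Prod>i\<in>I. f (z i))) (PiE I A)
        = (\<integral>\<^sup>+z. (\<Prod>i\<in>I. f (z i)) * indicator (PiE I A) z \<partial>lborel_on I)"
      by (rule emeasure_density[OF m PiE])
    also have "\<dots> = (\<integral>\<^sup>+z. (\<Prod>i\<in>I. f (z i) * indicator (A i) (z i)) \<partial>lborel_on I)"
    proof (rule nn_integral_cong)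
      fix z assume z: "z \<in> space (lborel_on I)"
      have "indicator (PiE I A) z = (\<Prod>i\<in>I. indicator (A i) (z i) :: ennreal)"
      proof (cases "\<forall>i\<in>I. z i \<in> A i")
        case True
        then show ?thesis using z by (auto simp: space_PiM PiE_iff)
      next
        case False
        then obtain i where i: "i \<in> I" "z i \<notin> A i" by auto
        then have "(\<Prod>i\<in>I. indicator (A i) (z i) :: ennreal) = 0"
          using assms(1) by (intro prod_zero) (auto intro!: bexI[of _ i])
        with i show ?thesis by (auto simp: indicator_def PiE_iff)
      qed
      then show "(\<Prod>i\<in>I. f (z i)) * indicator (PiE I A) z = (\<Prod>i\<in>I. f (z i) * indicator (A i) (z i))"
        by (simp add: prod.distrib)
    qed
    also have "\<dots> = (\<Prod>i\<in>I. \<integral>\<^sup>+x. f x * indicator (A i) x \<partial>lborel)"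
      using A f by (subst product_nn_integral_prod[OF assms(1)]) auto
    also have "\<dots> = (\<Prod>i\<in>I. emeasure (density lborel f) (A i))"
      using A f by (intro prod.cong refl emeasure_density[symmetric]) auto
    finally show "emeasure (density (lborel_on I) (\<lambda>z. \<Prod>i\<in>I. f (z i))) (PiE I A)
        = (\<Prod>i\<in>I. emeasure (density lborel f) (A i))" .
  qed
qed

lemma sets_noise_measure: "sets (noise_measure K n) = sets (lborel_on ({1..K} \<times> {..<n}))"
  unfolding noise_measure_def by (rule sets_PiM_cong) auto

lemma prob_space_noise: "prob_space (noise_measure K n)"
  unfolding noise_measure_def by (intro prob_space_PiM prob_space_normal_density) simp

lemma std_normal_density_le_1: "std_normal_density x \<le> 1"
proof -
  have "1 \<le> sqrt (2 * pi)" using pi_gt3 by simp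
  then have "1 / sqrt (2 * pi) * exp (- x\<^sup>2 / 2) \<le> 1 * 1"
    by (intro mult_mono) auto
  then show ?thesis by (simp add: std_normal_density_def)
qed

text \<open>Each factor of the joint density is at most \<open>1\<close>. The comparison is crude,
  but it does not involve the power and so affects only the additive constants of the rate
  bounds.\<close>

lemma emeasure_noise_le_lborel:
  assumes "E \<in> sets (noise_measure K n)"
  shows "emeasure (noise_measure K n) E \<le> emeasure (lborel_on ({1..K} \<times> {..<n})) E"
proof -
  let ?I = "{1..K} \<times> {..<n}"
  let ?f = "\<lambda>z. \<Prod>i\<in>?I. ennreal (std_normal_density (z i))"
  have E: "E \<in> sets (lborel_on ?I)" using assms by (simp add: sets_noise_measure)
  have "noise_measure K n = density (lborel_on ?I) ?f"
    unfolding noise_measure_def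
    by (rule PiM_density_lborel) (auto intro: prob_space_normal_density)
  then have "emeasure (noise_measure K n) E = (\<integral>\<^sup>+z. ?f z * indicator E z \<partial>lborel_on ?I)"
    using E by (simp add: emeasure_density)
  also have "\<dots> \<le> (\<integral>\<^sup>+z. indicator E z \<partial>lborel_on ?I)"
  proof (rule nn_integral_mono)
    fix z
    have "?f z = ennreal (\<Prod>i\<in>?I. std_normal_density (z i))"
      by (simp add: prod_ennreal)
    also have "\<dots> \<le> 1"
      using std_normal_density_le_1 by (auto intro!: prod_le_1 simp: ennreal_le_1)
    finally have "?f z \<le> 1" .
    then show "?f z * indicator E z \<le> indicator E z"
      using mult_right_mono[of "?f z" 1 "indicator E z"] by simp
  qed
  finally show ?thesis using E by simp
qed

text \<open>Markov's inequality: the expected energy is \<open>K * n\<close>, one for each standard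
  normal coordinate, so it exceeds four times this value with probability at most
  \<open>1 / 4\<close>.\<close>

lemma noise_typical:
  assumes "0 < n" "0 < K"
  defines "T \<equiv> {z \<in> space (noise_measure K n).
      (\<Sum>i\<in>{1..K} \<times> {..<n}. (z i)\<^sup>2) \<le> 4 * (real K * real n)}"
  shows "T \<in> sets (noise_measure K n)" and "3 / 4 \<le> measure (noise_measure K n) T"
proof -
  let ?I = "{1..K} \<times> {..<n}" and ?M = "noise_measure K n"
  interpret prob_space ?M by (rule prob_space_noise)
  interpret P: product_prob_space "\<lambda>_::nat \<times> nat. std_normal_distribution" ?I
    by (intro product_prob_spaceI prob_space_normal_density) simp
  have comp: "(\<lambda>z. z i) \<in> borel_measurable ?M" if "i \<in> ?I" for i
    using that measurable_component_singleton[of i ?I "\<lambda>_. std_normal_distribution"]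
    by (simp add: noise_measure_def)
  have meas: "(\<lambda>z. \<Sum>i\<in>?I. (z i)\<^sup>2) \<in> borel_measurable ?M"
    by (intro borel_measurable_sum borel_measurable_power comp)
  show T: "T \<in> sets ?M"
    unfolding T_def using meas by measurable
  have I1: "(\<integral>\<^sup>+z. ennreal ((z i)\<^sup>2) \<partial>?M) = 1" if i: "i \<in> ?I" for i
  proof -
    have "(\<integral>\<^sup>+z. ennreal ((z i)\<^sup>2) \<partial>?M)
        = (\<integral>\<^sup>+x. ennreal (x\<^sup>2) \<partial>distr ?M std_normal_distribution (\<lambda>z. z i))"
      using i by (subst nn_integral_distr) (auto simp: noise_measure_def)
    also have "distr ?M std_normal_distribution (\<lambda>z. z i) = std_normal_distribution"
      unfolding noise_measure_def by (rule P.PiM_component[OF i])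
    also have "(\<integral>\<^sup>+x. ennreal (x\<^sup>2) \<partial>std_normal_distribution)
        = (\<integral>\<^sup>+x. ennreal (std_normal_density x * x ^ (2 * 1)) \<partial>lborel)"
      by (subst nn_integral_density) (auto simp: ennreal_mult)
    also have "\<dots> = ennreal (fact (2 * 1) / (2 ^ 1 * fact 1))"
      by (subst nn_integral_eq_integral[OF integrable_std_normal_moment])
        (auto simp only: integral_std_normal_moment_even, auto)
    finally show ?thesis by simp
  qed
  have "(\<integral>\<^sup>+z. ennreal (\<Sum>i\<in>?I. (z i)\<^sup>2) \<partial>?M) = (\<integral>\<^sup>+z. (\<Sum>i\<in>?I. ennreal ((z i)\<^sup>2)) \<partial>?M)"
    by (simp add: sum_ennreal)
  also have "\<dots> = (\<Sum>i\<in>?I. \<integral>\<^sup>+z. ennreal ((z i)\<^sup>2) \<partial>?M)"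
    by (rule nn_integral_sum) (intro measurable_compose[OF _ measurable_ennreal]
        borel_measurable_power comp)
  also have "\<dots> = (\<Sum>i\<in>?I. 1)"
    by (rule sum.cong[OF refl I1])
  also have "\<dots> = of_nat (K * n)"
    by (simp add: card_cartesian_product)
  finally have int: "(\<integral>\<^sup>+z. ennreal (\<Sum>i\<in>?I. (z i)\<^sup>2) \<partial>?M) = ennreal (real (K * n))"
    by (simp add: ennreal_of_nat_eq_real_of_nat)
  have integ: "integrable ?M (\<lambda>z. \<Sum>i\<in>?I. (z i)\<^sup>2)"
    using int meas by (intro integrableI_nonneg) (auto intro!: AE_I2 sum_nonneg)
  have E: "expectation (\<lambda>z. \<Sum>i\<in>?I. (z i)\<^sup>2) = real (K * n)"
    using int meas by (subst integral_eq_nn_integral) (auto intro!: AE_I2 sum_nonneg)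
  have "space ?M - T \<subseteq> {z \<in> space ?M. (\<Sum>i\<in>?I. (z i)\<^sup>2) \<ge> 4 * (real K * real n)}"
    by (auto simp: T_def)
  then have "prob (space ?M - T) \<le> prob {z \<in> space ?M. (\<Sum>i\<in>?I. (z i)\<^sup>2) \<ge> 4 * (real K * real n)}"
    using meas unfolding borel_measurable_iff_ge by (intro finite_measure_mono) auto
  also have "\<dots> \<le> expectation (\<lambda>z. \<Sum>i\<in>?I. (z i)\<^sup>2) / (4 * (real K * real n))"
    using assms by (intro integral_Markov_inequality_measure[OF integ, of "{}"])
      (auto intro!: AE_I2 sum_nonneg)
  also have "\<dots> = 1 / 4" unfolding E using assms by simp
  finally show "3 / 4 \<le> prob T"
    using prob_compl[OF T] by simp
qed

section \<open>Energy of outputs and residuals for typical noise\<close>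

lemma sum_power2_add_le:
  fixes f g :: "'i \<Rightarrow> real"
  shows "(\<Sum>i\<in>I. (f i + g i)\<^sup>2) \<le> 2 * (\<Sum>i\<in>I. (f i)\<^sup>2) + 2 * (\<Sum>i\<in>I. (g i)\<^sup>2)"
proof -
  have "(f i + g i)\<^sup>2 \<le> 2 * (f i)\<^sup>2 + 2 * (g i)\<^sup>2" for i
    using sum_squares_bound[of "f i" "g i"] by (simp add: power2_sum)
  then have "(\<Sum>i\<in>I. (f i + g i)\<^sup>2) \<le> (\<Sum>i\<in>I. 2 * (f i)\<^sup>2 + 2 * (g i)\<^sup>2)"
    by (intro sum_mono)
  then show ?thesis by (simp add: sum.distrib sum_distrib_left)
qed

text \<open>Here \<open>D\<close> is a matrix of coefficients, not a number of rounds. The noise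
  energy \<open>4 * K * n\<close> enters directly and once more through Cauchy-Schwarz with the
  coefficients; squaring a difference costs a factor \<open>2\<close>, whence
  \<open>8\<close>.\<close>

definition residual_energy :: "nat \<Rightarrow> nat set \<Rightarrow> (nat \<Rightarrow> nat \<Rightarrow> real) \<Rightarrow> real" where
  "residual_energy K G D = 8 * real K * (1 + (\<Sum>r\<in>{1..K} - G. \<Sum>i\<in>G. (D r i)\<^sup>2))"

text \<open>Product of the Gaussian bounds for two balls, of squared radius
  \<open>n * (2 * c + 8 * K)\<close> for the kept outputs and
  \<open>n * residual_energy K G D\<close> for the residuals; each contributes
  \<open>exp (n / 2)\<close>. The parameter \<open>c\<close> stands for the signal power per time
  step, summed over \<open>G\<close>.\<close>

definition decoding_volume :: "nat \<Rightarrow> nat set \<Rightarrow> (nat \<Rightarrow> nat \<Rightarrow> real) \<Rightarrow> real \<Rightarrow> nat \<Rightarrow> real" where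
  "decoding_volume K G D c n =
     exp (real n) * sqrt (2 * pi * (2 * c + 8 * real K)) ^ (card G * n)
       * sqrt (2 * pi * residual_energy K G D) ^ (card ({1..K} - G) * n)"

lemma decoding_volume_nonneg:
  assumes "0 \<le> c"
  shows "0 \<le> decoding_volume K G W c n"
proof -
  have "0 \<le> residual_energy K G W"
    unfolding residual_energy_def by (intro mult_nonneg_nonneg add_nonneg_nonneg sum_nonneg) auto
  then show ?thesis
    unfolding decoding_volume_def using assms
    by (intro mult_nonneg_nonneg zero_le_power real_sqrt_ge_zero add_nonneg_nonneg) auto
qed

lemma residual_energy_bound:
  assumes "G \<subseteq> {1..K}" and z: "(\<Sum>i\<in>{1..K} \<times> {..<n}. (z i)\<^sup>2) \<le> 4 * (real K * real n)"
  shows "(\<Sum>j\<in>({1..K} - G) \<times> {..<n}. (z j - (\<Sum>i\<in>G. D (fst j) i * z (i, snd j)))\<^sup>2)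
    \<le> real n * residual_energy K G D"
proof -
  have fin: "finite G" using assms(1) finite_subset by blast
  let ?J = "({1..K} - G) \<times> {..<n}" and ?d = "\<lambda>r. \<Sum>i\<in>G. (D r i)\<^sup>2"
  define Z where "Z = 4 * (real K * real n)"
  have zJ: "(\<Sum>j\<in>?J. (z j)\<^sup>2) \<le> Z"
    unfolding Z_def by (intro order.trans[OF sum_mono2 z]) auto
  have zG: "(\<Sum>t<n. \<Sum>i\<in>G. (z (i, t))\<^sup>2) \<le> Z"
  proof -
    have "(\<Sum>t<n. \<Sum>i\<in>G. (z (i, t))\<^sup>2) = (\<Sum>i\<in>G \<times> {..<n}. (z i)\<^sup>2)"
      by (subst sum.swap) (simp add: sum.cartesian_product)
    also have "\<dots> \<le> Z"
      unfolding Z_def using assms(1) by (intro order.trans[OF sum_mono2 z]) auto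
    finally show ?thesis .
  qed
  have "(\<Sum>j\<in>?J. (\<Sum>i\<in>G. D (fst j) i * z (i, snd j))\<^sup>2)
      = (\<Sum>r\<in>{1..K} - G. \<Sum>t<n. (\<Sum>i\<in>G. D r i * z (i, t))\<^sup>2)"
    by (simp add: sum.cartesian_product case_prod_beta)
  also have "\<dots> \<le> (\<Sum>r\<in>{1..K} - G. \<Sum>t<n. ?d r * (\<Sum>i\<in>G. (z (i, t))\<^sup>2))"
    by (intro sum_mono Cauchy_Schwarz_ineq_sum)
  also have "\<dots> = (\<Sum>r\<in>{1..K} - G. ?d r * (\<Sum>t<n. \<Sum>i\<in>G. (z (i, t))\<^sup>2))"
    by (simp add: sum_distrib_left)
  also have "\<dots> \<le> (\<Sum>r\<in>{1..K} - G. ?d r * Z)"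
    by (intro sum_mono mult_left_mono zG sum_nonneg) auto
  also have "\<dots> = (\<Sum>r\<in>{1..K} - G. ?d r) * Z"
    by (simp add: sum_distrib_right)
  finally have 1: "(\<Sum>j\<in>?J. (- (\<Sum>i\<in>G. D (fst j) i * z (i, snd j)))\<^sup>2)
      \<le> (\<Sum>r\<in>{1..K} - G. ?d r) * Z" by simp
  have "(\<Sum>j\<in>?J. (z j + - (\<Sum>i\<in>G. D (fst j) i * z (i, snd j)))\<^sup>2)
      \<le> 2 * Z + 2 * ((\<Sum>r\<in>{1..K} - G. ?d r) * Z)"
    by (intro order.trans[OF sum_power2_add_le] add_mono mult_left_mono zJ 1) auto
  also have "\<dots> = real n * residual_energy K G D"
    by (simp add: residual_energy_def Z_def algebra_simps)
  finally show ?thesis by simp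
qed

text \<open>The volume bound is applied to the successful noises that are also typical; the atypical
  ones cost \<open>1 / 4\<close> for each message. On \<open>G\<close>, \<open>z + S m\<close> is
  the kept output.\<close>

lemma noise_decodable_bound:
  fixes S :: "'m \<Rightarrow> nat \<times> nat \<Rightarrow> real"
  assumes G: "G \<subseteq> {1..K}" and pos: "0 < K" "0 < n" "0 \<le> c" and fin: "finite Ms"
    and E: "\<And>m. m \<in> Ms \<Longrightarrow> E m \<in> sets (noise_measure K n)"
    and power: "\<And>m. m \<in> Ms \<Longrightarrow> (\<Sum>i\<in>G \<times> {..<n}. (S m i)\<^sup>2) \<le> real n * c"
    and inj: "\<And>m m' z z'. m \<in> Ms \<Longrightarrow> m' \<in> Ms \<Longrightarrow> z \<in> E m \<Longrightarrow> z' \<in> E m' \<Longrightarrow>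
        (\<And>k t. k \<in> G \<Longrightarrow> t < n \<Longrightarrow> z (k, t) + S m (k, t) = z' (k, t) + S m' (k, t)) \<Longrightarrow>
        (\<And>r t. r \<in> {1..K} - G \<Longrightarrow> t < n \<Longrightarrow>
          z (r, t) - (\<Sum>i\<in>G. D r i * z (i, t)) = z' (r, t) - (\<Sum>i\<in>G. D r i * z' (i, t))) \<Longrightarrow>
        m = m'"
  shows "(\<Sum>m\<in>Ms. measure (noise_measure K n) (E m)) \<le> card Ms / 4 + decoding_volume K G D c n"
proof -
  let ?M = "noise_measure K n" and ?I = "G \<times> {..<n}" and ?J = "({1..K} - G) \<times> {..<n}"
  interpret prob_space ?M by (rule prob_space_noise)
  have IJ: "?I \<union> ?J = {1..K} \<times> {..<n}" using G by auto
  have finG: "finite G" using G finite_subset by blast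
  define T where "T = {z \<in> space ?M. (\<Sum>i\<in>{1..K} \<times> {..<n}. (z i)\<^sup>2) \<le> 4 * (real K * real n)}"
  note T = noise_typical[OF pos(2,1), folded T_def]
  define L where "L x j = (\<Sum>i\<in>G. D (fst j) i * x (i, snd j))" for x :: "nat \<times> nat \<Rightarrow> real" and j
  have Lr: "L (restrict z ?I) j = L z j" if "j \<in> ?J" for z j
    using that unfolding L_def by (intro sum.cong) auto
  define a b where "a = 2 * c + 8 * real K" and "b = residual_energy K G D"
  have ab: "0 < a" "0 < b"
    using pos unfolding a_def b_def residual_energy_def
    by (auto intro!: mult_pos_pos add_pos_nonneg sum_nonneg)
  have "(\<Sum>m\<in>Ms. emeasure (lborel_on (?I \<union> ?J)) (E m \<inter> T))
    \<le> ennreal (exp (real n * a / (2 * a)) * sqrt (2 * pi * a) ^ card ?I)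
      * ennreal (exp (real n * b / (2 * b)) * sqrt (2 * pi * b) ^ card ?J)"
  proof (rule decodable_volume_bound[where S = S and L = L])
    show "(\<lambda>x. L x j) \<in> borel_measurable (lborel_on ?I)" if "j \<in> ?J" for j
      using that unfolding L_def
      by (intro borel_measurable_sum borel_measurable_times borel_measurable_const
          measurable_component_singleton[of _ ?I "\<lambda>_. lborel", simplified]) auto
  next
    fix m assume "m \<in> Ms"
    then show "E m \<inter> T \<in> sets (lborel_on (?I \<union> ?J))"
      unfolding IJ using E T(1) by (auto simp: sets_noise_measure)
  next
    fix m z assume m: "m \<in> Ms" and "z \<in> E m \<inter> T"
    then have z: "(\<Sum>i\<in>{1..K} \<times> {..<n}. (z i)\<^sup>2) \<le> 4 * (real K * real n)" by (simp add: T_def)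
    have "(\<Sum>i\<in>?I. (z i)\<^sup>2) \<le> 4 * (real K * real n)"
      using G by (intro order.trans[OF sum_mono2 z]) auto
    then have "(\<Sum>i\<in>?I. (z i + S m i)\<^sup>2) \<le> 2 * (4 * (real K * real n)) + 2 * (real n * c)"
      using power[OF m] by (intro order.trans[OF sum_power2_add_le] add_mono mult_left_mono) auto
    then show "(\<Sum>i\<in>?I. (z i + S m i)\<^sup>2) \<le> real n * a"
      by (simp add: a_def algebra_simps)
    have "(\<Sum>j\<in>?J. (z j - L (restrict z ?I) j)\<^sup>2) = (\<Sum>j\<in>?J. (z j - L z j)\<^sup>2)"
      by (intro sum.cong refl) (simp only: Lr)
    then show "(\<Sum>j\<in>?J. (z j - L (restrict z ?I) j)\<^sup>2) \<le> real n * b"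
      using residual_energy_bound[OF G z, of D] unfolding L_def b_def by simp
  next
    fix m m' z z'
    assume m: "m \<in> Ms" "m' \<in> Ms" "z \<in> E m \<inter> T" "z' \<in> E m' \<inter> T"
      and I: "\<forall>i\<in>?I. z i + S m i = z' i + S m' i"
      and J: "\<forall>j\<in>?J. z j - L (restrict z ?I) j = z' j - L (restrict z' ?I) j"
    have J': "z j - L z j = z' j - L z' j" if "j \<in> ?J" for j
      using bspec[OF J that] by (simp only: Lr[OF that])
    show "m = m'"
    proof (rule inj[of m m' z z'])
      fix r t assume "r \<in> {1..K} - G" "t < n"
      then show "z (r, t) - (\<Sum>i\<in>G. D r i * z (i, t)) = z' (r, t) - (\<Sum>i\<in>G. D r i * z' (i, t))"
        using J'[of "(r, t)"] by (simp add: L_def)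
    qed (use m I in auto)
  qed (use finG fin ab in auto)
  also have "\<dots> = ennreal (decoding_volume K G D c n)"
  proof -
    have half: "real n * a / (2 * a) = real n / 2" "real n * b / (2 * b) = real n / 2"
      using ab by auto
    have "exp (real n) = exp (real n / 2) * exp (real n / 2)"
      by (simp flip: exp_add)
    then show ?thesis
      unfolding half using ab
      by (simp add: decoding_volume_def a_def b_def card_cartesian_product mult_ac
          flip: ennreal_mult)
  qed
  finally have vol: "(\<Sum>m\<in>Ms. emeasure (lborel_on (?I \<union> ?J)) (E m \<inter> T))
      \<le> ennreal (decoding_volume K G D c n)" .
  have vol_nonneg: "0 \<le> decoding_volume K G D c n"
    using ab by (simp add: decoding_volume_def flip: a_def b_def)
  have "ennreal (\<Sum>m\<in>Ms. prob (E m \<inter> T)) = (\<Sum>m\<in>Ms. emeasure ?M (E m \<inter> T))"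
    by (simp add: emeasure_eq_measure)
  also have "\<dots> \<le> (\<Sum>m\<in>Ms. emeasure (lborel_on (?I \<union> ?J)) (E m \<inter> T))"
    unfolding IJ using E T(1) by (intro sum_mono emeasure_noise_le_lborel) auto
  finally have "(\<Sum>m\<in>Ms. prob (E m \<inter> T)) \<le> decoding_volume K G D c n"
    using order.trans[OF _ vol] vol_nonneg by (metis ennreal_le_iff)
  moreover have "prob (E m) \<le> 1 / 4 + prob (E m \<inter> T)" if "m \<in> Ms" for m
  proof -
    have "prob (E m) \<le> prob ((E m \<inter> T) \<union> (space ?M - T))"
      using E[OF that] T(1) sets.sets_into_space[OF E[OF that]] by (intro finite_measure_mono) auto
    also have "\<dots> \<le> prob (E m \<inter> T) + prob (space ?M - T)"
      using E[OF that] T(1) by (intro measure_Un_le) auto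
    also have "prob (space ?M - T) \<le> 1 / 4" using T prob_compl[OF T(1)] by simp
    finally show ?thesis by simp
  qed
  then have "(\<Sum>m\<in>Ms. prob (E m)) \<le> (\<Sum>m\<in>Ms. 1 / 4 + prob (E m \<inter> T))"
    by (rule sum_mono)
  ultimately show ?thesis by (simp add: sum.distrib)
qed

section \<open>Cooperation, measurability and reconstruction\<close>

text \<open>The region from which information can reach \<open>k\<close> in \<open>r\<close> rounds:
  it moves one user per round, and inactive users do not relay.\<close>

definition linked :: "nat set \<Rightarrow> nat \<Rightarrow> nat \<Rightarrow> nat \<Rightarrow> bool" where
  "linked A r k l \<longleftrightarrow> {min k l..max k l} \<subseteq> A \<and> l \<le> k + r \<and> k \<le> l + r"

lemma linked_refl: "k \<in> A \<Longrightarrow> linked A r k k"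
  by (simp add: linked_def)

lemma linked_mem: "linked A r k l \<Longrightarrow> k \<in> A" "linked A r k l \<Longrightarrow> l \<in> A"
  by (auto simp: linked_def)

lemma linked_mono: "linked A r k l \<Longrightarrow> r \<le> r' \<Longrightarrow> linked A r' k l"
  by (auto simp: linked_def)

text \<open>Distances add, which turns \<open>DTx\<close> rounds at the transmitters and
  \<open>DRx\<close> rounds at the receivers into reach \<open>DTx + DRx\<close>, whatever the
  split.\<close>

lemma linked_trans:
  assumes "linked A r k l" "linked A q l m"
  shows "linked A (r + q) k m"
proof -
  have "i \<in> A" if "i \<in> {min k m..max k m}" for i
  proof -
    from that have "i \<in> {min k l..max k l} \<or> i \<in> {min l m..max l m}" by auto
    with assms show ?thesis by (auto simp: linked_def)
  qed
  with assms show ?thesis by (auto simp: linked_def)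
qed

text \<open>In the induction, the newest message from a neighbour \<open>l\<close> depends on the
  observation of \<open>l\<close> and on its history of \<open>r\<close> rounds; the step from
  \<open>k\<close> to \<open>l\<close> uses up the additional unit of distance.\<close>

lemma coop_history_cong:
  assumes "\<And>l. linked (active_users K s) r k l \<Longrightarrow> obs l = obs' l"
  shows "coop_history K s c obs r k = coop_history K s c obs' r k"
  using assms
proof (induction r arbitrary: k)
  case 0
  then show ?case by simp
next
  case (Suc r)
  have hk: "coop_history K s c obs r k = coop_history K s c obs' r k"
    by (rule Suc.IH) (use Suc.prems linked_mono in fastforce)
  have "obs l = obs' l \<and> coop_history K s c obs r l = coop_history K s c obs' r l"
    if "k \<in> active_users K s" "l \<in> active_users K s" "l \<in> neighbours K k" for l
  proof
    have kl: "linked (active_users K s) 1 k l"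
      using that by (auto simp: linked_def neighbours_def min_def max_def le_Suc_eq
          elim!: le_SucE)
    then show "obs l = obs' l"
      by (intro Suc.prems linked_mono[OF kl]) simp
    show "coop_history K s c obs r l = coop_history K s c obs' r l"
      by (rule Suc.IH) (use linked_trans[OF kl] Suc.prems in auto)
  qed
  note step = this
  show ?case
  proof (intro ext)
    fix i l
    show "coop_history K s c obs (Suc r) k i l = coop_history K s c obs' (Suc r) k i l"
    proof (cases "k \<in> active_users K s \<and> l \<in> active_users K s \<and> l \<in> neighbours K k")
      case True
      with step[of l] hk show ?thesis by simp
    next
      case False
      with hk show ?thesis by auto
    qed
  qed
qed

section \<open>Measurability of the decoding events\<close>

lemma coop_history_measurable:
  fixes c :: "nat \<Rightarrow> nat \<Rightarrow> nat \<Rightarrow> (nat \<Rightarrow> real) \<Rightarrow> (nat \<Rightarrow> nat \<Rightarrow> nat \<Rightarrow> real) \<Rightarrow> nat \<Rightarrow> real"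
  assumes c: "\<And>i k l. (\<lambda>(y, H). c i k l y H) \<in> borel_measurable borel"
    and Y: "\<And>k. (\<lambda>z. Y z k) \<in> borel_measurable M"
  shows "(\<lambda>z. coop_history K s c (Y z) r k) \<in> borel_measurable M"
proof (induction r arbitrary: k)
  case 0
  then show ?case by simp
next
  case (Suc r)
  have step: "(\<lambda>z. c r l k (Y z l) (coop_history K s c (Y z) r l)) \<in> borel_measurable M" for l
  proof -
    have pair: "(\<lambda>z. (Y z l, coop_history K s c (Y z) r l)) \<in> borel_measurable M"
      by (rule borel_measurable_Pair[OF Y Suc.IH])
    have "(\<lambda>z. (\<lambda>(y, H). c r l k y H) (Y z l, coop_history K s c (Y z) r l)) \<in> borel_measurable M"
      by (rule measurable_compose[OF pair c])
    then show ?thesis unfolding prod.case .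
  qed
  have old: "(\<lambda>z. coop_history K s c (Y z) r k i l) \<in> borel_measurable M" for i l
    by (rule measurable_product_then_coordinatewise[OF
          measurable_product_then_coordinatewise[OF Suc.IH]])
  show ?case
  proof (intro measurable_coordinatewise_then_product)
    fix i l
    have "(\<lambda>z. coop_history K s c (Y z) (Suc r) k i l) \<in> borel_measurable M"
      using step[of l] old[of i l]
      by (cases "i = r"; cases "k \<in> active_users K s \<and> l \<in> active_users K s \<and> l \<in> neighbours K k")
        auto
    then show "\<And>ia. (\<lambda>z. coop_history K s c (Y z) (Suc r) k i l ia) \<in> borel_measurable M"
      by (rule measurable_product_then_coordinatewise)
  qed
qed

lemma noise_component_measurable: "(\<lambda>z. z i) \<in> borel_measurable (noise_measure K n)"
proof (cases "i \<in> {1..K} \<times> {..<n}")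
  case True
  then show ?thesis
    using measurable_component_singleton[of i "{1..K} \<times> {..<n}" "\<lambda>_. std_normal_distribution"]
    by (simp add: noise_measure_def)
next
  case False
  then have "z i = undefined" if "z \<in> space (noise_measure K n)" for z
    using PiE_arb[OF _ False] that by (simp add: noise_measure_def space_PiM)
  then show ?thesis
    by (subst measurable_cong[where g = "\<lambda>_. undefined"]) auto
qed

lemma channel_output_measurable:
  "(\<lambda>z. channel_output h K n x z k) \<in> borel_measurable (noise_measure K n)"
proof (intro measurable_coordinatewise_then_product)
  fix t
  note [measurable] = noise_component_measurable
  show "(\<lambda>z. channel_output h K n x z k t) \<in> borel_measurable (noise_measure K n)"
    by (cases "t < n") (simp_all add: channel_output_def)
qed

lemma decode_urllc_set:
  assumes "measurable_code C"
  shows "{z \<in> space (noise_measure K n).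
      decode_urllc C s k (channel_output h K n x z k) = v} \<in> sets (noise_measure K n)"
proof -
  have "(\<lambda>z. decode_urllc C s k (channel_output h K n x z k))
      \<in> measurable (noise_measure K n) (count_space UNIV)"
    using assms by (intro measurable_compose[OF channel_output_measurable])
      (auto simp: measurable_code_def)
  then show ?thesis by measurable
qed

lemma decode_embb_set:
  assumes "measurable_code C"
  shows "{z \<in> space (noise_measure K n).
      decode_embb C s k (channel_output h K n x z k)
        (coop_history K s (rx_coop C s) (channel_output h K n x z) r k) = v}
    \<in> sets (noise_measure K n)"
proof -
  have c: "(\<lambda>(y, H). rx_coop C s i k l y H) \<in> borel_measurable borel" for i k l
    using assms by (simp add: measurable_code_def)
  have d: "(\<lambda>(y, H). decode_embb C s k y H) \<in> measurable borel (count_space UNIV)"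
    using assms by (simp add: measurable_code_def)
  have "(\<lambda>z. coop_history K s (rx_coop C s) (channel_output h K n x z) r k)
      \<in> borel_measurable (noise_measure K n)"
    by (rule coop_history_measurable[OF c channel_output_measurable])
  then have "(\<lambda>z. decode_embb C s k (channel_output h K n x z k)
        (coop_history K s (rx_coop C s) (channel_output h K n x z) r k))
      \<in> measurable (noise_measure K n) (count_space UNIV)"
    using measurable_compose[OF borel_measurable_Pair[OF channel_output_measurable] d]
    by simp
  then show ?thesis by measurable
qed

lemma finite_users: "finite (active_users K s)" "finite (embb_users K s)" "finite (urllc_users K s)"
  by (auto simp: active_users_def embb_users_def urllc_users_def)

lemma decoding_error_set:
  assumes "measurable_code C"
  shows "{z \<in> space (noise_measure K n). decoding_error h K n DTx DRx C s me mu z}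
    \<in> sets (noise_measure K n)"
proof -
  let ?M = "noise_measure K n" and ?Y = "channel_output h K n (channel_input K DTx C s me mu)"
  have "{z \<in> space ?M. decoding_error h K n DTx DRx C s me mu z} =
      (\<Union>k\<in>urllc_users K s. space ?M - {z \<in> space ?M. decode_urllc C s k (?Y z k) = mu k}) \<union>
      (\<Union>k\<in>embb_users K s. space ?M - {z \<in> space ?M.
         decode_embb C s k (?Y z k) (coop_history K s (rx_coop C s) (?Y z) DRx k) = me k})"
    by (auto simp: decoding_error_def Let_def)
  also have "\<dots> \<in> sets ?M"
    by (intro sets.Un sets.finite_UN finite_users sets.compl_sets decode_urllc_set
        decode_embb_set assms)
  finally show ?thesis .
qed

definition gain :: "(nat \<Rightarrow> nat \<Rightarrow> real) \<Rightarrow> nat \<Rightarrow> (nat \<Rightarrow> real) \<Rightarrow> nat \<Rightarrow> real" where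
  "gain h K x k = h k k * x k + (\<Sum>l\<in>neighbours K k. h l k * x l)"

lemma channel_output_eq:
  "channel_output h K n x z k t = (if t < n then gain h K (\<lambda>l. x l t) k + z (k, t) else 0)"
  by (simp add: channel_output_def gain_def)

lemma channel_input_inactive:
  "k \<notin> active_users K s \<Longrightarrow> channel_input K DTx C s me mu k t = 0"
  by (simp add: channel_input_def)

text \<open>
  The outputs at \<open>G\<close> suffice to find all messages: the messages that determine the inputs of the
  seeds \<open>Sd\<close> are decoded from these outputs alone, and the remaining active users' outputs are, up
  to bounded noise, linear combinations of the outputs at \<open>G\<close> and the inputs of the seeds.
\<close>

definition reconstructs ::
    "(nat \<Rightarrow> nat \<Rightarrow> real) \<Rightarrow> nat \<Rightarrow> nat \<Rightarrow> nat set \<Rightarrow> nat set \<Rightarrow> nat set \<Rightarrow> (nat \<Rightarrow> nat \<Rightarrow> real) \<Rightarrow> bool"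
  where "reconstructs h K D A G Sd W \<longleftrightarrow>
     G \<subseteq> A \<and> Sd \<subseteq> A \<and>
     (\<forall>sd\<in>Sd. \<forall>r. linked A D sd r \<longrightarrow> r \<in> G) \<and>
     (\<forall>r\<in>A - G. \<exists>V. \<forall>x. (\<forall>l. l \<notin> A \<longrightarrow> x l = 0) \<longrightarrow>
        gain h K x r = (\<Sum>i\<in>G. W r i * gain h K x i) + (\<Sum>i\<in>Sd. V i * x i))"

text \<open>Two error-free transmissions are compared. Equal outputs around a seed force equal
  messages there and hence equal seed inputs. In the linear relation for a discarded output the
  noise occurs only through the residual, so all active outputs agree, and then all messages
  do.\<close>

lemma reconstructs_inj:
  assumes rec: "reconstructs h K (DTx + DRx) (active_users K s) G Sd W"
    and supp: "\<And>k. k \<notin> active_users K s \<Longrightarrow> me k = me' k"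
      "\<And>k. k \<notin> urllc_users K s \<Longrightarrow> mu k = mu' k"
    and ok: "\<not> decoding_error h K n DTx DRx C s me mu z"
      "\<not> decoding_error h K n DTx DRx C s me' mu' z'"
    and out: "\<And>k t. k \<in> G \<Longrightarrow> t < n \<Longrightarrow>
        channel_output h K n (channel_input K DTx C s me mu) z k t
      = channel_output h K n (channel_input K DTx C s me' mu') z' k t"
    and res: "\<And>r t. r \<in> active_users K s - G \<Longrightarrow> t < n \<Longrightarrow>
        z (r, t) - (\<Sum>i\<in>G. W r i * z (i, t)) = z' (r, t) - (\<Sum>i\<in>G. W r i * z' (i, t))"
  shows "me = me' \<and> mu = mu'"
proof -
  let ?A = "active_users K s"
  let ?X = "channel_input K DTx C s me mu" and ?X' = "channel_input K DTx C s me' mu'"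
  let ?Y = "channel_output h K n ?X z" and ?Y' = "channel_output h K n ?X' z'"
  have Y_ext: "?Y k = ?Y' k" if "\<And>t. t < n \<Longrightarrow> ?Y k t = ?Y' k t" for k
  proof
    fix t show "?Y k t = ?Y' k t"
      using that[of t] by (cases "t < n") (simp_all add: channel_output_def)
  qed
  have YG: "?Y k = ?Y' k" if "k \<in> G" for k
    using out[OF that] by (rule Y_ext)
  have dec_e: "me j = me' j" if "j \<in> ?A" "\<And>l. linked ?A DRx j l \<Longrightarrow> ?Y l = ?Y' l" for j
  proof -
    have "coop_history K s (rx_coop C s) ?Y DRx j = coop_history K s (rx_coop C s) ?Y' DRx j"
      by (rule coop_history_cong) (rule that(2))
    moreover have "?Y j = ?Y' j" by (rule that(2)[OF linked_refl[OF that(1)]])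
    ultimately show ?thesis
      using ok that(1) unfolding decoding_error_def Let_def embb_users_def by metis
  qed
  have dec_u: "mu j = mu' j" if "?Y j = ?Y' j" for j
    using ok supp(2)[of j] that unfolding decoding_error_def Let_def
    by (cases "j \<in> urllc_users K s") metis+
  have seed: "?X sd t = ?X' sd t" if sd: "sd \<in> Sd" for sd t
  proof -
    have sdA: "sd \<in> ?A" and link: "\<And>r. linked ?A (DTx + DRx) sd r \<Longrightarrow> r \<in> G"
      using rec sd unfolding reconstructs_def by auto
    \<comment> \<open>A user within \<open>DTx\<close> of the seed is decoded from outputs within
      \<open>DRx\<close> of that user; these are within \<open>DTx + DRx\<close> of the seed and
      therefore in \<open>G\<close>.\<close>
    have near: "me j = me' j" if "linked ?A DTx sd j" for j
    proof (rule dec_e)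
      show "j \<in> ?A" using that by (rule linked_mem)
      show "?Y l = ?Y' l" if "linked ?A DRx j l" for l
        using link linked_trans[OF \<open>linked ?A DTx sd j\<close> that] YG by blast
    qed
    have "coop_history K s (tx_coop C s) me DTx sd = coop_history K s (tx_coop C s) me' DTx sd"
      by (rule coop_history_cong) (rule near)
    moreover have "me sd = me' sd" by (rule near[OF linked_refl[OF sdA]])
    moreover have "mu sd = mu' sd" by (rule dec_u[OF YG[OF link[OF linked_refl[OF sdA]]]])
    ultimately show ?thesis by (simp add: channel_input_def)
  qed
  have YA: "?Y r = ?Y' r" if r: "r \<in> ?A" for r
  proof (cases "r \<in> G")
    case False
    show ?thesis
    proof (rule Y_ext)
      fix t assume t: "t < n"
      obtain V where V: "\<And>x. (\<forall>l. l \<notin> ?A \<longrightarrow> x l = 0) \<Longrightarrow>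
          gain h K x r = (\<Sum>i\<in>G. W r i * gain h K x i) + (\<Sum>i\<in>Sd. V i * x i)"
        using rec r False unfolding reconstructs_def by blast
      \<comment> \<open>The last bracket is the residual, which holds all the noise. The
        coefficients \<open>W\<close> and \<open>V\<close> are the same for both transmissions and
        all times.\<close>
      have lin: "?Y r t = (\<Sum>i\<in>G. W r i * ?Y i t) + (\<Sum>i\<in>Sd. V i * ?X i t)
          + (z (r, t) - (\<Sum>i\<in>G. W r i * z (i, t)))"
        using t V[of "\<lambda>l. ?X l t"] channel_input_inactive[of _ K s DTx C me mu t]
        by (simp add: channel_output_eq distrib_left sum.distrib)
      have lin': "?Y' r t = (\<Sum>i\<in>G. W r i * ?Y' i t) + (\<Sum>i\<in>Sd. V i * ?X' i t)
          + (z' (r, t) - (\<Sum>i\<in>G. W r i * z' (i, t)))"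
        using t V[of "\<lambda>l. ?X' l t"] channel_input_inactive[of _ K s DTx C me' mu' t]
        by (simp add: channel_output_eq distrib_left sum.distrib)
      have "(\<Sum>i\<in>G. W r i * ?Y i t) = (\<Sum>i\<in>G. W r i * ?Y' i t)"
        by (intro sum.cong refl) (simp add: YG)
      moreover have "(\<Sum>i\<in>Sd. V i * ?X i t) = (\<Sum>i\<in>Sd. V i * ?X' i t)"
        by (intro sum.cong refl) (simp add: seed)
      ultimately show "?Y r t = ?Y' r t"
        unfolding lin lin' using res[of r t] r False t by simp
    qed
  qed (rule YG)
  have "me k = me' k" for k
  proof (cases "k \<in> ?A")
    case True
    then show ?thesis by (rule dec_e) (intro YA, erule linked_mem(2))
  qed (rule supp)
  moreover have "mu k = mu' k" for k
  proof (cases "k \<in> urllc_users K s")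
    case True
    then have "k \<in> ?A" by (auto simp: urllc_users_def active_users_def)
    then show ?thesis by (intro dec_u YA)
  qed (rule supp)
  ultimately show ?thesis by auto
qed

section \<open>Runs of active users\<close>

text \<open>A maximal block of active users between the inactive positions \<open>a\<close> and
  \<open>a + L + 1\<close>. The position \<open>a\<close> may be \<open>0\<close>, in front of the
  first user.\<close>

definition run :: "nat set \<Rightarrow> nat \<Rightarrow> nat \<Rightarrow> bool" where
  "run A a L \<longleftrightarrow> a \<notin> A \<and> {a + 1..a + L} \<subseteq> A \<and> a + L + 1 \<notin> A"

lemma run_mem: "run A a L \<Longrightarrow> a < k \<Longrightarrow> k \<le> a + L \<Longrightarrow> k \<in> A"
  by (auto simp: run_def)

lemma run_exists:
  assumes "finite A" "0 \<notin> A" "k \<in> A"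
  obtains a L where "run A a L" "a < k" "k \<le> a + L"
proof -
  define a where "a = Max {i. i < k \<and> i \<notin> A}"
  define b where "b = (LEAST i. k < i \<and> i \<notin> A)"
  have "0 < k" using assms by (cases k) auto
  then have "a \<in> {i. i < k \<and> i \<notin> A}"
    unfolding a_def using assms by (intro Max_in) auto
  then have a: "a < k" "a \<notin> A" by auto
  have a_max: "i \<in> A" if "a < i" "i < k" for i
    using that Max_ge[of "{i. i < k \<and> i \<notin> A}" i] unfolding a_def[symmetric]
    by (cases "i \<in> A") auto
  have "infinite (- A)" using assms by (simp add: finite_compl)
  then have "\<exists>i>k. i \<notin> A"
    by (meson ComplD infinite_nat_iff_unbounded)
  then have b: "k < b" "b \<notin> A"
    unfolding b_def using LeastI_ex[of "\<lambda>i. k < i \<and> i \<notin> A"] by auto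
  have b_min: "i \<in> A" if "k < i" "i < b" for i
    using that not_less_Least[of i "\<lambda>i. k < i \<and> i \<notin> A"] unfolding b_def by auto
  have "i \<in> A" if "i \<in> {a + 1..a + (b - 1 - a)}" for i
  proof -
    have "a < i" "i < b" using that a b by auto
    then show ?thesis using a_max[of i] b_min[of i] assms(3) by (cases i k rule: linorder_cases) auto
  qed
  then have "run A a (b - 1 - a)" using a b by (auto simp: run_def)
  with a b show thesis by (intro that[of a "b - 1 - a"]) auto
qed

lemma run_linked:
  assumes "run A a L" "a < k" "k \<le> a + L" "linked A r k l"
  shows "a < l \<and> l \<le> a + L"
proof (rule ccontr)
  assume "\<not> ?thesis"
  then consider "l \<le> a" | "a + L + 1 \<le> l" by linarith
  then show False
  proof cases
    case 1
    then have "a \<in> {min k l..max k l}" using assms by auto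
    then show False using assms unfolding linked_def run_def by blast
  next
    case 2
    then have "a + L + 1 \<in> {min k l..max k l}" using assms by auto
    then show False using assms unfolding linked_def run_def by blast
  qed
qed

lemma run_unique:
  assumes "run A a L" "a < k" "k \<le> a + L" "run A b M" "b < k" "k \<le> b + M"
  shows "a = b \<and> L = M"
proof -
  have "\<not> a < b" using assms run_mem[OF assms(1), of b] by (auto simp: run_def)
  moreover have "\<not> b < a" using assms run_mem[OF assms(4), of a] by (auto simp: run_def)
  ultimately have ab: "a = b" by simp
  moreover have "\<not> L < M" using assms ab run_mem[OF assms(4), of "a + L + 1"] by (auto simp: run_def)
  moreover have "\<not> M < L" using assms ab run_mem[OF assms(1), of "b + M + 1"] by (auto simp: run_def)
  ultimately show ?thesis by simp
qed

text \<open>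
  In a run of \<open>L\<close> active users, the positions \<open>j E\<close> and \<open>j E + 1\<close> for \<open>j \<le> q = L div E\<close> are seeds if
  \<open>j - q\<close> is even, and their outputs are cut if \<open>j - q\<close> is odd. Position \<open>0\<close> does not belong to the
  run, so that exactly \<open>q\<close> outputs are cut.
\<close>

definition cut_left :: "nat set \<Rightarrow> nat \<Rightarrow> nat set" where
  "cut_left A E = {k. \<exists>a L j. run A a L \<and> 1 \<le> j \<and> j < L div E \<and> odd (j + L div E) \<and> k = a + j * E}"

definition cut_right :: "nat set \<Rightarrow> nat \<Rightarrow> nat set" where
  "cut_right A E = {k. \<exists>a L j. run A a L \<and> j < L div E \<and> odd (j + L div E) \<and> k = a + j * E + 1}"

definition seeds :: "nat set \<Rightarrow> nat \<Rightarrow> nat set" where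
  "seeds A E = {k. \<exists>a L j. run A a L \<and> j \<le> L div E \<and> even (j + L div E) \<and>
     (k = a + j * E \<or> k = a + j * E + 1) \<and> a < k \<and> k \<le> a + L}"

text \<open>A run of \<open>L\<close> users has \<open>L div E\<close> such members, as many as
  there are cuts in it. They are easier to average than the cuts: membership of \<open>k\<close>
  refers only to the last inactive position before \<open>k\<close>, not to the length of the
  run.\<close>

definition multiples :: "nat set \<Rightarrow> nat \<Rightarrow> nat set" where
  "multiples A E = {k. \<exists>a j. a \<notin> A \<and> 1 \<le> j \<and> k = a + j * E \<and> {a + 1..k} \<subseteq> A}"

lemma div_position:
  fixes j L E :: nat
  assumes "j < L div E"
  shows "j * E + E \<le> L"
proof -
  have "Suc j * E \<le> L div E * E" using assms by (intro mult_right_mono) auto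
  also have "\<dots> \<le> L" by simp
  finally show ?thesis by simp
qed

lemma mult_gap:
  fixes i j E :: nat
  assumes "i < j"
  shows "i * E + E \<le> j * E"
proof -
  have "Suc i * E \<le> j * E" using assms by (intro mult_right_mono) auto
  then show ?thesis by simp
qed

lemma cutE:
  assumes "k \<in> cut_left A E \<union> cut_right A E" "2 \<le> E"
  obtains a L j where "run A a L" "j < L div E" "odd (j + L div E)"
    "k = a + j * E \<or> k = a + j * E + 1" "a < k" "k \<le> a + L"
proof -
  from assms(1) consider (l) "k \<in> cut_left A E" | (r) "k \<in> cut_right A E" by auto
  then show thesis
  proof cases
    case l
    then obtain a L j where *: "run A a L" "1 \<le> j" "j < L div E" "odd (j + L div E)" "k = a + j * E"
      unfolding cut_left_def by blast
    then show thesis using div_position[OF *(3)] assms(2) by (intro that[of a L j]) auto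
  next
    case r
    then obtain a L j where *: "run A a L" "j < L div E" "odd (j + L div E)" "k = a + j * E + 1"
      unfolding cut_right_def by blast
    then show thesis using div_position[OF *(2)] assms(2) by (intro that[of a L j]) auto
  qed
qed

text \<open>Links do not leave a run, and inside a run the indices \<open>j\<close> of seeds and
  cuts differ by parity. Positions belonging to different indices are at least
  \<open>E - 1 = D + 1\<close> apart.\<close>

lemma seeds_far_from_cuts:
  assumes "sd \<in> seeds A (D + 2)" "linked A D sd r"
  shows "r \<notin> cut_left A (D + 2) \<union> cut_right A (D + 2)"
proof
  let ?E = "D + 2"
  assume "r \<in> cut_left A ?E \<union> cut_right A ?E"
  then obtain b M i where r: "run A b M" "i < M div ?E" "odd (i + M div ?E)"
    "r = b + i * ?E \<or> r = b + i * ?E + 1" "b < r" "r \<le> b + M"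
    by (rule cutE) auto
  obtain a L j where sd: "run A a L" "j \<le> L div ?E" "even (j + L div ?E)"
    "sd = a + j * ?E \<or> sd = a + j * ?E + 1" "a < sd" "sd \<le> a + L"
    using assms(1) unfolding seeds_def by blast
  have "a < r \<and> r \<le> a + L" by (rule run_linked[OF sd(1,5,6) assms(2)])
  then have ab: "a = b" "L = M" using run_unique[OF sd(1) _ _ r(1,5,6)] by auto
  have near: "r \<le> sd + D" "sd \<le> r + D" using assms(2) by (auto simp: linked_def)
  have "i \<noteq> j" using r(3) sd(3) ab by auto
  then consider "i < j" | "j < i" by linarith
  then show False
  proof cases
    case 1
    show False using mult_gap[OF 1, of ?E] r(4) sd(4) near ab by linarith
  next
    case 2
    show False using mult_gap[OF 2, of ?E] r(4) sd(4) near ab by linarith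
  qed
qed

text \<open>Position \<open>j * E\<close> is itself a left cut if \<open>j + L div E\<close> is odd;
  otherwise \<open>(j - 1) * E + 1\<close> is a right cut, \<open>E - 1\<close> places before it.
  Left and right cuts are disjoint because \<open>E\<close> is at least \<open>2\<close>.\<close>

lemma card_multiples_le:
  assumes fin: "finite A" and "0 \<notin> A" and E: "2 \<le> E"
  shows "card (multiples A E) \<le> card (cut_left A E \<union> cut_right A E)"
proof -
  have sub: "cut_left A E \<union> cut_right A E \<subseteq> A"
  proof
    fix k assume "k \<in> cut_left A E \<union> cut_right A E"
    then obtain a L j where "run A a L" "a < k" "k \<le> a + L" using E by (rule cutE)
    then show "k \<in> A" by (rule run_mem)
  qed
  then have fins: "finite (cut_left A E)" "finite (cut_right A E)"
    using fin finite_subset by auto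
  have "cut_left A E \<inter> cut_right A E = {}"
  proof (rule equals0I)
    fix k assume "k \<in> cut_left A E \<inter> cut_right A E"
    then obtain a L j b M i where *: "run A a L" "1 \<le> j" "j < L div E" "k = a + j * E"
      "run A b M" "i < M div E" "k = b + i * E + 1"
      unfolding cut_left_def cut_right_def by blast
    have "a < k" "k \<le> a + L" using * div_position[OF *(3)] E by auto
    moreover have "b < k" "k \<le> b + M" using * div_position[OF *(6)] E by auto
    ultimately have "a = b" using run_unique * by blast
    then have eq: "j * E = i * E + 1" using * by simp
    consider "j \<le> i" | "i < j" by linarith
    then show False
    proof cases
      case 1
      then have "j * E \<le> i * E" by (rule mult_right_mono) simp
      then show False using eq by simp
    next
      case 2
      show False using mult_gap[OF 2, of E] eq E by simp
    qed
  qed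
  then have card: "card (cut_left A E \<union> cut_right A E) = card (cut_left A E) + card (cut_right A E)"
    using fins by (intro card_Un_disjoint)
  have "multiples A E \<subseteq> cut_left A E \<union> (\<lambda>k. k + (E - 1)) ` cut_right A E"
  proof
    fix k assume "k \<in> multiples A E"
    then obtain a j where k: "a \<notin> A" "1 \<le> j" "k = a + j * E" "{a + 1..k} \<subseteq> A"
      unfolding multiples_def by blast
    have "a < k" using k E by auto
    then have "k \<in> A" using k by auto
    then obtain b L where r: "run A b L" "b < k" "k \<le> b + L"
      using run_exists[OF fin assms(2)] by blast
    have "\<not> b < a" using run_mem[OF r(1), of a] k r by auto
    moreover have "\<not> a < b" using subsetD[OF k(4), of b] r by (auto simp: run_def)
    ultimately have ab: "b = a" by simp
    have jq: "j \<le> L div E"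
    proof -
      have "j * E \<le> L" using r k ab by simp
      then have "j * E div E \<le> L div E" by (rule div_le_mono)
      then show ?thesis using E by simp
    qed
    show "k \<in> cut_left A E \<union> (\<lambda>k. k + (E - 1)) ` cut_right A E"
    proof (cases "odd (j + L div E)")
      case True
      then have "j < L div E" using jq by (cases "j = L div E") auto
      then have "k \<in> cut_left A E"
        unfolding cut_left_def using r(1) k ab True by blast
      then show ?thesis by simp
    next
      case False
      have j1: "j - 1 < L div E" using jq k(2) by simp
      have "odd ((j - 1) + L div E)" using False k(2) by (cases j) auto
      then have "a + (j - 1) * E + 1 \<in> cut_right A E"
        unfolding cut_right_def using r(1) ab j1 by blast
      moreover have "k = a + (j - 1) * E + 1 + (E - 1)"
        using k(2,3) E by (cases j) auto
      ultimately show ?thesis by blast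
    qed
  qed
  then have "card (multiples A E) \<le> card (cut_left A E \<union> (\<lambda>k. k + (E - 1)) ` cut_right A E)"
    using fins by (intro card_mono) auto
  also have "\<dots> \<le> card (cut_left A E) + card ((\<lambda>k. k + (E - 1)) ` cut_right A E)"
    by (rule card_Un_le)
  also have "\<dots> \<le> card (cut_left A E) + card (cut_right A E)"
    using card_image_le[OF fins(2)] by simp
  finally show ?thesis using card by simp
qed

text \<open>The coefficients are chosen before \<open>x\<close>, so the same ones serve for all
  times and messages. Such functionals are closed under linear combinations, which lets the inputs
  be recovered one after another.\<close>

definition determined ::
    "(nat \<Rightarrow> nat \<Rightarrow> real) \<Rightarrow> nat \<Rightarrow> nat set \<Rightarrow> nat set \<Rightarrow> nat set \<Rightarrow> ((nat \<Rightarrow> real) \<Rightarrow> real) \<Rightarrow> bool"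
  where "determined h K A G Sd f \<longleftrightarrow> (\<exists>w v. \<forall>x. (\<forall>l. l \<notin> A \<longrightarrow> x l = 0) \<longrightarrow>
     f x = (\<Sum>i\<in>G. w i * gain h K x i) + (\<Sum>i\<in>Sd. v i * x i))"

lemma determined_add:
  assumes "determined h K A G Sd f" "determined h K A G Sd g"
  shows "determined h K A G Sd (\<lambda>x. f x + g x)"
proof -
  obtain w v w' v' where
    f: "\<And>x. (\<forall>l. l \<notin> A \<longrightarrow> x l = 0) \<Longrightarrow> f x = (\<Sum>i\<in>G. w i * gain h K x i) + (\<Sum>i\<in>Sd. v i * x i)" and
    g: "\<And>x. (\<forall>l. l \<notin> A \<longrightarrow> x l = 0) \<Longrightarrow> g x = (\<Sum>i\<in>G. w' i * gain h K x i) + (\<Sum>i\<in>Sd. v' i * x i)"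
    using assms unfolding determined_def by blast
  show ?thesis
    unfolding determined_def
    by (intro exI[of _ "\<lambda>i. w i + w' i"] exI[of _ "\<lambda>i. v i + v' i"])
      (auto simp: f g algebra_simps sum.distrib)
qed

lemma determined_scale:
  assumes "determined h K A G Sd f"
  shows "determined h K A G Sd (\<lambda>x. c * f x)"
proof -
  obtain w v where
    f: "\<And>x. (\<forall>l. l \<notin> A \<longrightarrow> x l = 0) \<Longrightarrow> f x = (\<Sum>i\<in>G. w i * gain h K x i) + (\<Sum>i\<in>Sd. v i * x i)"
    using assms unfolding determined_def by blast
  show ?thesis
    unfolding determined_def
    by (intro exI[of _ "\<lambda>i. c * w i"] exI[of _ "\<lambda>i. c * v i"])
      (auto simp: f algebra_simps sum_distrib_left)
qed

lemma determined_cong: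
  assumes "determined h K A G Sd f" "\<And>x. (\<forall>l. l \<notin> A \<longrightarrow> x l = 0) \<Longrightarrow> g x = f x"
  shows "determined h K A G Sd g"
proof -
  obtain w v where
    f: "\<And>x. (\<forall>l. l \<notin> A \<longrightarrow> x l = 0) \<Longrightarrow> f x = (\<Sum>i\<in>G. w i * gain h K x i) + (\<Sum>i\<in>Sd. v i * x i)"
    using assms(1) unfolding determined_def by blast
  show ?thesis
    unfolding determined_def
  proof (rule exI[of _ w], rule exI[of _ v], intro allI impI)
    fix x :: "nat \<Rightarrow> real" assume x: "\<forall>l. l \<notin> A \<longrightarrow> x l = 0"
    show "g x = (\<Sum>i\<in>G. w i * gain h K x i) + (\<Sum>i\<in>Sd. v i * x i)"
      using assms(2)[OF x] f[OF x] by (rule trans)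
  qed
qed

lemma determined_inactive:
  assumes "l \<notin> A"
  shows "determined h K A G Sd (\<lambda>x. x l)"
  unfolding determined_def
  by (intro exI[of _ "\<lambda>_. 0"]) (use assms in auto)

lemma determined_seed:
  assumes "finite Sd" "l \<in> Sd"
  shows "determined h K A G Sd (\<lambda>x. x l)"
  unfolding determined_def
  by (rule exI[of _ "\<lambda>_. 0"], rule exI[of _ "\<lambda>i. if i = l then 1 else 0"])
    (use assms in \<open>simp add: if_distrib[of "\<lambda>c. c * _"] cong: if_cong\<close>)

lemma determined_gain:
  assumes "finite G" "l \<in> G"
  shows "determined h K A G Sd (\<lambda>x. gain h K x l)"
  unfolding determined_def
  by (rule exI[of _ "\<lambda>i. if i = l then 1 else 0"], rule exI[of _ "\<lambda>_. 0"])
    (use assms in \<open>simp add: if_distrib[of "\<lambda>c. c * _"] cong: if_cong\<close>)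

text \<open>Neighbours beyond the border may be included because inputs outside \<open>A\<close>
  vanish; for \<open>k = 1\<close> the index \<open>k - 1\<close> is \<open>0\<close>, which is not
  in \<open>A\<close>.\<close>

lemma gain_eq:
  assumes "A \<subseteq> {1..K}" "k \<in> A" "\<forall>l. l \<notin> A \<longrightarrow> x l = 0"
  shows "gain h K x k = h k k * x k + h (k - 1) k * x (k - 1) + h (k + 1) k * x (k + 1)"
proof -
  have k: "1 \<le> k" using assms by auto
  have "(\<Sum>l\<in>neighbours K k. h l k * x l) = (\<Sum>l\<in>{k - 1, k + 1}. h l k * x l)"
  proof (rule sum.mono_neutral_left)
    show "neighbours K k \<subseteq> {k - 1, k + 1}" by (auto simp: neighbours_def)
    show "\<forall>l\<in>{k - 1, k + 1} - neighbours K k. h l k * x l = 0"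
    proof
      fix l assume "l \<in> {k - 1, k + 1} - neighbours K k"
      then have "l \<notin> {1..K}" using k by (auto simp: neighbours_def)
      then show "h l k * x l = 0" using assms by auto
    qed
  qed simp
  then show ?thesis by (simp add: gain_def)
qed

context
  fixes h :: "nat \<Rightarrow> nat \<Rightarrow> real" and K :: nat and A G Sd :: "nat set"
  assumes A: "A \<subseteq> {1..K}" and GA: "G \<subseteq> A" and h: "\<And>k. 1 \<le> k \<Longrightarrow> 0 < h k (k + 1) \<and> 0 < h (k + 1) k"
begin

lemma finite_G: "finite G"
  using A GA by (meson finite_atLeastAtMost finite_subset)

text \<open>The output of \<open>k\<close> is solved for the input of \<open>k + 1\<close>, which is
  possible because the cross gain \<open>h (k + 1) k\<close> is positive.\<close>

lemma determined_right:
  assumes k: "k \<in> G" and det: "determined h K A G Sd (\<lambda>x. x (k - 1))" "determined h K A G Sd (\<lambda>x. x k)"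
  shows "determined h K A G Sd (\<lambda>x. x (k + 1))"
proof -
  have k1: "1 \<le> k" and kA: "k \<in> A" using k A GA by auto
  have "determined h K A G Sd (\<lambda>x. (1 / h (k + 1) k) *
      (gain h K x k + ((- h k k) * x k + (- h (k - 1) k) * x (k - 1))))"
    by (intro determined_scale determined_add det determined_gain finite_G k)
  then show ?thesis
  proof (rule determined_cong)
    fix x :: "nat \<Rightarrow> real" assume x: "\<forall>l. l \<notin> A \<longrightarrow> x l = 0"
    have "h (k + 1) k \<noteq> 0" using h[OF k1] by simp
    then show "x (k + 1) = (1 / h (k + 1) k) *
      (gain h K x k + ((- h k k) * x k + (- h (k - 1) k) * x (k - 1)))"
      unfolding gain_eq[OF A kA x] by simp
  qed
qed

lemma determined_left:
  assumes k: "k \<in> G" and det: "determined h K A G Sd (\<lambda>x. x k)" "determined h K A G Sd (\<lambda>x. x (k + 1))"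
  shows "determined h K A G Sd (\<lambda>x. x (k - 1))"
proof (cases "k = 1")
  case True
  then show ?thesis using A by (intro determined_inactive) auto
next
  case False
  moreover have kA: "k \<in> A" using k GA by auto
  moreover have "1 \<le> k" using kA A by auto
  ultimately have k1: "1 \<le> k - 1" by simp
  have "determined h K A G Sd (\<lambda>x. (1 / h (k - 1) k) *
      (gain h K x k + ((- h k k) * x k + (- h (k + 1) k) * x (k + 1))))"
    by (intro determined_scale determined_add det determined_gain finite_G k)
  then show ?thesis
  proof (rule determined_cong)
    fix x :: "nat \<Rightarrow> real" assume x: "\<forall>l. l \<notin> A \<longrightarrow> x l = 0"
    have "h (k - 1) k \<noteq> 0" using h[OF k1] k1 by simp
    then show "x (k - 1) = (1 / h (k - 1) k) *
      (gain h K x k + ((- h k k) * x k + (- h (k + 1) k) * x (k + 1)))"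
      unfolding gain_eq[OF A kA x] by simp
  qed
qed

end

text \<open>From the seeds of index \<open>j\<close> one sweeps right with the outputs at
  \<open>j * E + 1\<close> to \<open>(j + 1) * E - 1\<close> and left with those at
  \<open>j * E\<close> down to \<open>(j - 1) * E + 2\<close>. This yields the inputs up to
  \<open>(j + 1) * E\<close> and down to \<open>(j - 1) * E + 1\<close>, one cut user on either
  side, without any cut output. Parity is counted from \<open>L div E\<close> so that this last
  index is a seed and serves the incomplete block at the end.\<close>

lemma run_determined:
  assumes A: "A \<subseteq> {1..K}" and h: "\<And>k. 1 \<le> k \<Longrightarrow> 0 < h k (k + 1) \<and> 0 < h (k + 1) k"
    and E: "2 \<le> E" and r: "run A a L" and p: "1 \<le> p" "p \<le> L"
  defines "G \<equiv> A - (cut_left A E \<union> cut_right A E)"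
  shows "determined h K A G (seeds A E) (\<lambda>x. x (a + p))"
proof -
  let ?q = "L div E" and ?det = "determined h K A G (seeds A E)"
  have GA: "G \<subseteq> A" by (auto simp: G_def)
  have "seeds A E \<subseteq> A"
    unfolding seeds_def using run_mem by blast
  then have finS: "finite (seeds A E)" using A by (meson finite_atLeastAtMost finite_subset)
  have G: "a + i \<in> G" if "1 \<le> i" "i \<le> L"
    "\<And>j. j < ?q \<Longrightarrow> odd (j + ?q) \<Longrightarrow> i \<noteq> j * E \<and> i \<noteq> j * E + 1" for i
  proof -
    have "a + i \<notin> cut_left A E \<union> cut_right A E"
    proof
      assume "a + i \<in> cut_left A E \<union> cut_right A E"
      then obtain b M j where c: "run A b M" "j < M div E" "odd (j + M div E)"
        "a + i = b + j * E \<or> a + i = b + j * E + 1" "b < a + i" "a + i \<le> b + M"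
        using E by (rule cutE)
      have "a = b \<and> L = M" using that(1,2) by (intro run_unique[OF r _ _ c(1,5,6)]) auto
      then show False using c that(3)[of j] by auto
    qed
    moreover have "a + i \<in> A" using that by (intro run_mem[OF r]) auto
    ultimately show ?thesis by (simp add: G_def)
  qed
  have seed: "a + i \<in> seeds A E" if "1 \<le> i" "i \<le> L" "j \<le> ?q" "even (j + ?q)"
    "i = j * E \<or> i = j * E + 1" for i j
    unfolding seeds_def using that r by fastforce
  have seed_det: "?det (\<lambda>x. x (a + i))" if "j \<le> ?q" "even (j + ?q)" "i = j * E \<or> i = j * E + 1" for i j
  proof (cases "1 \<le> i \<and> i \<le> L")
    case True
    then show ?thesis using that by (intro determined_seed finS seed) auto
  next
    \<comment> \<open>A seed position outside the run is \<open>0\<close> or \<open>L + 1\<close>;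
      both are inactive, so the input is known to vanish.\<close>
    case False
    have "j * E \<le> ?q * E" using that by (intro mult_right_mono) auto
    also have "\<dots> \<le> L" by simp
    finally have "i = 0 \<or> i = L + 1" using False that(3) by auto
    then show ?thesis using r by (intro determined_inactive) (auto simp: run_def)
  qed
  \<comment> \<open>The induction carries two adjacent inputs, since the output relation needs both
    to give the next one.\<close>
  have right: "?det (\<lambda>x. x (a + (j * E + i))) \<and> ?det (\<lambda>x. x (a + (j * E + i + 1)))"
    if j: "j \<le> ?q" "even (j + ?q)" and "i + 1 \<le> E" "j * E + i + 1 \<le> L" for i j
    using that(3,4)
  proof (induction i)
    case 0
    show ?case using seed_det[OF j, of "j * E"] seed_det[OF j, of "j * E + 1"] by simp
  next
    case (Suc i)
    then have IH: "?det (\<lambda>x. x (a + (j * E + i)))" "?det (\<lambda>x. x (a + (j * E + i + 1)))" by auto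
    have "a + (j * E + i + 1) \<in> G"
    proof (rule G)
      fix j' assume j': "j' < ?q" "odd (j' + ?q)"
      then have "j' \<noteq> j" using j by auto
      then consider "j' < j" | "j < j'" by linarith
      then show "j * E + i + 1 \<noteq> j' * E \<and> j * E + i + 1 \<noteq> j' * E + 1"
      proof cases
        case 1
        then show ?thesis using mult_gap[OF 1, of E] E by auto
      next
        case 2
        then show ?thesis using mult_gap[OF 2, of E] Suc.prems by auto
      qed
    qed (use Suc.prems in auto)
    from determined_right[where h = h, OF A GA h this] IH
    have "?det (\<lambda>x. x (a + (j * E + i + 1) + 1))" by simp
    then show ?case using IH by simp
  qed
  have left: "?det (\<lambda>x. x (a + (j * E - i))) \<and> ?det (\<lambda>x. x (a + (j * E - i + 1)))"
    if j: "1 \<le> j" "j \<le> ?q" "even (j + ?q)" and "i + 1 \<le> E" for i j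
    using that(4)
  proof (induction i)
    case 0
    show ?case using seed_det[OF j(2,3), of "j * E"] seed_det[OF j(2,3), of "j * E + 1"] by simp
  next
    case (Suc i)
    then have IH: "?det (\<lambda>x. x (a + (j * E - i)))" "?det (\<lambda>x. x (a + (j * E - i + 1)))" by auto
    have jE: "E \<le> j * E" using j by (cases j) auto
    have "j * E \<le> ?q * E" using j by (intro mult_right_mono) auto
    also have "\<dots> \<le> L" by simp
    finally have jL: "j * E \<le> L" .
    have "a + (j * E - i) \<in> G"
    proof (rule G)
      fix j' assume j': "j' < ?q" "odd (j' + ?q)"
      then have "j' \<noteq> j" using j by auto
      then consider "j' < j" | "j < j'" by linarith
      then show "j * E - i \<noteq> j' * E \<and> j * E - i \<noteq> j' * E + 1"
      proof cases
        case 1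
        then show ?thesis using mult_gap[OF 1, of E] Suc.prems by auto
      next
        case 2
        then show ?thesis using mult_gap[OF 2, of E] E by auto
      qed
    next
      show "1 \<le> j * E - i" using jE Suc.prems by linarith
      show "j * E - i \<le> L" using jL by linarith
    qed
    moreover have "a + (j * E - i) - 1 = a + (j * E - Suc i)"
      "a + (j * E - i) + 1 = a + (j * E - i + 1)" "j * E - Suc i + 1 = j * E - i"
      using Suc.prems jE by linarith+
    ultimately show ?case
      using determined_left[where h = h, OF A GA h, of "a + (j * E - i)" "seeds A E"] IH by simp
  qed
  define i s where "i = p div E" and "s = p mod E"
  have ps: "p = i * E + s" "s < E" using E by (auto simp: i_def s_def)
  have iq: "i \<le> ?q" unfolding i_def using p by (intro div_le_mono)
  \<comment> \<open>With \<open>p = i * E + s\<close>: if \<open>i\<close> is a seed index, go right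
    from it by \<open>s\<close>. Otherwise \<open>p\<close> is reached from \<open>i - 1\<close> on
    the left if \<open>s = 0\<close>, and from \<open>i + 1\<close> on the right if
    \<open>s > 0\<close>.\<close>
  show ?thesis
  proof (cases "even (i + ?q)")
    case True
    show ?thesis
    proof (cases s)
      case 0
      then show ?thesis using seed_det[OF iq True, of p] ps by auto
    next
      case (Suc s')
      then show ?thesis using right[OF iq True, of s'] ps p by auto
    qed
  next
    case False
    then have i1: "i + 1 \<le> ?q" using iq by (cases "i = ?q") auto
    show ?thesis
    proof (cases s)
      case 0
      then have i: "1 \<le> i" using ps p by (cases i) auto
      have "?det (\<lambda>x. x (a + ((i - 1) * E + (E - 1) + 1)))"
        using right[of "i - 1" "E - 1"] i iq False E p ps 0 by (cases i) auto
      moreover have "(i - 1) * E + (E - 1) + 1 = p" using ps 0 i E by (cases i) auto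
      ultimately show ?thesis by (simp only:)
    next
      case (Suc s')
      have "?det (\<lambda>x. x (a + ((i + 1) * E - (E - s))))"
        using left[of "i + 1" "E - s"] i1 False Suc ps by auto
      moreover have "(i + 1) * E - (E - s) = p" using ps by auto
      ultimately show ?thesis by (simp only:)
    qed
  qed
qed

text \<open>Every input is determined, hence by linearity every noise-free output, in particular the
  cut ones.\<close>

lemma reconstructs_exists:
  assumes A: "A \<subseteq> {1..K}" and h: "\<And>k. 1 \<le> k \<Longrightarrow> 0 < h k (k + 1) \<and> 0 < h (k + 1) k"
  obtains G Sd W where "reconstructs h K D A G Sd W"
    and "card G + card (multiples A (D + 2)) \<le> card A"
proof -
  let ?E = "D + 2"
  define G where "G = A - (cut_left A ?E \<union> cut_right A ?E)"
  have fin: "finite A" and A0: "0 \<notin> A" using A finite_subset by auto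
  have cut_sub: "cut_left A ?E \<union> cut_right A ?E \<subseteq> A"
  proof
    fix k assume "k \<in> cut_left A ?E \<union> cut_right A ?E"
    then obtain a L j where "run A a L" "a < k" "k \<le> a + L" by (rule cutE) auto
    then show "k \<in> A" by (rule run_mem)
  qed
  have det: "determined h K A G (seeds A ?E) (\<lambda>x. x k)" for k
  proof (cases "k \<in> A")
    case True
    then obtain a L where r: "run A a L" "a < k" "k \<le> a + L"
      using run_exists[OF fin A0] by blast
    have "determined h K A G (seeds A ?E) (\<lambda>x. x (a + (k - a)))"
      unfolding G_def by (rule run_determined[OF A]) (use h r in auto)
    then show ?thesis using r by simp
  qed (rule determined_inactive)
  have "determined h K A G (seeds A ?E) (\<lambda>x. gain h K x r)" if "r \<in> A" for r
  proof (rule determined_cong)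
    show "determined h K A G (seeds A ?E)
        (\<lambda>x. h r r * x r + h (r - 1) r * x (r - 1) + h (r + 1) r * x (r + 1))"
      by (intro determined_add determined_scale det)
  qed (rule gain_eq[OF A that])
  then have "\<forall>r\<in>A. \<exists>w. \<exists>V. \<forall>x. (\<forall>l. l \<notin> A \<longrightarrow> x l = 0) \<longrightarrow>
        gain h K x r = (\<Sum>i\<in>G. w i * gain h K x i) + (\<Sum>i\<in>seeds A ?E. V i * x i)"
    unfolding determined_def by blast
  then obtain W where W: "\<forall>r\<in>A. \<exists>V. \<forall>x. (\<forall>l. l \<notin> A \<longrightarrow> x l = 0) \<longrightarrow>
        gain h K x r = (\<Sum>i\<in>G. W r i * gain h K x i) + (\<Sum>i\<in>seeds A ?E. V i * x i)"
    by metis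
  have "reconstructs h K D A G (seeds A ?E) W"
    unfolding reconstructs_def
  proof (intro conjI ballI allI impI)
    show "G \<subseteq> A" by (auto simp: G_def)
    show "seeds A ?E \<subseteq> A" unfolding seeds_def using run_mem by blast
    fix sd r assume "sd \<in> seeds A ?E" "linked A D sd r"
    then show "r \<in> G"
      unfolding G_def using seeds_far_from_cuts linked_mem(2) by blast
  next
    fix r assume "r \<in> A - G"
    then show "\<exists>V. \<forall>x. (\<forall>l. l \<notin> A \<longrightarrow> x l = 0) \<longrightarrow>
        gain h K x r = (\<Sum>i\<in>G. W r i * gain h K x i) + (\<Sum>i\<in>seeds A ?E. V i * x i)"
      using W by blast
  qed
  moreover have "card G + card (multiples A ?E) \<le> card A"
  proof -
    have "card G = card A - card (cut_left A ?E \<union> cut_right A ?E)"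
      unfolding G_def by (rule card_Diff_subset[OF finite_subset[OF cut_sub fin] cut_sub])
    moreover have "card (cut_left A ?E \<union> cut_right A ?E) \<le> card A"
      by (rule card_mono[OF fin cut_sub])
    moreover have "card (multiples A ?E) \<le> card (cut_left A ?E \<union> cut_right A ?E)"
      by (rule card_multiples_le[OF fin A0]) simp
    ultimately show ?thesis by linarith
  qed
  ultimately show thesis by (rule that)
qed

section \<open>Rate bounds for a fixed activity pattern\<close>

lemma pair_pmf_of_set_product:
  assumes "finite A" "A \<noteq> {}" "finite B" "B \<noteq> {}"
  shows "pair_pmf (pmf_of_set A) (pmf_of_set B) = pmf_of_set (A \<times> B)"
proof (rule pmf_eqI)
  fix x
  show "pmf (pair_pmf (pmf_of_set A) (pmf_of_set B)) x = pmf (pmf_of_set (A \<times> B)) x"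
    using assms by (cases x) (auto simp: pmf_pair indicator_def card_cartesian_product)
qed

definition message_tuples ::
    "nat \<Rightarrow> nat \<Rightarrow> activity \<Rightarrow> (nat \<Rightarrow> real) \<Rightarrow> real \<Rightarrow> ((nat \<Rightarrow> nat) \<times> (nat \<Rightarrow> nat)) set" where
  "message_tuples K n s R RU =
     PiE_dflt (embb_users K s) 0 (\<lambda>k. message_set n (R k)) \<times>
     PiE_dflt (urllc_users K s) 0 (\<lambda>_. message_set n RU)"

lemma message_set_finite [simp]: "finite (message_set n R)"
  by (simp add: message_set_def)

text \<open>As \<open>2 powr (n * R)\<close> is at least \<open>1\<close>, rounding down loses at
  most a factor \<open>2\<close>, that is, one bit.\<close>

lemma card_message_set_ge:
  assumes "0 \<le> R"
  shows "2 powr (real n * R - 1) \<le> real (card (message_set n R))"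
proof -
  define x where "x = 2 powr (real n * R)"
  have "1 \<le> x" using assms by (simp add: x_def ge_one_powr_ge_zero)
  then have "1 \<le> \<lfloor>x\<rfloor>" by simp
  then have "x / 2 \<le> real_of_int \<lfloor>x\<rfloor>"
    using floor_correct[of x] by linarith
  then show ?thesis
    using \<open>1 \<le> \<lfloor>x\<rfloor>\<close> by (simp add: message_set_def powr_diff flip: x_def)
qed

lemma message_set_nonempty: "0 \<le> R \<Longrightarrow> message_set n R \<noteq> {}"
  using card_message_set_ge[of R n] powr_gt_zero[of 2 "real n * R - 1"] by fastforce

lemma message_tuples_finite [simp]: "finite (message_tuples K n s R RU)"
  unfolding message_tuples_def by (intro finite_cartesian_product finite_PiE_dflt finite_users) auto

lemma card_message_tuples:
  "card (message_tuples K n s R RU) =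
     (\<Prod>k\<in>embb_users K s. card (message_set n (R k))) * card (message_set n RU) ^ card (urllc_users K s)"
  unfolding message_tuples_def
  by (simp add: card_cartesian_product card_PiE_dflt finite_users)

lemma card_message_tuples_pos:
  fixes R :: "nat \<Rightarrow> real" and RU :: real
  assumes "\<forall>k. 0 \<le> R k" "0 \<le> RU"
  shows "0 < card (message_tuples K n s R RU)"
  using assms message_set_nonempty by (simp add: card_message_tuples finite_users card_gt_0_iff)

lemma card_message_tuples_ge:
  fixes R :: "nat \<Rightarrow> real" and RU :: real
  assumes "\<forall>k. 0 \<le> R k" "0 \<le> RU"
  shows "2 powr (real n * ((\<Sum>k\<in>embb_users K s. R k) + card (urllc_users K s) * RU)
      - (card (embb_users K s) + card (urllc_users K s)))
    \<le> real (card (message_tuples K n s R RU))"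
proof -
  have "real n * ((\<Sum>k\<in>embb_users K s. R k) + card (urllc_users K s) * RU)
      - (card (embb_users K s) + card (urllc_users K s))
      = (\<Sum>k\<in>embb_users K s. real n * R k - 1) + card (urllc_users K s) * (real n * RU - 1)"
    by (simp add: sum_subtractf sum_distrib_left algebra_simps)
  also have "2 powr \<dots> = (\<Prod>k\<in>embb_users K s. 2 powr (real n * R k - 1))
      * (2 powr (real n * RU - 1)) ^ card (urllc_users K s)"
    by (simp add: powr_add powr_sum powr_powr powr_realpow[symmetric] finite_users mult.commute)
  also have "\<dots> \<le> (\<Prod>k\<in>embb_users K s. real (card (message_set n (R k))))
      * real (card (message_set n RU)) ^ card (urllc_users K s)"
    using assms by (intro mult_mono prod_mono power_mono card_message_set_ge conjI prod_nonneg) auto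
  finally show ?thesis by (simp add: card_message_tuples)
qed

lemma message_pmf_eq:
  fixes R :: "nat \<Rightarrow> real" and RU :: real
  assumes "\<forall>k. 0 \<le> R k" "0 \<le> RU"
  shows "message_pmf K n s R RU = pmf_of_set (message_tuples K n s R RU)"
  unfolding message_pmf_def message_tuples_def
  using assms message_set_nonempty
  by (simp add: Pi_pmf_of_set finite_users pair_pmf_of_set_product finite_PiE_dflt)

lemma finite_set_activity: "finite (set_pmf (activity_pmf \<rho> \<rho>\<^sub>f K))"
  unfolding activity_pmf_def
  by (rule finite_subset[OF set_Pi_pmf_subset']) (auto intro!: finite_PiE_dflt)

definition success_set where
  "success_set h K n DTx DRx C s m = {z \<in> space (noise_measure K n).
     \<not> decoding_error h K n DTx DRx C s (fst m) (snd m) z}"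

lemma success_set_measurable:
  assumes "measurable_code C"
  shows "success_set h K n DTx DRx C s m \<in> sets (noise_measure K n)"
proof -
  have "success_set h K n DTx DRx C s m = space (noise_measure K n) -
      {z \<in> space (noise_measure K n). decoding_error h K n DTx DRx C s (fst m) (snd m) z}"
    by (auto simp: success_set_def)
  then show ?thesis using decoding_error_set[OF assms] by simp
qed

lemma measure_success_set:
  assumes "measurable_code C"
  shows "measure (noise_measure K n) (success_set h K n DTx DRx C s m) = 1 -
      measure (noise_measure K n)
        {z \<in> space (noise_measure K n). decoding_error h K n DTx DRx C s (fst m) (snd m) z}"
proof -
  interpret prob_space "noise_measure K n" by (rule prob_space_noise)
  have "success_set h K n DTx DRx C s m = space (noise_measure K n) -
      {z \<in> space (noise_measure K n). decoding_error h K n DTx DRx C s (fst m) (snd m) z}"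
    by (auto simp: success_set_def)
  then show ?thesis using prob_compl[OF decoding_error_set[OF assms]] by simp
qed

text \<open>\<open>achievable_rates\<close> with the eMBB rates \<open>R\<close> exposed in place of
  their mean, so that bounds for single patterns can be averaged later.\<close>

definition reliable ::
    "(nat \<Rightarrow> nat \<Rightarrow> real) \<Rightarrow> real \<Rightarrow> real \<Rightarrow> nat \<Rightarrow> nat \<Rightarrow> real \<Rightarrow> (activity \<Rightarrow> nat \<Rightarrow> real) \<Rightarrow> real \<Rightarrow> bool" where
  "reliable h \<rho> \<rho>\<^sub>f D K P R RU \<longleftrightarrow> 0 \<le> RU \<and> (\<forall>s k. 0 \<le> R s k) \<and>
     (\<exists>DTx DRx C. DTx + DRx = D \<and>
        (\<forall>n. measurable_code (C n) \<and> power_constraint \<rho> \<rho>\<^sub>f K n DTx R RU P (C n)) \<and>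
        (\<lambda>n. error_prob h \<rho> \<rho>\<^sub>f K n DTx DRx R RU (C n)) \<longlonglongrightarrow> 0)"

text \<open>The error probability is a mean over patterns; once it is below a quarter of the
  probability of \<open>s\<close>, the error for \<open>s\<close> is at most \<open>1 / 4\<close>.
  Together with the \<open>1 / 4\<close> lost to atypical noise this leaves half of the
  messages.\<close>

lemma reliable_code:
  assumes "reliable h \<rho> \<rho>\<^sub>f D K P R RU" and s: "s \<in> set_pmf (activity_pmf \<rho> \<rho>\<^sub>f K)"
  obtains DTx DRx C where "DTx + DRx = D" "\<And>n. measurable_code (C n)"
    "\<And>n m k. m \<in> message_tuples K n s (R s) RU \<Longrightarrow> k \<in> active_users K s \<Longrightarrow>
       (1 / real n) * (\<Sum>t<n. (channel_input K DTx (C n) s (fst m) (snd m) k t)\<^sup>2) \<le> P"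
    "\<forall>\<^sub>F n in sequentially. 3 / 4 * real (card (message_tuples K n s (R s) RU))
      \<le> (\<Sum>m\<in>message_tuples K n s (R s) RU.
           measure (noise_measure K n) (success_set h K n DTx DRx (C n) s m))"
proof -
  obtain DTx DRx C where D: "DTx + DRx = D" and mc: "\<And>n. measurable_code (C n)" and
    pc: "\<And>n. power_constraint \<rho> \<rho>\<^sub>f K n DTx R RU P (C n)" and
    lim: "(\<lambda>n. error_prob h \<rho> \<rho>\<^sub>f K n DTx DRx R RU (C n)) \<longlonglongrightarrow> 0"
    and nonneg: "0 \<le> RU" "\<forall>s k. 0 \<le> R s k"
    using assms(1) unfolding reliable_def by blast
  let ?M = "\<lambda>n. message_tuples K n s (R s) RU"
  have pmf: "message_pmf K n s' (R s') RU = pmf_of_set (message_tuples K n s' (R s') RU)" for n s'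
    using nonneg by (intro message_pmf_eq) auto
  have cpos: "0 < card (?M n)" for n
    using nonneg by (intro card_message_tuples_pos) auto
  have set: "set_pmf (pmf_of_set (?M n)) = ?M n" for n
    using cpos[of n] by (intro set_pmf_of_set) auto
  define err where "err n s' = measure_pmf.expectation (message_pmf K n s' (R s') RU) (\<lambda>(me, mu).
         measure (noise_measure K n)
           {z \<in> space (noise_measure K n). decoding_error h K n DTx DRx (C n) s' me mu z})" for n s'
  have err_nonneg: "0 \<le> err n s'" for n s'
    unfolding err_def by (intro integral_nonneg_AE) auto
  have p: "0 < pmf (activity_pmf \<rho> \<rho>\<^sub>f K) s" using s by (simp add: set_pmf_iff pmf_pos)
  have "error_prob h \<rho> \<rho>\<^sub>f K n DTx DRx R RU (C n)
      = (\<Sum>a\<in>set_pmf (activity_pmf \<rho> \<rho>\<^sub>f K). err n a * pmf (activity_pmf \<rho> \<rho>\<^sub>f K) a)" for n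
    unfolding error_prob_def err_def
    by (rule integral_measure_pmf_real[OF finite_set_activity])
  then have le: "err n s * pmf (activity_pmf \<rho> \<rho>\<^sub>f K) s
      \<le> error_prob h \<rho> \<rho>\<^sub>f K n DTx DRx R RU (C n)" for n
    using s err_nonneg finite_set_activity
    by (auto intro!: member_le_sum[of s _ "\<lambda>a. err n a * pmf (activity_pmf \<rho> \<rho>\<^sub>f K) a"])
  have "\<forall>\<^sub>F n in sequentially. error_prob h \<rho> \<rho>\<^sub>f K n DTx DRx R RU (C n)
      < pmf (activity_pmf \<rho> \<rho>\<^sub>f K) s / 4"
    using p by (intro order_tendstoD(2)[OF lim]) auto
  then have "\<forall>\<^sub>F n in sequentially. 3 / 4 * real (card (?M n))
      \<le> (\<Sum>m\<in>?M n. measure (noise_measure K n) (success_set h K n DTx DRx (C n) s m))"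
  proof eventually_elim
    case (elim n)
    have "err n s * pmf (activity_pmf \<rho> \<rho>\<^sub>f K) s \<le> (1 / 4) * pmf (activity_pmf \<rho> \<rho>\<^sub>f K) s"
      using le[of n] elim by simp
    then have "err n s \<le> 1 / 4" using p by (rule mult_right_le_imp_le)
    moreover have "err n s = (\<Sum>m\<in>?M n. measure (noise_measure K n)
        {z \<in> space (noise_measure K n). decoding_error h K n DTx DRx (C n) s (fst m) (snd m) z})
        / card (?M n)"
      unfolding err_def pmf using cpos[of n]
      by (subst integral_pmf_of_set) (auto simp: case_prod_beta)
    moreover have "(\<Sum>m\<in>?M n. measure (noise_measure K n) (success_set h K n DTx DRx (C n) s m))
        = card (?M n) - (\<Sum>m\<in>?M n. measure (noise_measure K n)
        {z \<in> space (noise_measure K n). decoding_error h K n DTx DRx (C n) s (fst m) (snd m) z})"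
      by (simp add: measure_success_set[OF mc] sum_subtractf)
    ultimately show ?case using cpos[of n] by (simp add: field_simps)
  qed
  moreover have "(1 / real n) * (\<Sum>t<n. (channel_input K DTx (C n) s (fst m) (snd m) k t)\<^sup>2) \<le> P"
    if "m \<in> ?M n" "k \<in> active_users K s" for n m k
  proof -
    have "\<forall>m\<in>set_pmf (pmf_of_set (?M n)). \<forall>k\<in>active_users K s.
        (1 / real n) * (\<Sum>t<n. (channel_input K DTx (C n) s (fst m) (snd m) k t)\<^sup>2) \<le> P"
      using pc[of n] s unfolding power_constraint_def AE_measure_pmf_iff pmf case_prod_beta
      by blast
    then show ?thesis using that unfolding set by blast
  qed
  ultimately show thesis using D mc by (intro that)
qed

text \<open>Squared Frobenius norm of the channel matrix; by Cauchy-Schwarz it bounds the received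
  power by a multiple of the transmitted power.\<close>

definition gain_energy :: "(nat \<Rightarrow> nat \<Rightarrow> real) \<Rightarrow> nat \<Rightarrow> real" where
  "gain_energy h K = (\<Sum>k\<in>{1..K}. \<Sum>l\<in>{1..K}. (if l = k \<or> l \<in> neighbours K k then h l k else 0)\<^sup>2)"

lemma gain_power:
  assumes "G \<subseteq> {1..K}" and x: "\<And>l. l \<in> {1..K} \<Longrightarrow> (\<Sum>t<n. (x l t)\<^sup>2) \<le> B" and "0 \<le> B"
  shows "(\<Sum>k\<in>G. \<Sum>t<n. (gain h K (\<lambda>l. x l t) k)\<^sup>2) \<le> gain_energy h K * (real K * B)"
proof -
  let ?g = "\<lambda>k l. if l = k \<or> l \<in> neighbours K k then h l k else 0"
  have gain: "gain h K y k = (\<Sum>l\<in>{1..K}. ?g k l * y l)" if k: "k \<in> {1..K}" for y k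
  proof -
    have nk: "k \<notin> neighbours K k" "finite (neighbours K k)" by (auto simp: neighbours_def)
    have "gain h K y k = (\<Sum>l\<in>insert k (neighbours K k). h l k * y l)"
      using nk by (simp add: gain_def)
    also have "\<dots> = (\<Sum>l\<in>{1..K}. ?g k l * y l)"
      using k by (intro sum.mono_neutral_cong_left) (auto simp: neighbours_def)
    finally show ?thesis .
  qed
  have "(\<Sum>k\<in>G. \<Sum>t<n. (gain h K (\<lambda>l. x l t) k)\<^sup>2) \<le> (\<Sum>k\<in>{1..K}. \<Sum>t<n. (gain h K (\<lambda>l. x l t) k)\<^sup>2)"
    using assms(1) by (intro sum_mono2 sum_nonneg) auto
  also have "\<dots> = (\<Sum>k\<in>{1..K}. \<Sum>t<n. (\<Sum>l\<in>{1..K}. ?g k l * x l t)\<^sup>2)"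
    by (intro sum.cong refl) (simp only: gain)
  also have "\<dots> \<le> (\<Sum>k\<in>{1..K}. \<Sum>t<n. (\<Sum>l\<in>{1..K}. (?g k l)\<^sup>2) * (\<Sum>l\<in>{1..K}. (x l t)\<^sup>2))"
    by (intro sum_mono Cauchy_Schwarz_ineq_sum)
  also have "\<dots> = gain_energy h K * (\<Sum>t<n. \<Sum>l\<in>{1..K}. (x l t)\<^sup>2)"
    unfolding gain_energy_def by (rule sum_product[symmetric])
  also have "(\<Sum>t<n. \<Sum>l\<in>{1..K}. (x l t)\<^sup>2) = (\<Sum>l\<in>{1..K}. \<Sum>t<n. (x l t)\<^sup>2)"
    by (rule sum.swap)
  also have "gain_energy h K * \<dots> \<le> gain_energy h K * (\<Sum>l\<in>{1..K}. B)"
    unfolding gain_energy_def by (intro mult_left_mono sum_mono x sum_nonneg) auto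
  finally show ?thesis by simp
qed

lemma signal_power:
  assumes "G \<subseteq> {1..K}" "0 < n" "0 < P"
    and pow: "\<And>k. k \<in> active_users K s \<Longrightarrow>
       (1 / real n) * (\<Sum>t<n. (channel_input K DTx C s me mu k t)\<^sup>2) \<le> P"
  shows "(\<Sum>(k, t)\<in>G \<times> {..<n}. (gain h K (\<lambda>l. channel_input K DTx C s me mu l t) k)\<^sup>2)
    \<le> real n * (gain_energy h K * real K * P)"
proof -
  have "(\<Sum>t<n. (channel_input K DTx C s me mu l t)\<^sup>2) \<le> real n * P" for l
  proof (cases "l \<in> active_users K s")
    case True
    from pow[OF this] assms(2) show ?thesis by (simp add: field_simps)
  next
    case False
    then show ?thesis using assms by (simp add: channel_input_inactive)
  qed
  then have "(\<Sum>k\<in>G. \<Sum>t<n. (gain h K (\<lambda>l. channel_input K DTx C s me mu l t) k)\<^sup>2)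
      \<le> gain_energy h K * (real K * (real n * P))"
    using assms by (intro gain_power) auto
  then show ?thesis by (simp add: sum.cartesian_product mult_ac)
qed

text \<open>Only the \<open>card G * n\<close> factors of the kept outputs grow with the power, each
  like \<open>sqrt P\<close>. For \<open>1 \<le> P\<close> the summand \<open>8 * K\<close> is
  absorbed into a multiple of \<open>P\<close>, so that \<open>C\<close> depends on neither
  \<open>P\<close> nor \<open>n\<close>.\<close>

lemma decoding_volume_rate:
  assumes "0 < K" "0 \<le> \<gamma>"
  obtains C where "\<And>P n. 1 \<le> P \<Longrightarrow>
    decoding_volume K G W (\<gamma> * P) n \<le> 2 powr (real n * (real (card G) / 2 * log 2 P + C))"
proof -
  define b where "b = sqrt (2 * pi * residual_energy K G W)"
  have b: "0 < b"
    unfolding b_def residual_energy_def using assms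
    by (auto intro!: mult_pos_pos add_pos_nonneg sum_nonneg)
  define a where "a = sqrt (2 * pi * (2 * \<gamma> + 8 * real K))"
  have a: "0 < a" unfolding a_def using assms by (auto intro!: add_nonneg_pos)
  define Q where "Q = exp 1 * a ^ card G * b ^ card ({1..K} - G)"
  have Q: "0 < Q" using a b by (simp add: Q_def)
  show thesis
  proof (rule that[of "log 2 Q"])
    fix P :: real and n assume P: "1 \<le> P"
    have "2 * (\<gamma> * P) + 8 * real K \<le> (2 * \<gamma> + 8 * real K) * P"
      using mult_left_mono[OF P, of "real K"] by (simp add: algebra_simps)
    then have "sqrt (2 * pi * (2 * (\<gamma> * P) + 8 * real K)) \<le> sqrt (2 * pi * ((2 * \<gamma> + 8 * real K) * P))"
      by simp
    also have "\<dots> = a * sqrt P" by (simp add: a_def flip: real_sqrt_mult)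
    finally have 1: "sqrt (2 * pi * (2 * (\<gamma> * P) + 8 * real K)) \<le> a * sqrt P" .
    have "decoding_volume K G W (\<gamma> * P) n
        = (exp 1 * sqrt (2 * pi * (2 * (\<gamma> * P) + 8 * real K)) ^ card G * b ^ card ({1..K} - G)) ^ n"
      by (simp add: decoding_volume_def b_def power_mult_distrib power_mult exp_of_nat_mult[of n 1, simplified])
    also have "\<dots> \<le> (exp 1 * (a * sqrt P) ^ card G * b ^ card ({1..K} - G)) ^ n"
      using a b P assms 1 by (intro power_mono mult_mono) (auto intro!: mult_nonneg_nonneg add_nonneg_nonneg)
    also have "exp 1 * (a * sqrt P) ^ card G * b ^ card ({1..K} - G) = Q * sqrt P ^ card G"
      by (simp add: Q_def power_mult_distrib mult_ac)
    also have "sqrt P ^ card G = 2 powr (real (card G) / 2 * log 2 P)"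
    proof -
      have "sqrt P = 2 powr (1 / 2 * log 2 P)"
        using P by (simp add: powr_half_sqrt[symmetric] powr_def log_def)
      then show ?thesis by (simp add: powr_power)
    qed
    also have "Q = 2 powr (log 2 Q)" using Q by simp
    also have "(2 powr log 2 Q * 2 powr (real (card G) / 2 * log 2 P)) ^ n
        = 2 powr (real n * (real (card G) / 2 * log 2 P + log 2 Q))"
      by (simp add: powr_add[symmetric] powr_power algebra_simps)
    finally show "decoding_volume K G W (\<gamma> * P) n
        \<le> 2 powr (real n * (real (card G) / 2 * log 2 P + log 2 Q))" .
  qed
qed

lemma rate_le_of_eventually:
  fixes T y c :: real
  assumes "\<forall>\<^sub>F n in sequentially. real n * T - c \<le> real n * y"
  shows "T \<le> y"
proof (rule field_le_epsilon)
  fix e :: real assume e: "0 < e"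
  have "\<forall>\<^sub>F n in sequentially. c / e < real n"
    using filterlim_real_sequentially by (simp add: filterlim_at_top_dense)
  with assms have "\<forall>\<^sub>F n in sequentially. real n * T - c \<le> real n * y \<and> c / e < real n \<and> 0 < n"
    using eventually_gt_at_top[of 0] by eventually_elim auto
  then obtain n where n: "real n * T - c \<le> real n * y" "c / e < real n" "0 < n"
    by (auto dest!: eventually_happens'[rotated])
  have "c \<le> real n * e" using n(2) e by (simp add: field_simps)
  then have "real n * T \<le> real n * (y + e)" using n(1) by (simp add: algebra_simps)
  then show "T \<le> y + e" using n(3) by simp
qed

lemma sum_rate_bound:
  assumes K: "0 < K" and h: "\<And>k. 1 \<le> k \<Longrightarrow> 0 < h k (k + 1) \<and> 0 < h (k + 1) k"
    and s: "s \<in> set_pmf (activity_pmf \<rho> \<rho>\<^sub>f K)"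
  obtains C where "\<And>P (R :: activity \<Rightarrow> nat \<Rightarrow> real) (RU :: real). 1 \<le> P \<Longrightarrow> reliable h \<rho> \<rho>\<^sub>f D K P R RU \<Longrightarrow>
    (\<Sum>k\<in>embb_users K s. R s k) + card (urllc_users K s) * RU
    \<le> (real (card (active_users K s)) - real (card (multiples (active_users K s) (D + 2)))) / 2 * log 2 P + C"
proof -
  let ?A = "active_users K s"
  have A: "?A \<subseteq> {1..K}" by (auto simp: active_users_def)
  obtain G Sd W where rec: "reconstructs h K D ?A G Sd W"
    and cG: "card G + card (multiples ?A (D + 2)) \<le> card ?A"
    by (rule reconstructs_exists[OF A]) (use h in auto)
  have GA: "G \<subseteq> ?A" using rec by (simp add: reconstructs_def)
  then have G: "G \<subseteq> {1..K}" using A by auto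
  define \<gamma> where "\<gamma> = gain_energy h K * real K"
  have \<gamma>: "0 \<le> \<gamma>" unfolding \<gamma>_def gain_energy_def by (intro mult_nonneg_nonneg sum_nonneg) auto
  obtain C where C: "\<And>P n. 1 \<le> P \<Longrightarrow>
      decoding_volume K G W (\<gamma> * P) n \<le> 2 powr (real n * (real (card G) / 2 * log 2 P + C))"
    using decoding_volume_rate[OF K \<gamma>, of G W] by blast
  show thesis
  proof (rule that[of C])
    fix P R RU assume P: "1 \<le> P" and rel: "reliable h \<rho> \<rho>\<^sub>f D K P R RU"
    have nonneg: "0 \<le> RU" "\<forall>k. 0 \<le> R s k" using rel by (auto simp: reliable_def)
    obtain DTx DRx Co where D: "DTx + DRx = D" and mc: "\<And>n. measurable_code (Co n)"
      and pow: "\<And>n m k. m \<in> message_tuples K n s (R s) RU \<Longrightarrow> k \<in> ?A \<Longrightarrow>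
         (1 / real n) * (\<Sum>t<n. (channel_input K DTx (Co n) s (fst m) (snd m) k t)\<^sup>2) \<le> P"
      and succ: "\<forall>\<^sub>F n in sequentially. 3 / 4 * real (card (message_tuples K n s (R s) RU))
        \<le> (\<Sum>m\<in>message_tuples K n s (R s) RU.
             measure (noise_measure K n) (success_set h K n DTx DRx (Co n) s m))"
      using reliable_code[OF rel s] by blast
    let ?T = "(\<Sum>k\<in>embb_users K s. R s k) + card (urllc_users K s) * RU"
    let ?c = "real (card (embb_users K s) + card (urllc_users K s))"
    \<comment> \<open>\<open>?c\<close> is one bit of rounding for each message; the further
      \<open>1\<close> is the factor \<open>2\<close> from having only half of the messages.\<close>
    have "\<forall>\<^sub>F n in sequentially. real n * ?T - (?c + 1) \<le> real n * (real (card G) / 2 * log 2 P + C)"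
      using succ eventually_gt_at_top[of 0]
    proof eventually_elim
      case (elim n)
      let ?M = "message_tuples K n s (R s) RU"
      define S where "S m = (\<lambda>(k, t). gain h K (\<lambda>l. channel_input K DTx (Co n) s (fst m) (snd m) l t) k)"
        for m
      have "(\<Sum>m\<in>?M. measure (noise_measure K n) (success_set h K n DTx DRx (Co n) s m))
          \<le> card ?M / 4 + decoding_volume K G W (\<gamma> * P) n"
      proof (rule noise_decodable_bound[where S = S])
        fix m assume m: "m \<in> ?M"
        show "(\<Sum>i\<in>G \<times> {..<n}. (S m i)\<^sup>2) \<le> real n * (\<gamma> * P)"
          using signal_power[OF G elim(2), of P s DTx "Co n" "fst m" "snd m" h] P pow[OF m]
          by (simp add: S_def \<gamma>_def case_prod_beta)
      next
        fix m m' z z'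
        assume m: "m \<in> ?M" "m' \<in> ?M" "z \<in> success_set h K n DTx DRx (Co n) s m"
            "z' \<in> success_set h K n DTx DRx (Co n) s m'"
          and out: "\<And>k t. k \<in> G \<Longrightarrow> t < n \<Longrightarrow> z (k, t) + S m (k, t) = z' (k, t) + S m' (k, t)"
          and res: "\<And>r t. r \<in> {1..K} - G \<Longrightarrow> t < n \<Longrightarrow>
            z (r, t) - (\<Sum>i\<in>G. W r i * z (i, t)) = z' (r, t) - (\<Sum>i\<in>G. W r i * z' (i, t))"
        have "fst m = fst m' \<and> snd m = snd m'"
        proof (rule reconstructs_inj[of h K DTx DRx s G Sd W])
          show "reconstructs h K (DTx + DRx) ?A G Sd W" using rec D by simp
          show "fst m k = fst m' k" if "k \<notin> ?A" for k
            using m(1,2) that by (auto simp: message_tuples_def PiE_dflt_def embb_users_def)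
          show "snd m k = snd m' k" if "k \<notin> urllc_users K s" for k
            using m(1,2) that by (auto simp: message_tuples_def PiE_dflt_def)
          show "\<not> decoding_error h K n DTx DRx (Co n) s (fst m) (snd m) z"
            "\<not> decoding_error h K n DTx DRx (Co n) s (fst m') (snd m') z'"
            using m by (auto simp: success_set_def)
          show "channel_output h K n (channel_input K DTx (Co n) s (fst m) (snd m)) z k t
             = channel_output h K n (channel_input K DTx (Co n) s (fst m') (snd m')) z' k t"
            if "k \<in> G" "t < n" for k t
            using out[OF that] that by (simp add: S_def channel_output_eq add.commute)
          show "z (r, t) - (\<Sum>i\<in>G. W r i * z (i, t)) = z' (r, t) - (\<Sum>i\<in>G. W r i * z' (i, t))"
            if "r \<in> ?A - G" "t < n" for r t
            using res[of r t] that A by auto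
        qed
        then show "m = m'" by (simp add: prod_eq_iff)
      qed (use G K elim P \<gamma> success_set_measurable[OF mc] in auto)
      with elim(1) have "real (card ?M) \<le> 2 * decoding_volume K G W (\<gamma> * P) n" by simp
      also have "\<dots> \<le> 2 * 2 powr (real n * (real (card G) / 2 * log 2 P + C))"
        using C[OF P] by simp
      also have "\<dots> = 2 powr (real n * (real (card G) / 2 * log 2 P + C) + 1)"
        by (simp add: powr_add)
      finally have le: "real (card ?M) \<le> 2 powr (real n * (real (card G) / 2 * log 2 P + C) + 1)" .
      have "2 powr (real n * ?T - ?c) \<le> real (card ?M)"
        using card_message_tuples_ge[of "R s" RU n K s] nonneg by simp
      from order.trans[OF this le] show ?case by simp
    qed
    then have "?T \<le> real (card G) / 2 * log 2 P + C" by (rule rate_le_of_eventually)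
    also have "\<dots> \<le> (real (card ?A) - real (card (multiples ?A (D + 2)))) / 2 * log 2 P + C"
      using cG P by (intro add_right_mono mult_right_mono) auto
    finally show "?T \<le> (real (card ?A) - real (card (multiples ?A (D + 2)))) / 2 * log 2 P + C" .
  qed
qed

text \<open>Once the first message is known, the first output is a noisy version of the input of
  user \<open>2\<close>. Scaled by \<open>h 2 2 / h 2 1\<close> it predicts the second output up to
  terms common to both transmissions and the residual.\<close>

lemma urllc_pair_inj:
  assumes K: "2 \<le> K" and h: "0 < h 2 1"
    and u: "1 \<in> urllc_users K s" "2 \<in> urllc_users K s"
    and other: "\<And>k. k \<noteq> 1 \<Longrightarrow> k \<noteq> 2 \<Longrightarrow> mu k = mu' k"
    and ok: "\<not> decoding_error h K n DTx DRx C s me mu z"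
      "\<not> decoding_error h K n DTx DRx C s me mu' z'"
    and out: "\<And>t. t < n \<Longrightarrow>
        channel_output h K n (channel_input K DTx C s me mu) z 1 t
      = channel_output h K n (channel_input K DTx C s me mu') z' 1 t"
    and res: "\<And>t. t < n \<Longrightarrow>
        z (2, t) - h 2 2 / h 2 1 * z (1, t) = z' (2, t) - h 2 2 / h 2 1 * z' (1, t)"
  shows "mu = mu'"
proof -
  let ?X = "channel_input K DTx C s me mu" and ?X' = "channel_input K DTx C s me mu'"
  let ?Y = "channel_output h K n ?X z" and ?Y' = "channel_output h K n ?X' z'"
  have Y_ext: "?Y k = ?Y' k" if "\<And>t. t < n \<Longrightarrow> ?Y k t = ?Y' k t" for k
  proof
    fix t show "?Y k t = ?Y' k t"
      using that[of t] by (cases "t < n") (simp_all add: channel_output_def)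
  qed
  have dec: "mu j = mu' j" if "?Y j = ?Y' j" "j \<in> urllc_users K s" for j
    using ok that unfolding decoding_error_def Let_def by metis
  have mu1: "mu 1 = mu' 1" by (rule dec[OF Y_ext[OF out] u(1)])
  \<comment> \<open>Transmitters exchange eMBB messages only, so a URLLC message affects no input
    but that of its own user.\<close>
  have X: "?X l t = ?X' l t" if "l \<noteq> 2" for l t
  proof -
    have "mu l = mu' l" using other[of l] mu1 that by (cases "l = 1") auto
    then show ?thesis by (simp add: channel_input_def)
  qed
  have n1: "neighbours K 1 = {2}" using K by (auto simp: neighbours_def)
  have n2: "2 \<notin> neighbours K 2" by (simp add: neighbours_def)
  have g1: "gain h K (\<lambda>l. ?X l t) 1 - gain h K (\<lambda>l. ?X' l t) 1 = h 2 1 * (?X 2 t - ?X' 2 t)" for t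
    unfolding gain_def n1 using X[of 1] by (simp add: algebra_simps)
  have g2: "gain h K (\<lambda>l. ?X l t) 2 - gain h K (\<lambda>l. ?X' l t) 2 = h 2 2 * (?X 2 t - ?X' 2 t)" for t
  proof -
    have "(\<Sum>l\<in>neighbours K 2. h l 2 * ?X l t) = (\<Sum>l\<in>neighbours K 2. h l 2 * ?X' l t)"
      using n2 X by (intro sum.cong refl) metis
    then show ?thesis unfolding gain_def by (simp add: algebra_simps)
  qed
  have "?Y 2 t = ?Y' 2 t" if t: "t < n" for t
  proof -
    have "h 2 1 * (?X 2 t - ?X' 2 t) = z' (1, t) - z (1, t)"
      using out[OF t] g1[of t] t by (simp add: channel_output_eq)
    then have "?X 2 t - ?X' 2 t = (z' (1, t) - z (1, t)) / h 2 1"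
      using h by (simp add: field_simps)
    then have "h 2 2 * (?X 2 t - ?X' 2 t) = h 2 2 * ((z' (1, t) - z (1, t)) / h 2 1)"
      by (simp only:)
    also have "\<dots> = h 2 2 / h 2 1 * z' (1, t) - h 2 2 / h 2 1 * z (1, t)"
      by (simp add: algebra_simps diff_divide_distrib)
    finally show ?thesis using g2[of t] res[OF t] t by (simp add: channel_output_eq)
  qed
  then have "mu 2 = mu' 2" by (intro dec[OF Y_ext] u(2))
  then show ?thesis using mu1 other by (metis ext)
qed

text \<open>The volume bound is used with \<open>G = {1}\<close> inside each class of tuples that
  differ only in the URLLC messages of users \<open>1\<close> and \<open>2\<close>. Receivers other
  than \<open>2\<close> have coefficient \<open>0\<close> in \<open>W\<close>, so their residuals
  are the plain noises.\<close>

lemma urllc_rate_bound: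
  assumes K: "2 \<le> K" and h: "0 < h 2 1"
    and s: "s \<in> set_pmf (activity_pmf \<rho> \<rho>\<^sub>f K)"
    and u: "1 \<in> urllc_users K s" "2 \<in> urllc_users K s"
  obtains C where "\<And>P (R :: activity \<Rightarrow> nat \<Rightarrow> real) (RU :: real). 1 \<le> P \<Longrightarrow> reliable h \<rho> \<rho>\<^sub>f D K P R RU \<Longrightarrow> 2 * RU \<le> 1 / 2 * log 2 P + C"
proof -
  define W :: "nat \<Rightarrow> nat \<Rightarrow> real" where "W r i = (if r = 2 then h 2 2 / h 2 1 else 0)" for r i
  have G: "{1} \<subseteq> {1..K}" and K0: "0 < K" using K by auto
  define \<gamma> where "\<gamma> = gain_energy h K * real K"
  have \<gamma>: "0 \<le> \<gamma>" unfolding \<gamma>_def gain_energy_def by (intro mult_nonneg_nonneg sum_nonneg) auto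
  obtain C where C: "\<And>P n. 1 \<le> P \<Longrightarrow>
      decoding_volume K {1} W (\<gamma> * P) n \<le> 2 powr (real n * (real (card {1::nat}) / 2 * log 2 P + C))"
    using decoding_volume_rate[OF K0 \<gamma>, of "{1}" W] by blast
  show thesis
  proof (rule that[of C])
    fix P R RU assume P: "1 \<le> P" and rel: "reliable h \<rho> \<rho>\<^sub>f D K P R RU"
    have nonneg: "0 \<le> RU" "\<forall>k. 0 \<le> R s k" using rel by (auto simp: reliable_def)
    obtain DTx DRx Co where D: "DTx + DRx = D" and mc: "\<And>n. measurable_code (Co n)"
      and pow: "\<And>n m k. m \<in> message_tuples K n s (R s) RU \<Longrightarrow> k \<in> active_users K s \<Longrightarrow>
         (1 / real n) * (\<Sum>t<n. (channel_input K DTx (Co n) s (fst m) (snd m) k t)\<^sup>2) \<le> P"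
      and succ: "\<forall>\<^sub>F n in sequentially. 3 / 4 * real (card (message_tuples K n s (R s) RU))
        \<le> (\<Sum>m\<in>message_tuples K n s (R s) RU.
             measure (noise_measure K n) (success_set h K n DTx DRx (Co n) s m))"
      using reliable_code[OF rel s] by blast
    \<comment> \<open>Two bits of rounding for the two URLLC messages, one bit for the factor
      \<open>2\<close> in \<open>?N\<^sup>2 \<le> 2 * V\<close>.\<close>
    have "\<forall>\<^sub>F n in sequentially. real n * (2 * RU) - 3
        \<le> real n * (real (card {1::nat}) / 2 * log 2 P + C)"
      using succ eventually_gt_at_top[of 0]
    proof eventually_elim
      case (elim n)
      let ?M = "message_tuples K n s (R s) RU"
      let ?suc = "\<lambda>m. measure (noise_measure K n) (success_set h K n DTx DRx (Co n) s m)"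
      let ?N = "real (card (message_set n RU))"
      define V where "V = decoding_volume K {1} W (\<gamma> * P) n"
      define cls where "cls m = (fst m, (snd m)(1 := 0, 2 := 0))" for m :: "(nat \<Rightarrow> nat) \<times> (nat \<Rightarrow> nat)"
      define S where "S m = (\<lambda>(k, t). gain h K (\<lambda>l. channel_input K DTx (Co n) s (fst m) (snd m) l t) k)"
        for m
      have fibre: "(\<Sum>m\<in>{m \<in> ?M. cls m = c}. ?suc m) \<le> card {m \<in> ?M. cls m = c} / 4 + V" for c
        unfolding V_def
      proof (rule noise_decodable_bound[where S = S])
        fix m assume m: "m \<in> {m \<in> ?M. cls m = c}"
        then show "(\<Sum>i\<in>{1} \<times> {..<n}. (S m i)\<^sup>2) \<le> real n * (\<gamma> * P)"
          using signal_power[OF G elim(2), of P s DTx "Co n" "fst m" "snd m" h] P pow[of m n]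
          by (simp add: S_def \<gamma>_def case_prod_beta)
      next
        fix m m' z z'
        assume m: "m \<in> {m \<in> ?M. cls m = c}" "m' \<in> {m \<in> ?M. cls m = c}"
            "z \<in> success_set h K n DTx DRx (Co n) s m"
            "z' \<in> success_set h K n DTx DRx (Co n) s m'"
          and out: "\<And>k t. k \<in> {1} \<Longrightarrow> t < n \<Longrightarrow> z (k, t) + S m (k, t) = z' (k, t) + S m' (k, t)"
          and res: "\<And>r t. r \<in> {1..K} - {1} \<Longrightarrow> t < n \<Longrightarrow>
            z (r, t) - (\<Sum>i\<in>{1}. W r i * z (i, t)) = z' (r, t) - (\<Sum>i\<in>{1}. W r i * z' (i, t))"
        have eq: "cls m = cls m'" using m by simp
        then have me: "fst m = fst m'" by (simp add: cls_def)
        have "snd m = snd m'"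
        proof (rule urllc_pair_inj[where h = h, OF K h u])
          show "snd m k = snd m' k" if "k \<noteq> 1" "k \<noteq> 2" for k
            using eq that unfolding cls_def by (metis fun_upd_apply snd_conv)
          show "\<not> decoding_error h K n DTx DRx (Co n) s (fst m) (snd m) z"
            "\<not> decoding_error h K n DTx DRx (Co n) s (fst m) (snd m') z'"
            using m me by (auto simp: success_set_def)
          show "channel_output h K n (channel_input K DTx (Co n) s (fst m) (snd m)) z 1 t
             = channel_output h K n (channel_input K DTx (Co n) s (fst m) (snd m')) z' 1 t"
            if "t < n" for t
            using out[of 1 t] that me by (simp add: S_def channel_output_eq add.commute)
          show "z (2, t) - h 2 2 / h 2 1 * z (1, t) = z' (2, t) - h 2 2 / h 2 1 * z' (1, t)"
            if "t < n" for t
            using res[of 2 t] that K by (simp add: W_def)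
        qed
        with me show "m = m'" by (simp add: prod_eq_iff)
      qed (use G K0 elim P \<gamma> success_set_measurable[OF mc] in auto)
      have V0: "0 \<le> V"
        unfolding V_def using P \<gamma> by (intro decoding_volume_nonneg) simp
      let ?U = "urllc_users K s - {1, 2}"
      let ?B = "PiE_dflt (embb_users K s) 0 (\<lambda>k. message_set n (R s k)) \<times>
        PiE_dflt ?U 0 (\<lambda>_. message_set n RU)"
      \<comment> \<open>\<open>p\<close> bounds the number of classes, and there are
        \<open>p * ?N\<^sup>2\<close> tuples in all, so \<open>p\<close> cancels after summation
        over the classes.\<close>
      define p where "p = (\<Prod>k\<in>embb_users K s. real (card (message_set n (R s k)))) * ?N ^ card ?U"
      have "cls ` ?M \<subseteq> ?B"
        by (auto simp: cls_def message_tuples_def PiE_dflt_def)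
      then have "card (cls ` ?M) \<le> card ?B"
        by (intro card_mono finite_cartesian_product finite_PiE_dflt) (auto simp: finite_users)
      then have cls_card: "real (card (cls ` ?M)) \<le> p"
        by (simp add: card_cartesian_product card_PiE_dflt finite_users p_def flip: of_nat_le_iff[where 'a = real])
      have "urllc_users K s = insert 1 (insert 2 ?U)" using u by auto
      then have "card (urllc_users K s) = card ?U + 2"
        using finite_users(3)[of K s]
        by (metis Diff_iff card_insert_disjoint finite.insertI finite_Diff insertCI insertE
            numeral_eq_one_iff add_2_eq_Suc' semiring_norm(85))
      then have M: "real (card ?M) = p * ?N\<^sup>2"
        by (simp add: card_message_tuples p_def power_add power2_eq_square)
      have "0 < real (card ?M)" using card_message_tuples_pos[of "R s" RU] nonneg by simp
      then have p: "0 < p" using M by (simp add: zero_less_mult_iff)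
      have "(\<Sum>m\<in>?M. ?suc m) = (\<Sum>c\<in>cls ` ?M. \<Sum>m\<in>{m \<in> ?M. cls m = c}. ?suc m)"
        by (rule sum.image_gen) simp
      also have "\<dots> \<le> (\<Sum>c\<in>cls ` ?M. card {m \<in> ?M. cls m = c} / 4 + V)"
        by (rule sum_mono[OF fibre])
      also have "\<dots> = (\<Sum>c\<in>cls ` ?M. \<Sum>m\<in>{m \<in> ?M. cls m = c}. 1 / 4) + card (cls ` ?M) * V"
        by (simp add: sum.distrib)
      also have "(\<Sum>c\<in>cls ` ?M. \<Sum>m\<in>{m \<in> ?M. cls m = c}. 1 / 4 :: real) = (\<Sum>m\<in>?M. 1 / 4)"
        by (rule sum.image_gen[symmetric]) simp
      also have "\<dots> = real (card ?M) / 4" by simp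
      finally have "3 / 4 * real (card ?M) \<le> real (card ?M) / 4 + card (cls ` ?M) * V"
        by (rule order.trans[OF elim(1)])
      also have "\<dots> \<le> real (card ?M) / 4 + p * V"
        using cls_card V0 by (intro add_left_mono mult_right_mono)
      finally have "p * ?N\<^sup>2 \<le> p * (2 * V)" using M by (simp add: algebra_simps)
      then have "?N\<^sup>2 \<le> 2 * V" using p by simp
      have "2 powr (real n * (2 * RU) - 2) = (2 powr (real n * RU - 1))\<^sup>2"
        by (simp add: powr_power algebra_simps)
      also have "\<dots> \<le> ?N\<^sup>2" using nonneg by (intro power_mono card_message_set_ge) auto
      also have "\<dots> \<le> 2 * V" by fact
      also have "\<dots> \<le> 2 * 2 powr (real n * (real (card {1::nat}) / 2 * log 2 P + C))"
        unfolding V_def using C[OF P] by simp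
      also have "\<dots> = 2 powr (real n * (real (card {1::nat}) / 2 * log 2 P + C) + 1)"
        by (simp add: powr_add)
      finally show ?case by simp
    qed
    then show "2 * RU \<le> 1 / 2 * log 2 P + C"
      using rate_le_of_eventually by fastforce
  qed
qed

section \<open>Random activity\<close>

lemma map_fst_user_pmf: "map_pmf fst (user_pmf \<rho> \<rho>\<^sub>f) = bernoulli_pmf \<rho>"
proof -
  have "map_pmf fst (if a then map_pmf (\<lambda>b. (True, b)) (bernoulli_pmf \<rho>\<^sub>f) else return_pmf (False, False))
      = return_pmf a" for a
    by (simp add: pmf.map_comp o_def map_pmf_const)
  then show ?thesis
    by (simp add: user_pmf_def map_bind_pmf bind_return_pmf')
qed

lemma expectation_user_urllc:
  assumes "0 \<le> \<rho>" "\<rho> \<le> 1" "0 \<le> \<rho>\<^sub>f" "\<rho>\<^sub>f \<le> 1"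
  shows "measure_pmf.expectation (user_pmf \<rho> \<rho>\<^sub>f) (\<lambda>a. of_bool (fst a \<and> snd a)) = \<rho> * \<rho>\<^sub>f"
proof -
  have "map_pmf (\<lambda>a. fst a \<and> snd a) (user_pmf \<rho> \<rho>\<^sub>f)
      = bind_pmf (bernoulli_pmf \<rho>) (\<lambda>a. if a then bernoulli_pmf \<rho>\<^sub>f else return_pmf False)"
    unfolding user_pmf_def map_bind_pmf
    by (intro bind_pmf_cong refl) (simp add: pmf.map_comp o_def)
  then have "pmf (map_pmf (\<lambda>a. fst a \<and> snd a) (user_pmf \<rho> \<rho>\<^sub>f)) True = \<rho> * \<rho>\<^sub>f"
    using assms by (simp add: pmf_bind)
  moreover have "measure_pmf.expectation (user_pmf \<rho> \<rho>\<^sub>f) (\<lambda>a. of_bool (fst a \<and> snd a) :: real)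
      = measure_pmf.expectation (map_pmf (\<lambda>a. fst a \<and> snd a) (user_pmf \<rho> \<rho>\<^sub>f)) of_bool"
    by simp
  moreover have "\<dots> = pmf (map_pmf (\<lambda>a. fst a \<and> snd a) (user_pmf \<rho> \<rho>\<^sub>f)) True"
    by (subst integral_measure_pmf_real[of UNIV]) (auto simp: UNIV_bool)
  ultimately show ?thesis by simp
qed

lemma expectation_user_active:
  assumes "0 \<le> \<rho>" "\<rho> \<le> 1"
  shows "measure_pmf.expectation (user_pmf \<rho> \<rho>\<^sub>f) (\<lambda>a. of_bool (fst a)) = \<rho>"
proof -
  have "measure_pmf.expectation (user_pmf \<rho> \<rho>\<^sub>f) (\<lambda>a. of_bool (fst a) :: real)
      = measure_pmf.expectation (map_pmf fst (user_pmf \<rho> \<rho>\<^sub>f)) of_bool"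
    by simp
  then show ?thesis using assms by (simp add: map_fst_user_pmf)
qed

lemma prob_user_active:
  assumes "0 \<le> \<rho>" "\<rho> \<le> 1"
  shows "measure_pmf.prob (user_pmf \<rho> \<rho>\<^sub>f) {a. fst a} = \<rho>"
    and "measure_pmf.prob (user_pmf \<rho> \<rho>\<^sub>f) {a. \<not> fst a} = 1 - \<rho>"
proof -
  have "measure_pmf.prob (user_pmf \<rho> \<rho>\<^sub>f) {a. fst a} = measure_pmf.prob (map_pmf fst (user_pmf \<rho> \<rho>\<^sub>f)) {True}"
    by (simp add: vimage_def)
  then show 1: "measure_pmf.prob (user_pmf \<rho> \<rho>\<^sub>f) {a. fst a} = \<rho>"
    using assms by (simp add: map_fst_user_pmf measure_pmf_single)
  show "measure_pmf.prob (user_pmf \<rho> \<rho>\<^sub>f) {a. \<not> fst a} = 1 - \<rho>"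
    using measure_pmf.prob_compl[of "{a. fst a}" "user_pmf \<rho> \<rho>\<^sub>f"] 1
    by (simp add: Collect_neg_eq Compl_eq_Diff_UNIV)
qed

lemma expectation_card_users:
  "measure_pmf.expectation (activity_pmf \<rho> \<rho>\<^sub>f K) (\<lambda>s. real (card {k \<in> {1..K}. Q (s k)}))
    = real K * measure_pmf.expectation (user_pmf \<rho> \<rho>\<^sub>f) (\<lambda>a. of_bool (Q a))"
proof -
  let ?p = "activity_pmf \<rho> \<rho>\<^sub>f K"
  have "real (card {k \<in> {1..K}. Q (s k)}) = (\<Sum>k\<in>{1..K}. of_bool (Q (s k)))" for s :: activity
    by (simp add: Int_def)
  then have "measure_pmf.expectation ?p (\<lambda>s. real (card {k \<in> {1..K}. Q (s k)}))
      = (\<Sum>k\<in>{1..K}. measure_pmf.expectation ?p (\<lambda>s. of_bool (Q (s k))))"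
    by (simp only:) (intro Bochner_Integration.integral_sum integrable_measure_pmf_finite
        finite_set_activity)
  also have "\<dots> = (\<Sum>k\<in>{1..K}. measure_pmf.expectation (user_pmf \<rho> \<rho>\<^sub>f) (\<lambda>a. of_bool (Q a)))"
  proof (rule sum.cong[OF refl])
    fix k assume k: "k \<in> {1..K}"
    have "measure_pmf.expectation ?p (\<lambda>s. of_bool (Q (s k)) :: real)
        = measure_pmf.expectation (map_pmf (\<lambda>s. s k) ?p) (\<lambda>a. of_bool (Q a))"
      by simp
    also have "map_pmf (\<lambda>s. s k) ?p = user_pmf \<rho> \<rho>\<^sub>f"
      unfolding activity_pmf_def using k by (subst Pi_pmf_component) auto
    finally show "measure_pmf.expectation ?p (\<lambda>s. of_bool (Q (s k)) :: real)
        = measure_pmf.expectation (user_pmf \<rho> \<rho>\<^sub>f) (\<lambda>a. of_bool (Q a))" .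
  qed
  finally show ?thesis by simp
qed

section \<open>Expected number of discarded outputs\<close>

lemma finite_multiples: "finite A \<Longrightarrow> 1 \<le> E \<Longrightarrow> finite (multiples A E)"
  by (rule finite_subset[of _ A]) (auto simp: multiples_def Suc_le_eq)

text \<open>The condition \<open>m < k\<close> makes \<open>k - m\<close> a genuine user, whose
  inactivity has probability \<open>1 - \<rho>\<close>. Runs that start at user \<open>1\<close> are
  thereby left aside, which for \<open>\<rho> < 1\<close> costs only a bounded amount.\<close>

lemma prob_run_position:
  assumes "0 \<le> \<rho>" "\<rho> \<le> 1" "m < k" "k \<le> K"
  shows "(1 - \<rho>) * \<rho> ^ m \<le> measure_pmf.prob (activity_pmf \<rho> \<rho>\<^sub>f K)
    {s. \<not> fst (s (k - m)) \<and> (\<forall>i\<in>{k - m + 1..k}. fst (s i))}"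
proof -
  define B where "B x = (if x = k - m then {a. \<not> fst a}
    else if x \<in> {k - m + 1..k} then {a. fst a} else (UNIV :: (bool \<times> bool) set))" for x
  let ?f = "\<lambda>x. measure_pmf.prob (user_pmf \<rho> \<rho>\<^sub>f) (B x)"
  have "(\<Prod>x\<in>{1..K}. ?f x) = (\<Prod>x\<in>{k - m..k}. ?f x)"
    using assms by (intro prod.mono_neutral_right) (auto simp: B_def)
  also have "{k - m..k} = insert (k - m) {k - m + 1..k}"
    by auto
  also have "(\<Prod>x\<in>\<dots>. ?f x) = ?f (k - m) * (\<Prod>x\<in>{k - m + 1..k}. ?f x)"
    by (rule prod.insert) auto
  also have "(\<Prod>x\<in>{k - m + 1..k}. ?f x) = (\<Prod>x\<in>{k - m + 1..k}. \<rho>)"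
    using assms by (intro prod.cong refl) (auto simp: B_def prob_user_active)
  also have "?f (k - m) = 1 - \<rho>"
    using assms by (simp add: B_def prob_user_active)
  finally have "(\<Prod>x\<in>{1..K}. ?f x) = (1 - \<rho>) * \<rho> ^ m"
    using assms by simp
  moreover have "measure_pmf.prob (activity_pmf \<rho> \<rho>\<^sub>f K) (PiE_dflt {1..K} (False, False) B)
      = (\<Prod>x\<in>{1..K}. ?f x)"
    unfolding activity_pmf_def by (rule measure_Pi_pmf_PiE_dflt) simp
  moreover have "measure_pmf.prob (activity_pmf \<rho> \<rho>\<^sub>f K) (PiE_dflt {1..K} (False, False) B)
      \<le> measure_pmf.prob (activity_pmf \<rho> \<rho>\<^sub>f K) {s. \<not> fst (s (k - m)) \<and> (\<forall>i\<in>{k - m + 1..k}. fst (s i))}"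
  proof (intro measure_pmf.finite_measure_mono subsetI)
    fix s assume s: "s \<in> PiE_dflt {1..K} (False, False) B"
    have "s x \<in> B x" if "x \<in> {k - m..k}" for x
      using s that assms by (auto simp: PiE_dflt_def)
    then show "s \<in> {s. \<not> fst (s (k - m)) \<and> (\<forall>i\<in>{k - m + 1..k}. fst (s i))}"
      by (force simp: B_def split: if_splits)
  qed simp
  ultimately show ?thesis by simp
qed

text \<open>The event \<open>F k j\<close> says that the last inactive user before \<open>k\<close>
  is \<open>k - j * E\<close>. For different \<open>j\<close> these events exclude each other, so
  their probabilities may be added.\<close>

lemma expectation_multiples_ge:
  assumes "0 \<le> \<rho>" "\<rho> \<le> 1" "1 \<le> E"
  shows "(\<Sum>k\<in>{1..K}. \<Sum>j\<in>{1..(k - 1) div E}. (1 - \<rho>) * \<rho> ^ (j * E))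
    \<le> measure_pmf.expectation (activity_pmf \<rho> \<rho>\<^sub>f K)
        (\<lambda>s. real (card (multiples (active_users K s) E)))"
proof -
  let ?p = "activity_pmf \<rho> \<rho>\<^sub>f K"
  define F where "F k j = {s :: activity. \<not> fst (s (k - j * E)) \<and> (\<forall>i\<in>{k - j * E + 1..k}. fst (s i))}" for k j
  have jE: "j * E < k" if "1 \<le> k" "j \<in> {1..(k - 1) div E}" for j k
  proof -
    have "j * E \<le> (k - 1) div E * E" using that by (intro mult_right_mono) auto
    also have "\<dots> \<le> k - 1" by simp
    finally show ?thesis using that by simp
  qed
  have inner: "(\<Sum>j\<in>{1..(k - 1) div E}. indicator (F k j) s)
      \<le> (of_bool (k \<in> multiples (active_users K s) E) :: real)" if k: "k \<in> {1..K}" for k s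
  proof (cases "\<exists>j\<in>{1..(k - 1) div E}. s \<in> F k j")
    case False
    then have "(\<Sum>j\<in>{1..(k - 1) div E}. indicator (F k j) s :: real) = 0"
      by (intro sum.neutral) auto
    then show ?thesis by simp
  next
    case True
    then obtain j where j: "j \<in> {1..(k - 1) div E}" "s \<in> F k j" by blast
    have disj: "False" if "i \<in> {1..(k - 1) div E}" "i' \<in> {1..(k - 1) div E}" "i < i'" "s \<in> F k i" "s \<in> F k i'" for i i'
    proof -
      have "i * E < i' * E" using that assms by simp
      moreover have "i' * E < k" using jE[of k i'] that k by simp
      ultimately have "k - i' * E + 1 \<le> k - i * E" "k - i * E \<le> k" by linarith+
      then have "k - i * E \<in> {k - i' * E + 1..k}" by simp
      then show False using that by (auto simp: F_def)
    qed
    have "(\<Sum>i\<in>{1..(k - 1) div E}. indicator (F k i) s :: real)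
        = (\<Sum>i\<in>{1..(k - 1) div E}. if i = j then 1 else 0)"
    proof (rule sum.cong[OF refl])
      fix i assume "i \<in> {1..(k - 1) div E}"
      then have "s \<in> F k i \<longleftrightarrow> i = j"
        using disj[of i j] disj[of j i] j by (cases i j rule: linorder_cases) blast+
      then show "(indicator (F k i) s :: real) = (if i = j then 1 else 0)"
        by (simp add: indicator_def)
    qed
    also have "\<dots> = 1" using j by simp
    also have "k \<in> multiples (active_users K s) E"
    proof -
      have lt: "j * E < k" using jE j k by simp
      then have "k - j * E \<notin> active_users K s" "{k - j * E + 1..k} \<subseteq> active_users K s"
        using j k by (auto simp: F_def active_users_def)
      then show ?thesis
        unfolding multiples_def using lt j
        by (intro CollectI exI[of _ "k - j * E"] exI[of _ j]) auto
    qed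
    then have "1 = (of_bool (k \<in> multiples (active_users K s) E) :: real)" by simp
    finally show ?thesis by simp
  qed
  have "(\<Sum>k\<in>{1..K}. \<Sum>j\<in>{1..(k - 1) div E}. (1 - \<rho>) * \<rho> ^ (j * E))
      \<le> (\<Sum>k\<in>{1..K}. \<Sum>j\<in>{1..(k - 1) div E}. measure_pmf.prob ?p (F k j))"
    unfolding F_def using assms jE by (intro sum_mono prob_run_position) auto
  also have "\<dots> = measure_pmf.expectation ?p (\<lambda>s. \<Sum>k\<in>{1..K}. \<Sum>j\<in>{1..(k - 1) div E}. indicator (F k j) s)"
    by (simp add: Bochner_Integration.integral_sum integrable_measure_pmf_finite finite_set_activity)
  also have "\<dots> \<le> measure_pmf.expectation ?p (\<lambda>s. real (card (multiples (active_users K s) E)))"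
  proof (intro integral_mono integrable_measure_pmf_finite finite_set_activity)
    fix s :: activity
    let ?M = "multiples (active_users K s) E"
    have "(\<Sum>k\<in>{1..K}. \<Sum>j\<in>{1..(k - 1) div E}. indicator (F k j) s)
        \<le> (\<Sum>k\<in>{1..K}. of_bool (k \<in> ?M) :: real)"
      by (intro sum_mono inner)
    also have "\<dots> = real (card ({1..K} \<inter> ?M))" by simp
    also have "\<dots> \<le> real (card ?M)"
      using finite_multiples[OF finite_users(1) assms(3)] by (simp add: card_mono)
    finally show "(\<Sum>k\<in>{1..K}. \<Sum>j\<in>{1..(k - 1) div E}. indicator (F k j) s) \<le> real (card ?M)" .
  qed
  finally show ?thesis .
qed

text \<open>Truncated subtraction makes the first \<open>E\<close> terms equal to \<open>1\<close>;
  the others form a geometric series.\<close>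

lemma sum_shifted_powers_le:
  fixes \<rho> :: real
  assumes "0 \<le> \<rho>" "\<rho> < 1"
  shows "(\<Sum>k\<in>{1..K}. \<rho> ^ (k - E)) \<le> real E + 1 / (1 - \<rho>)"
proof -
  have "(\<Sum>k\<in>{1..K}. \<rho> ^ (k - E)) \<le> real (min K E) + (\<Sum>i\<le>K - E. \<rho> ^ i)"
  proof (induction K)
    case 0
    then show ?case by simp
  next
    case (Suc K)
    show ?case
    proof (cases "Suc K \<le> E")
      case True
      then show ?thesis using Suc by (simp add: min_def)
    next
      case False
      then have "Suc K - E = Suc (K - E)" "min K E = E" "min (Suc K) E = E" by auto
      then show ?thesis using Suc by simp
    qed
  qed
  moreover have "(\<Sum>i\<le>K - E. \<rho> ^ i) \<le> 1 / (1 - \<rho>)"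
  proof -
    have "(\<Sum>i\<le>K - E. \<rho> ^ i) \<le> suminf (\<lambda>i. \<rho> ^ i)"
      using assms by (intro sum_le_suminf summable_geometric) auto
    then show ?thesis using assms by (simp add: suminf_geometric)
  qed
  ultimately show ?thesis by simp
qed

text \<open>\<open>\<tau>\<close> is the sum of \<open>(1 - \<rho>) * \<rho> ^ (j * E)\<close> over
  all \<open>j \<ge> 1\<close>. For user \<open>k\<close> the border of the network truncates this
  series; the missing tail is at most \<open>\<tau> * \<rho> ^ (k - E)\<close>, which is summable
  over \<open>k\<close>.\<close>

lemma expectation_multiples_linear:
  assumes \<rho>: "0 < \<rho>" "\<rho> < 1" and E: "1 \<le> E"
  defines "\<tau> \<equiv> (1 - \<rho>) * \<rho> ^ E / (1 - \<rho> ^ E)"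
  shows "\<tau> * real K - \<tau> * (real E + 1 / (1 - \<rho>)) \<le>
    measure_pmf.expectation (activity_pmf \<rho> \<rho>\<^sub>f K) (\<lambda>s. real (card (multiples (active_users K s) E)))"
proof -
  define r where "r = \<rho> ^ E"
  have r: "0 < r" "r < 1" unfolding r_def using \<rho> E by (auto simp: power_less_one_iff)
  have \<tau>: "0 \<le> \<tau>" unfolding \<tau>_def using \<rho> r by (simp add: r_def)
  have geo: "(\<Sum>j\<in>{1..m}. (1 - \<rho>) * \<rho> ^ (j * E)) = \<tau> * (1 - r ^ m)" for m
  proof (induction m)
    case 0
    then show ?case by simp
  next
    case (Suc m)
    have "\<tau> * (1 - r) = (1 - \<rho>) * r" using r by (simp add: \<tau>_def r_def)
    then have "(1 - \<rho>) * r ^ Suc m = \<tau> * (1 - r) * r ^ m" by simp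
    moreover have "\<rho> ^ (Suc m * E) = r ^ Suc m"
      unfolding r_def by (simp only: power_mult[symmetric] mult.commute)
    ultimately have "(1 - \<rho>) * \<rho> ^ (Suc m * E) = \<tau> * (1 - r) * r ^ m"
      by (simp only:)
    moreover have "(\<Sum>j\<in>{1..Suc m}. (1 - \<rho>) * \<rho> ^ (j * E))
        = (\<Sum>j\<in>{1..m}. (1 - \<rho>) * \<rho> ^ (j * E)) + (1 - \<rho>) * \<rho> ^ (Suc m * E)"
      by simp
    ultimately show ?case
      unfolding Suc by (simp add: algebra_simps)
  qed
  have bound: "\<tau> * (1 - \<rho> ^ (k - E)) \<le> (\<Sum>j\<in>{1..(k - 1) div E}. (1 - \<rho>) * \<rho> ^ (j * E))" if "k \<in> {1..K}" for k
  proof -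
    have "k - 1 < E * ((k - 1) div E) + E" using dividend_less_times_div[of E "k - 1"] E by linarith
    then have "k - E \<le> E * ((k - 1) div E)" by simp
    then have "\<rho> ^ (E * ((k - 1) div E)) \<le> \<rho> ^ (k - E)"
      using \<rho> by (intro power_decreasing) auto
    then have "\<tau> * (1 - \<rho> ^ (k - E)) \<le> \<tau> * (1 - r ^ ((k - 1) div E))"
      using \<tau> by (intro mult_left_mono) (auto simp: r_def simp flip: power_mult)
    then show ?thesis by (simp only: geo)
  qed
  have "\<tau> * real K - \<tau> * (real E + 1 / (1 - \<rho>)) \<le> \<tau> * real K - \<tau> * (\<Sum>k\<in>{1..K}. \<rho> ^ (k - E))"
    using \<tau> \<rho> by (intro diff_left_mono mult_left_mono sum_shifted_powers_le) auto
  also have "\<dots> = (\<Sum>k\<in>{1..K}. \<tau> * (1 - \<rho> ^ (k - E)))"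
    by (simp add: algebra_simps sum_subtractf sum_distrib_left)
  also have "\<dots> \<le> (\<Sum>k\<in>{1..K}. \<Sum>j\<in>{1..(k - 1) div E}. (1 - \<rho>) * \<rho> ^ (j * E))"
    by (intro sum_mono bound)
  also have "\<dots> \<le> measure_pmf.expectation (activity_pmf \<rho> \<rho>\<^sub>f K)
      (\<lambda>s. real (card (multiples (active_users K s) E)))"
    using \<rho> E by (intro expectation_multiples_ge) auto
  finally show ?thesis .
qed

text \<open>For \<open>\<rho> = 1\<close> all users form a single run behind position
  \<open>0\<close>, just the kind of run that the estimate for \<open>\<rho> < 1\<close> leaves
  aside.\<close>

lemma expectation_multiples_all_active:
  assumes E: "1 \<le> E"
  shows "1 / real E * real K - 1 \<le>
    measure_pmf.expectation (activity_pmf 1 \<rho>\<^sub>f K) (\<lambda>s. real (card (multiples (active_users K s) E)))"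
proof -
  let ?p = "activity_pmf 1 \<rho>\<^sub>f K"
  have "1 / real E * real K - 1 \<le> real (card (multiples (active_users K s) E))"
    if s: "s \<in> set_pmf ?p" for s
  proof -
    have "fst ` set_pmf (user_pmf 1 \<rho>\<^sub>f) = set_pmf (bernoulli_pmf 1)"
      by (simp flip: set_map_pmf add: map_fst_user_pmf)
    also have "\<dots> \<subseteq> {True}"
      by (auto simp: set_pmf_iff) (metis pmf_bernoulli_False diff_self le_numeral_extra(4) zero_le_one)
    finally have "fst a" if "a \<in> set_pmf (user_pmf 1 \<rho>\<^sub>f)" for a using that by auto
    moreover have "s k \<in> set_pmf (user_pmf 1 \<rho>\<^sub>f)" if "k \<in> {1..K}" for k
      using s that unfolding activity_pmf_def by (auto simp: set_Pi_pmf PiE_dflt_def)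
    ultimately have "fst (s k)" if "k \<in> {1..K}" for k
      using that by blast
    then have A: "active_users K s = {1..K}"
      by (auto simp: active_users_def)
    have "(\<lambda>j. j * E) ` {1..K div E} \<subseteq> multiples {1..K} E"
    proof
      fix k assume "k \<in> (\<lambda>j. j * E) ` {1..K div E}"
      then obtain j where j: "1 \<le> j" "j \<le> K div E" "k = j * E" by auto
      have "j * E \<le> K div E * E" using j by (intro mult_right_mono) auto
      also have "\<dots> \<le> K" by simp
      finally show "k \<in> multiples {1..K} E"
        unfolding multiples_def using j by (intro CollectI exI[of _ 0] exI[of _ j]) auto
    qed
    then have "card ((\<lambda>j. j * E) ` {1..K div E}) \<le> card (multiples {1..K} E)"
      by (intro card_mono finite_multiples E) auto
    moreover have "card ((\<lambda>j. j * E) ` {1..K div E}) = K div E"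
      using E by (subst card_image) (auto simp: inj_on_def)
    ultimately have le: "K div E \<le> card (multiples (active_users K s) E)" by (simp add: A)
    have "real K < real E * real (K div E) + real E"
      using dividend_less_times_div[of E K] E by (simp flip: of_nat_mult of_nat_add)
    then have "1 / real E * real K - 1 \<le> real (K div E)"
      using E by (simp add: field_simps)
    with le show ?thesis by linarith
  qed
  then have "measure_pmf.expectation ?p (\<lambda>s. 1 / real E * real K - 1)
      \<le> measure_pmf.expectation ?p (\<lambda>s. real (card (multiples (active_users K s) E)))"
    by (intro integral_mono_AE integrable_measure_pmf_finite finite_set_activity) (simp add: AE_measure_pmf_iff)
  then show ?thesis by simp
qed

text \<open>Mean of \<open>sum_rate_bound\<close> over the pattern. The URLLC rate is the same in
  all patterns, so it is multiplied by the mean number of URLLC users; the constants are averaged as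
  well.\<close>

lemma achievable_sum_bound:
  assumes K: "0 < K" and h: "\<And>k. 1 \<le> k \<Longrightarrow> 0 < h k (k + 1) \<and> 0 < h (k + 1) k"
    and \<rho>: "0 \<le> \<rho>" "\<rho> \<le> 1" "0 \<le> \<rho>\<^sub>f" "\<rho>\<^sub>f \<le> 1"
    and mult: "m \<le> measure_pmf.expectation (activity_pmf \<rho> \<rho>\<^sub>f K)
      (\<lambda>s. real (card (multiples (active_users K s) (D + 2))))"
  obtains C where "\<And>P RU Rbar. 1 \<le> P \<Longrightarrow> achievable_rates h \<rho> \<rho>\<^sub>f D K P RU Rbar \<Longrightarrow>
    real K * (Rbar + \<rho> * \<rho>\<^sub>f * RU) \<le> (real K * \<rho> - m) / 2 * log 2 P + C"
proof -
  let ?p = "activity_pmf \<rho> \<rho>\<^sub>f K"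
  let ?A = "\<lambda>s. real (card (active_users K s))" and ?U = "\<lambda>s. real (card (urllc_users K s))"
  let ?M = "\<lambda>s. real (card (multiples (active_users K s) (D + 2)))"
  have "\<exists>C. \<forall>P R RU. 1 \<le> P \<longrightarrow> reliable h \<rho> \<rho>\<^sub>f D K P R RU \<longrightarrow>
    (\<Sum>k\<in>embb_users K s. R s k) + ?U s * RU \<le> (?A s - ?M s) / 2 * log 2 P + C"
    if "s \<in> set_pmf ?p" for s
    using sum_rate_bound[where h = h, OF K h that, of D] by metis
  then obtain C where C: "\<And>s P R RU. s \<in> set_pmf ?p \<Longrightarrow> 1 \<le> P \<Longrightarrow> reliable h \<rho> \<rho>\<^sub>f D K P R RU \<Longrightarrow>
    (\<Sum>k\<in>embb_users K s. R s k) + ?U s * RU \<le> (?A s - ?M s) / 2 * log 2 P + C s"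
    by metis
  have int: "integrable (measure_pmf ?p) f" for f :: "activity \<Rightarrow> real"
    by (rule integrable_measure_pmf_finite[OF finite_set_activity])
  have EA: "measure_pmf.expectation ?p ?A = real K * \<rho>"
    unfolding active_users_def using \<rho>
    by (subst expectation_card_users) (simp add: expectation_user_active)
  have EU: "measure_pmf.expectation ?p ?U = real K * (\<rho> * \<rho>\<^sub>f)"
    unfolding urllc_users_def using \<rho>
    by (subst expectation_card_users[where Q = "\<lambda>a. fst a \<and> snd a"]) (simp add: expectation_user_urllc)
  show thesis
  proof (rule that[of "measure_pmf.expectation ?p C"])
    fix P RU Rbar assume P: "1 \<le> P" and ach: "achievable_rates h \<rho> \<rho>\<^sub>f D K P RU Rbar"
    obtain R where rel: "reliable h \<rho> \<rho>\<^sub>f D K P R RU" and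
      Rbar: "Rbar \<le> measure_pmf.expectation ?p (\<lambda>s. (1 / real K) * (\<Sum>k\<in>embb_users K s. R s k))"
      using ach unfolding achievable_rates_def reliable_def by blast
    have "real K * Rbar \<le> measure_pmf.expectation ?p (\<lambda>s. \<Sum>k\<in>embb_users K s. R s k)"
      using Rbar K by (simp add: field_simps)
    then have "real K * (Rbar + \<rho> * \<rho>\<^sub>f * RU)
        \<le> measure_pmf.expectation ?p (\<lambda>s. \<Sum>k\<in>embb_users K s. R s k) + measure_pmf.expectation ?p ?U * RU"
      unfolding EU by (simp add: algebra_simps)
    also have "\<dots> = measure_pmf.expectation ?p (\<lambda>s. (\<Sum>k\<in>embb_users K s. R s k) + ?U s * RU)"
      by (subst Bochner_Integration.integral_add) (auto intro!: int)
    also have "\<dots> \<le> measure_pmf.expectation ?p (\<lambda>s. (?A s - ?M s) / 2 * log 2 P + C s)"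
      by (intro integral_mono_AE int) (use C P rel in \<open>simp add: AE_measure_pmf_iff\<close>)
    also have "\<dots> = (measure_pmf.expectation ?p ?A - measure_pmf.expectation ?p ?M) / 2 * log 2 P
        + measure_pmf.expectation ?p C"
      by (simp add: int)
    also have "\<dots> \<le> (real K * \<rho> - m) / 2 * log 2 P + measure_pmf.expectation ?p C"
      unfolding EA using mult P by (intro add_right_mono mult_right_mono divide_right_mono diff_left_mono) auto
    finally show "real K * (Rbar + \<rho> * \<rho>\<^sub>f * RU) \<le> (real K * \<rho> - m) / 2 * log 2 P + measure_pmf.expectation ?p C" .
  qed
qed

text \<open>As the URLLC rate does not depend on the pattern, one pattern of positive probability
  suffices; the one with URLLC messages at all users is taken.\<close>

lemma achievable_urllc_bound:
  assumes K: "2 \<le> K" and h: "0 < h 2 1"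
    and \<rho>: "0 < \<rho>" "\<rho> \<le> 1" "0 < \<rho>\<^sub>f" "\<rho>\<^sub>f \<le> 1"
  obtains C where "\<And>P RU Rbar. 1 \<le> P \<Longrightarrow> achievable_rates h \<rho> \<rho>\<^sub>f D K P RU Rbar \<Longrightarrow>
    2 * RU \<le> 1 / 2 * log 2 P + C"
proof -
  define s :: activity where "s k = (if k \<in> {1..K} then (True, True) else (False, False))" for k
  have "(True, True) \<in> set_pmf (user_pmf \<rho> \<rho>\<^sub>f)"
  proof -
    have "True \<in> set_pmf (bernoulli_pmf p)" if "0 < p" "p \<le> 1" for p
      using that by (simp add: set_pmf_iff)
    then show ?thesis using \<rho> unfolding user_pmf_def by (auto intro!: bexI[of _ True])
  qed
  then have s: "s \<in> set_pmf (activity_pmf \<rho> \<rho>\<^sub>f K)"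
    unfolding activity_pmf_def by (auto simp: set_Pi_pmf PiE_dflt_def s_def)
  have "1 \<in> urllc_users K s" "2 \<in> urllc_users K s"
    using K by (auto simp: urllc_users_def s_def)
  then obtain C where C: "\<And>P R RU. 1 \<le> P \<Longrightarrow> reliable h \<rho> \<rho>\<^sub>f D K P R RU \<Longrightarrow> 2 * RU \<le> 1 / 2 * log 2 P + C"
    using urllc_rate_bound[where h = h, OF K h s, of D] by metis
  show thesis
  proof (rule that[of C])
    fix P RU Rbar assume "1 \<le> P" "achievable_rates h \<rho> \<rho>\<^sub>f D K P RU Rbar"
    then show "2 * RU \<le> 1 / 2 * log 2 P + C"
      using C unfolding achievable_rates_def reliable_def by blast
  qed
qed

section \<open>Multiplexing gains\<close>

lemma tendsto_const_over_log: "((\<lambda>P. C / (1 / 2 * log 2 P)) \<longlongrightarrow> 0) at_top"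
proof -
  have "filterlim (\<lambda>P::real. 1 / (2 * ln 2) * ln P) at_top at_top"
    by (rule filterlim_tendsto_pos_mult_at_top[OF tendsto_const _ ln_at_top]) simp
  then have "filterlim (\<lambda>P::real. 1 / 2 * log 2 P) at_infinity at_top"
    by (intro filterlim_at_top_imp_at_infinity) (simp add: log_def)
  then show ?thesis by (rule tendsto_divide_0[OF tendsto_const])
qed

lemma pre_log_le:
  assumes P: "1 < P" and "a * R K P \<le> b / 2 * log 2 P + C" and a: "0 < a"
  shows "pre_log R K P \<le> ereal (b / a + (C / a) / (1 / 2 * log 2 P))"
proof -
  have l: "0 < 1 / 2 * log 2 P" using P by simp
  have "R K P \<le> (b / 2 * log 2 P + C) / a"
    using assms by (simp add: field_simps)
  then have "R K P / (1 / 2 * log 2 P) \<le> (b / 2 * log 2 P + C) / a / (1 / 2 * log 2 P)"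
    using l by (intro divide_right_mono) auto
  also have "\<dots> = b / a + (C / a) / (1 / 2 * log 2 P)"
    using l a by (simp add: field_simps)
  finally show ?thesis by (simp add: pre_log_def)
qed

lemma tendsto_pre_log_bound:
  assumes "filterlim p at_top F"
  shows "((\<lambda>i. ereal (b + C / (1 / 2 * log 2 (p i)))) \<longlongrightarrow> ereal b) F"
proof -
  have "((\<lambda>i. b + C / (1 / 2 * log 2 (p i))) \<longlongrightarrow> b + 0) F"
    by (intro tendsto_add tendsto_const filterlim_compose[OF tendsto_const_over_log assms])
  then show ?thesis by simp
qed

text \<open>\<open>\<tau>\<close> is a lower estimate for the fraction of discarded outputs, and
  \<open>c\<close> is a border effect that vanishes after division by \<open>K\<close>. The bounds
  for fixed \<open>K\<close> and \<open>P\<close> pass to the limit along the common sequences,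
  first in \<open>P\<close> and then in \<open>K\<close>.\<close>

lemma achievable_mg_pair_bounds:
  assumes mg: "achievable_mg_pair h \<rho> \<rho>\<^sub>f D SU Se"
    and h: "\<And>k. 1 \<le> k \<Longrightarrow> 0 < h k (k + 1) \<and> 0 < h (k + 1) k"
    and \<rho>: "0 < \<rho>" "\<rho> \<le> 1" "0 \<le> \<rho>\<^sub>f" "\<rho>\<^sub>f \<le> 1"
    and mult: "\<And>K. 1 \<le> K \<Longrightarrow> \<tau> * real K - c \<le> measure_pmf.expectation (activity_pmf \<rho> \<rho>\<^sub>f K)
      (\<lambda>s. real (card (multiples (active_users K s) (D + 2))))"
  shows "SU \<le> ereal (\<rho> * \<rho>\<^sub>f / 2) \<and> Se + SU \<le> ereal (\<rho> - \<tau>)"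
proof -
  obtain RU Rbar where
    ach: "\<And>K P. 1 \<le> K \<Longrightarrow> 0 < P \<Longrightarrow> achievable_rates h \<rho> \<rho>\<^sub>f D K P (RU K P) (Rbar K P)" and
    SU: "SU = ereal (\<rho> * \<rho>\<^sub>f) * upper_pre_log RU" and Se: "Se = upper_pre_log Rbar" and
    joint: "jointly_attained RU Rbar"
    using mg unfolding achievable_mg_pair_def by blast
  define v where "v = \<rho> * \<rho>\<^sub>f"
  have v: "0 \<le> v" using \<rho> by (simp add: v_def)
  have sum_le: "\<exists>C. \<forall>P>1. ereal v * pre_log RU K P + pre_log Rbar K P
      \<le> ereal ((\<rho> - \<tau> + c / real K) + C / (1 / 2 * log 2 P))" if K: "1 \<le> K" for K
  proof -
    obtain C where C: "\<And>P RU Rbar. 1 \<le> P \<Longrightarrow> achievable_rates h \<rho> \<rho>\<^sub>f D K P RU Rbar \<Longrightarrow>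
        real K * (Rbar + \<rho> * \<rho>\<^sub>f * RU) \<le> (real K * \<rho> - (\<tau> * real K - c)) / 2 * log 2 P + C"
      using achievable_sum_bound[where h = h and K = K, OF _ h _ _ _ _ mult[OF K]] K \<rho> by auto
    have "ereal v * pre_log RU K P + pre_log Rbar K P
        \<le> ereal ((\<rho> - \<tau> + c / real K) + (C / real K) / (1 / 2 * log 2 P))" if P: "1 < P" for P
    proof -
      let ?R = "\<lambda>K P. Rbar K P + v * RU K P"
      have "pre_log ?R K P \<le> ereal ((real K * \<rho> - (\<tau> * real K - c)) / real K
          + (C / real K) / (1 / 2 * log 2 P))"
        using C[OF _ ach[OF K]] P K by (intro pre_log_le) (auto simp: v_def)
      moreover have "(real K * \<rho> - (\<tau> * real K - c)) / real K = \<rho> - \<tau> + c / real K"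
        using K by (simp add: field_simps)
      moreover have "pre_log ?R K P = ereal v * pre_log RU K P + pre_log Rbar K P"
        by (simp add: pre_log_def add_divide_distrib)
      ultimately show ?thesis by simp
    qed
    then show ?thesis by blast
  qed
  have urllc_le: "\<exists>C. \<forall>P>1. 0 \<le> pre_log RU K P \<and>
      pre_log RU K P \<le> ereal (1 / 2 + C / (1 / 2 * log 2 P))" if K: "2 \<le> K" and "0 < v" for K
  proof -
    have \<rho>f: "0 < \<rho>\<^sub>f" using that \<rho> by (simp add: v_def zero_less_mult_iff)
    have "0 < h 2 1" using h[of 1] by (simp add: numeral_2_eq_2)
    then obtain C where C: "\<And>P RU Rbar. 1 \<le> P \<Longrightarrow> achievable_rates h \<rho> \<rho>\<^sub>f D K P RU Rbar \<Longrightarrow>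
        2 * RU \<le> 1 / 2 * log 2 P + C"
      using achievable_urllc_bound[where h = h and K = K and D = D, OF K _ \<rho>(1,2) \<rho>f \<rho>(4)] by metis
    have "0 \<le> pre_log RU K P \<and> pre_log RU K P \<le> ereal (1 / 2 + (C / 2) / (1 / 2 * log 2 P))"
      if P: "1 < P" for P
    proof
      have a: "achievable_rates h \<rho> \<rho>\<^sub>f D K P (RU K P) (Rbar K P)"
        using P K by (intro ach) auto
      then have "0 \<le> RU K P" unfolding achievable_rates_def by blast
      then show "0 \<le> pre_log RU K P" using P by (simp add: pre_log_def)
      show "pre_log RU K P \<le> ereal (1 / 2 + (C / 2) / (1 / 2 * log 2 P))"
        using C[OF _ a] P by (intro pre_log_le) auto
    qed
    then show ?thesis by blast
  qed
  have U_bounds: "0 \<le> upper_pre_log RU \<and> upper_pre_log RU \<le> ereal (1 / 2)" if v0: "0 < v"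
  proof -
    have "0 \<le> Limsup at_top (pre_log RU K) \<and> Limsup at_top (pre_log RU K) \<le> ereal (1 / 2)"
      if K: "2 \<le> K" for K
    proof
      obtain C where C: "\<And>P. 1 < P \<Longrightarrow> 0 \<le> pre_log RU K P \<and>
          pre_log RU K P \<le> ereal (1 / 2 + C / (1 / 2 * log 2 P))"
        using urllc_le[OF K v0] by blast
      have ev: "\<forall>\<^sub>F P in at_top. 1 < (P :: real)" by (rule eventually_gt_at_top)
      show "0 \<le> Limsup at_top (pre_log RU K)"
        by (rule le_Limsup[OF _ eventually_mono[OF ev]]) (use C in auto)
      have "Limsup at_top (pre_log RU K) \<le> Limsup at_top (\<lambda>P. ereal (1 / 2 + C / (1 / 2 * log 2 P)))"
        by (rule Limsup_mono[OF eventually_mono[OF ev]]) (use C in auto)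
      also have "\<dots> = ereal (1 / 2)"
        by (rule lim_imp_Limsup[OF _ tendsto_pre_log_bound[OF filterlim_ident]]) simp
      finally show "Limsup at_top (pre_log RU K) \<le> ereal (1 / 2)" .
    qed
    note bd = this
    have ev: "\<forall>\<^sub>F K in sequentially. 2 \<le> (K :: nat)" by (rule eventually_ge_at_top)
    show ?thesis
      unfolding upper_pre_log_def
    proof
      show "0 \<le> limsup (\<lambda>K. Limsup at_top (pre_log RU K))"
        by (rule le_Limsup[OF _ eventually_mono[OF ev]]) (use bd in auto)
      show "limsup (\<lambda>K. Limsup at_top (pre_log RU K)) \<le> ereal (1 / 2)"
        by (rule Limsup_bounded[OF eventually_mono[OF ev]]) (use bd in auto)
    qed
  qed
  have SU_le: "SU \<le> ereal (\<rho> * \<rho>\<^sub>f / 2)"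
  \<comment> \<open>For \<open>v = 0\<close> the URLLC rate is unrestricted, but the product of
    \<open>0\<close> with an infinite upper limit is still \<open>0\<close>.\<close>
  proof (cases "v = 0")
    case True
    then show ?thesis by (simp add: SU flip: v_def zero_ereal_def)
  next
    case False
    then have "ereal v * upper_pre_log RU \<le> ereal v * ereal (1 / 2)"
      using U_bounds v by (intro ereal_mult_left_mono) auto
    then show ?thesis by (simp add: SU v_def)
  qed
  obtain \<kappa> p u u' where \<kappa>: "filterlim \<kappa> at_top sequentially" and
    p: "\<And>j. filterlim (p j) at_top sequentially" and
    u: "\<And>j. (\<lambda>i. pre_log RU (\<kappa> j) (p j i)) \<longlonglongrightarrow> u j" and
    u': "\<And>j. (\<lambda>i. pre_log Rbar (\<kappa> j) (p j i)) \<longlonglongrightarrow> u' j" and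
    lim: "u \<longlonglongrightarrow> upper_pre_log RU" "u' \<longlonglongrightarrow> upper_pre_log Rbar"
    using joint unfolding jointly_attained_def by blast
  have p1: "\<forall>\<^sub>F i in sequentially. 1 < p j i" for j
    using p[of j] by (simp add: filterlim_at_top_dense)
  have at_size: "ereal v * u j + u' j \<le> ereal (\<rho> - \<tau> + c / real (\<kappa> j))" if K: "2 \<le> \<kappa> j" for j
  proof -
    \<comment> \<open>Finiteness of the URLLC part rules out
      \<open>\<infinity> - \<infinity>\<close> in the limit of the sum; the eMBB part may tend to
      \<open>-\<infinity>\<close>, because \<open>Rbar\<close> is bounded only from above.\<close>
    have fin: "\<bar>ereal v * u j\<bar> \<noteq> \<infinity>"
    proof (cases "v = 0")
      case False
      then obtain C where C: "\<And>P. 1 < P \<Longrightarrow> 0 \<le> pre_log RU (\<kappa> j) P \<and>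
          pre_log RU (\<kappa> j) P \<le> ereal (1 / 2 + C / (1 / 2 * log 2 P))"
        using urllc_le[OF K] v by force
      have "u j \<le> ereal (1 / 2)"
        by (rule tendsto_le[OF trivial_limit_sequentially
              tendsto_pre_log_bound[where C = C, OF p[of j]] u eventually_mono[OF p1]])
          (use C in auto)
      moreover have "0 \<le> u j"
        by (rule tendsto_lowerbound[OF u eventually_mono[OF p1]]) (use C in auto)
      ultimately show ?thesis by (cases "u j") auto
    qed (simp flip: zero_ereal_def)
    obtain C where C: "\<And>P. 1 < P \<Longrightarrow> ereal v * pre_log RU (\<kappa> j) P + pre_log Rbar (\<kappa> j) P
      \<le> ereal ((\<rho> - \<tau> + c / real (\<kappa> j)) + C / (1 / 2 * log 2 P))"
      using sum_le[of "\<kappa> j"] K by auto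
    have "(\<lambda>i. ereal v * pre_log RU (\<kappa> j) (p j i) + pre_log Rbar (\<kappa> j) (p j i))
        \<longlonglongrightarrow> ereal v * u j + u' j"
      by (intro tendsto_add_ereal_general2 tendsto_cmult_ereal u u' fin) simp
    then show ?thesis
      by (rule tendsto_le[OF trivial_limit_sequentially
            tendsto_pre_log_bound[where C = C, OF p[of j]] _ eventually_mono[OF p1]])
        (use C in auto)
  qed
  have finU: "\<bar>ereal v * upper_pre_log RU\<bar> \<noteq> \<infinity>"
  proof (cases "v = 0")
    case False
    then show ?thesis using U_bounds v by (cases "upper_pre_log RU") auto
  qed (simp flip: zero_ereal_def)
  have "(\<lambda>j. ereal v * u j + u' j) \<longlonglongrightarrow> ereal v * upper_pre_log RU + upper_pre_log Rbar"
    by (intro tendsto_add_ereal_general2 tendsto_cmult_ereal lim finU) simp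
  moreover have "(\<lambda>j. ereal (\<rho> - \<tau> + c / real (\<kappa> j))) \<longlonglongrightarrow> ereal (\<rho> - \<tau>)"
  proof -
    have "(\<lambda>j. c / real (\<kappa> j)) \<longlonglongrightarrow> 0"
      by (intro tendsto_divide_0[OF tendsto_const] filterlim_at_top_imp_at_infinity
          filterlim_compose[OF filterlim_real_sequentially \<kappa>])
    then have "(\<lambda>j. \<rho> - \<tau> + c / real (\<kappa> j)) \<longlonglongrightarrow> \<rho> - \<tau> + 0"
      by (intro tendsto_add tendsto_const)
    then show ?thesis by simp
  qed
  moreover have "\<forall>\<^sub>F j in sequentially. ereal v * u j + u' j \<le> ereal (\<rho> - \<tau> + c / real (\<kappa> j))"
  proof -
    have "\<forall>\<^sub>F j in sequentially. 2 \<le> \<kappa> j" using \<kappa> by (simp add: filterlim_at_top)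
    then show ?thesis by (rule eventually_mono) (rule at_size)
  qed
  ultimately have "ereal v * upper_pre_log RU + upper_pre_log Rbar \<le> ereal (\<rho> - \<tau>)"
    by (intro tendsto_le[OF trivial_limit_sequentially])
  then show ?thesis using SU_le by (simp add: SU Se v_def add.commute)
qed

theorem theorem2:
  fixes h :: "nat \<Rightarrow> nat \<Rightarrow> real" and \<rho> \<rho>\<^sub>f :: real and D :: nat and SU Se :: ereal
  assumes "0 < D" and "even D"
    and "0 \<le> \<rho>\<^sub>f" and "\<rho>\<^sub>f \<le> 1"
    and "\<forall>k\<ge>1. 0 \<le> h k k"
    and "\<forall>k\<ge>1. 0 < h k (k + 1) \<and> 0 < h (k + 1) k"
    and "achievable_mg_pair h \<rho> \<rho>\<^sub>f D SU Se"
  shows "(0 < \<rho> \<and> \<rho> < 1 \<longrightarrow>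
            SU \<le> ereal (\<rho> * \<rho>\<^sub>f / 2) \<and>
            Se + SU \<le> ereal (\<rho> - (1 - \<rho>) * \<rho> ^ (D + 2) / (1 - \<rho> ^ (D + 2)))) \<and>
         (\<rho> = 1 \<longrightarrow>
            SU \<le> ereal (\<rho> * \<rho>\<^sub>f / 2) \<and>
            Se + SU \<le> ereal (\<rho> * (real (D + 1) / real (D + 2))))"
proof (intro conjI[of "_ \<longrightarrow> _"] impI)
  have h: "0 < h k (k + 1) \<and> 0 < h (k + 1) k" if "1 \<le> k" for k
    using assms(6) that by blast
  {
    assume \<rho>: "0 < \<rho> \<and> \<rho> < 1"
    show "SU \<le> ereal (\<rho> * \<rho>\<^sub>f / 2) \<and>
      Se + SU \<le> ereal (\<rho> - (1 - \<rho>) * \<rho> ^ (D + 2) / (1 - \<rho> ^ (D + 2)))"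
      using \<rho> by (intro achievable_mg_pair_bounds[OF assms(7) h _ _ assms(3,4)
            expectation_multiples_linear]) auto
  }
  assume \<rho>: "\<rho> = 1"
  \<comment> \<open>One output in \<open>D + 2\<close> is discarded, with border constant
    \<open>1\<close>.\<close>
  have "SU \<le> ereal (\<rho> * \<rho>\<^sub>f / 2) \<and> Se + SU \<le> ereal (\<rho> - 1 / real (D + 2))"
    unfolding \<rho> by (intro achievable_mg_pair_bounds[OF assms(7)[unfolded \<rho>] h _ _ assms(3,4)
          expectation_multiples_all_active]) auto
  moreover have "\<rho> - 1 / real (D + 2) = \<rho> * (real (D + 1) / real (D + 2))"
    unfolding \<rho> by (simp add: field_simps)
  ultimately show "SU \<le> ereal (\<rho> * \<rho>\<^sub>f / 2) \<and> Se + SU \<le> ereal (\<rho> * (real (D + 1) / real (D + 2)))"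
    by simp
qed

end
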